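(* Let $\mathcal X_1,\ldots,\mathcal X_n$ be finitely many o-minimal structures and let $G$ be an abelian group definable in their disjoint union $\bigsqcup_i \mathcal X_i$. Then there is a locally definable isomorphism $$G\cong G_1\times\cdots\times G_n/\Gamma,$$ where each $G_i$ is a locally definable and definably generated group in $\mathcal X_i$, and $\Gamma$ is a compatible locally definable discrete subgroup of $G_1\times\cdots\times G_n$.
   Context: The disjoint union $\bigsqcup_i\mathcal X_i$ is the multi-sorted structure with one sort for each $\mathcal X_i$, whose basic relations are the definable sets of the individual structures $\mathcal X_i$. "Definable" means definable with parameters. A locally definable set is a countable union of definable sets together with a given presentation as such a union; a subset of it is called definable if it is definable and contained in the union of finitely many sets of the presentation. A compatible subset of a locally definable set $X$ is a subset whose intersection with every definable subset of $X$ is definable; it is discrete if its intersection with every definable subset of $X$ is finite. A locally definable function is a function between locally definable sets whose restriction to each definable subset is definable. A locally definable group is a locally definable set with a locally definable group operation; compatible/discrete subgroups and locally definable homomorphisms are defined accordingly. A locally definable group is definably generated if it is generated by a definable subset. The isomorphism asserted means a locally definable group isomorphism between $G$ and the quotient of $G_1\times\cdots\times G_n$ by $\Gamma$ (equivalently, a surjective locally definable homomorphism $G_1\times\cdots\times G_n\to G$ with kernel $\Gamma$). *)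

theory Defs
  imports
    "HOL-Algebra.Product_Groups"
    "HOL-Algebra.Weak_Morphisms"
    "HOL-Library.Countable_Set"
begin

section \<open>Many-sorted structures and definable sets\<close>

text \<open>
  A relational first-order structure with sorts in \<open>'s\<close> and elements in \<open>'a\<close>. A basic relation
  is a pair of its arity (a list of sorts) and its extension (a set of tuples, written as lists);
  it serves as its own relation symbol. A function or constant of a structure is represented by
  its graph, which does not change the definable sets.
  The universes of different sorts are sets in the same type and may overlap; sorting is enforced
  by well-formedness of formulas, so elements of different sorts are never compared.
\<close>

record ('s, 'a) fo_structure =
  sorts :: "'s set"
  univ :: "'s \<Rightarrow> 'a set"
  rels :: "('s list \<times> 'a list set) set"

definition tuples :: "('s, 'a) fo_structure \<Rightarrow> 's list \<Rightarrow> 'a list set" where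
  "tuples M w = {xs. list_all2 (\<lambda>a s. a \<in> univ M s) xs w}"

definition is_structure :: "('s, 'a) fo_structure \<Rightarrow> bool" where
  "is_structure M \<longleftrightarrow>
     (\<forall>s\<in>sorts M. univ M s \<noteq> {}) \<and>
     (\<forall>(w, R)\<in>rels M. set w \<subseteq> sorts M \<and> R \<subseteq> tuples M w)"

text \<open>
  Terms are variables (de Bruijn indices into the current environment) and parameters; the
  sort in \<open>Equal\<close> and \<open>Exists\<close> is the sort of the compared terms and of the bound variable.
\<close>

datatype 'a tm = Var nat | Par 'a

datatype ('s, 'a) fm =
    Rel "'s list" "'a list set" "'a tm list"
  | Equal 's "'a tm" "'a tm"
  | Neg "('s, 'a) fm"
  | Conj "('s, 'a) fm" "('s, 'a) fm"
  | Exists 's "('s, 'a) fm"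

fun wf_tm :: "('s, 'a) fo_structure \<Rightarrow> 's list \<Rightarrow> 'a tm \<Rightarrow> 's \<Rightarrow> bool" where
  "wf_tm M \<Delta> (Var k) s \<longleftrightarrow> k < length \<Delta> \<and> \<Delta> ! k = s"
| "wf_tm M \<Delta> (Par a) s \<longleftrightarrow> s \<in> sorts M \<and> a \<in> univ M s"

fun wf_fm :: "('s, 'a) fo_structure \<Rightarrow> 's list \<Rightarrow> ('s, 'a) fm \<Rightarrow> bool" where
  "wf_fm M \<Delta> (Rel w R ts) \<longleftrightarrow> (w, R) \<in> rels M \<and> list_all2 (wf_tm M \<Delta>) ts w"
| "wf_fm M \<Delta> (Equal s t u) \<longleftrightarrow> wf_tm M \<Delta> t s \<and> wf_tm M \<Delta> u s"
| "wf_fm M \<Delta> (Neg \<phi>) \<longleftrightarrow> wf_fm M \<Delta> \<phi>"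
| "wf_fm M \<Delta> (Conj \<phi> \<psi>) \<longleftrightarrow> wf_fm M \<Delta> \<phi> \<and> wf_fm M \<Delta> \<psi>"
| "wf_fm M \<Delta> (Exists s \<phi>) \<longleftrightarrow> s \<in> sorts M \<and> wf_fm M (s # \<Delta>) \<phi>"

fun val :: "'a list \<Rightarrow> 'a tm \<Rightarrow> 'a" where
  "val e (Var k) = e ! k"
| "val e (Par a) = a"

fun sat :: "('s, 'a) fo_structure \<Rightarrow> 'a list \<Rightarrow> ('s, 'a) fm \<Rightarrow> bool" where
  "sat M e (Rel w R ts) \<longleftrightarrow> map (val e) ts \<in> R"
| "sat M e (Equal s t u) \<longleftrightarrow> val e t = val e u"
| "sat M e (Neg \<phi>) \<longleftrightarrow> \<not> sat M e \<phi>"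
| "sat M e (Conj \<phi> \<psi>) \<longleftrightarrow> sat M e \<phi> \<and> sat M e \<psi>"
| "sat M e (Exists s \<phi>) \<longleftrightarrow> (\<exists>a\<in>univ M s. sat M (a # e) \<phi>)"

definition definable :: "('s, 'a) fo_structure \<Rightarrow> 's list \<Rightarrow> 'a list set \<Rightarrow> bool" where
  "definable M w D \<longleftrightarrow>
     set w \<subseteq> sorts M \<and> (\<exists>\<phi>. wf_fm M w \<phi> \<and> D = {xs \<in> tuples M w. sat M xs \<phi>})"


section \<open>O-minimal structures and their disjoint union\<close>

text \<open>A one-sorted structure is a structure whose type of sorts is \<open>unit\<close>.\<close>

inductive_set points_and_intervals :: "'a set \<Rightarrow> 'a rel \<Rightarrow> 'a set set"
  for A :: "'a set" and r :: "'a rel" where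
  point: "a \<in> A \<Longrightarrow> {a} \<in> points_and_intervals A r"
| bounded: "a \<in> A \<Longrightarrow> b \<in> A \<Longrightarrow> {x \<in> A. (a, x) \<in> r \<and> (x, b) \<in> r} \<in> points_and_intervals A r"
| above: "a \<in> A \<Longrightarrow> {x \<in> A. (a, x) \<in> r} \<in> points_and_intervals A r"
| below: "b \<in> A \<Longrightarrow> {x \<in> A. (x, b) \<in> r} \<in> points_and_intervals A r"
| all: "A \<in> points_and_intervals A r"

text \<open>
  As usual, the order of an o-minimal structure is one of its basic relations and is dense
  without endpoints.
\<close>

definition o_minimal :: "(unit, 'a) fo_structure \<Rightarrow> bool" where
  "o_minimal M \<longleftrightarrow> is_structure M \<and> sorts M = {()} \<and>
     (\<exists>r. r \<subseteq> univ M () \<times> univ M () \<and> strict_linear_order_on (univ M ()) r \<and>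
        (\<forall>(a, b)\<in>r. \<exists>c. (a, c) \<in> r \<and> (c, b) \<in> r) \<and>
        (\<forall>a\<in>univ M (). (\<exists>b. (b, a) \<in> r) \<and> (\<exists>b. (a, b) \<in> r)) \<and>
        ([(), ()], {[a, b] | a b. (a, b) \<in> r}) \<in> rels M \<and>
        (\<forall>D. definable M [()] D \<longrightarrow>
           (\<exists>F. finite F \<and> F \<subseteq> points_and_intervals (univ M ()) r \<and> D = (\<lambda>a. [a]) ` \<Union>F)))"

definition disjoint_union :: "nat \<Rightarrow> (nat \<Rightarrow> (unit, 'a) fo_structure) \<Rightarrow> (nat, 'a) fo_structure" where
  "disjoint_union n M =
     \<lparr>sorts = {1..n},
      univ = (\<lambda>i. univ (M i) ()),
      rels = {(map (\<lambda>_. i) w, D) | i w D. i \<in> {1..n} \<and> definable (M i) w D}\<rparr>"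

definition definable_group :: "('s, 'a) fo_structure \<Rightarrow> 's list \<Rightarrow> 'a list monoid \<Rightarrow> bool" where
  "definable_group M w G \<longleftrightarrow> group G \<and> definable M w (carrier G) \<and>
     definable M (w @ w @ w) {x @ y @ (x \<otimes>\<^bsub>G\<^esub> y) | x y. x \<in> carrier G \<and> y \<in> carrier G}"


section \<open>Locally definable sets and groups\<close>

text \<open>
  The data of a locally definable set: the arity of the ambient product of sorts, and the
  presentation.
\<close>

record ('s, 'a) ld_data =
  arity :: "'s list"
  pieces :: "'a list set set"

definition ld_set :: "('s, 'a) fo_structure \<Rightarrow> ('s, 'a) ld_data \<Rightarrow> bool" where
  "ld_set M S \<longleftrightarrow> countable (pieces S) \<and> (\<forall>P\<in>pieces S. definable M (arity S) P)"

definition points :: "('s, 'a) ld_data \<Rightarrow> 'a list set" where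
  "points S = \<Union> (pieces S)"

definition definable_subset :: "('s, 'a) fo_structure \<Rightarrow> ('s, 'a) ld_data \<Rightarrow> 'a list set \<Rightarrow> bool" where
  "definable_subset M S D \<longleftrightarrow>
     definable M (arity S) D \<and> (\<exists>F. finite F \<and> F \<subseteq> pieces S \<and> D \<subseteq> \<Union>F)"

definition ld_subset :: "('s, 'a) fo_structure \<Rightarrow> ('s, 'a) ld_data \<Rightarrow> 'a list set \<Rightarrow> bool" where
  "ld_subset M S Y \<longleftrightarrow>
     (\<exists>\<Q>. countable \<Q> \<and> (\<forall>Q\<in>\<Q>. definable_subset M S Q) \<and> Y = \<Union>\<Q>)"

definition compatible_subset :: "('s, 'a) fo_structure \<Rightarrow> ('s, 'a) ld_data \<Rightarrow> 'a list set \<Rightarrow> bool" where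
  "compatible_subset M S Y \<longleftrightarrow>
     Y \<subseteq> points S \<and> (\<forall>D. definable_subset M S D \<longrightarrow> definable_subset M S (Y \<inter> D))"

definition discrete_subset :: "('s, 'a) fo_structure \<Rightarrow> ('s, 'a) ld_data \<Rightarrow> 'a list set \<Rightarrow> bool" where
  "discrete_subset M S Y \<longleftrightarrow>
     compatible_subset M S Y \<and> (\<forall>D. definable_subset M S D \<longrightarrow> finite (Y \<inter> D))"

definition ld_prod :: "('s, 'a) ld_data \<Rightarrow> ('s, 'a) ld_data \<Rightarrow> ('s, 'a) ld_data" where
  "ld_prod S T =
     \<lparr>arity = arity S @ arity T,
      pieces = {{x @ y | x y. x \<in> P \<and> y \<in> Q} | P Q. P \<in> pieces S \<and> Q \<in> pieces T}\<rparr>"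

text \<open>
  The graph of \<open>f\<close> on a definable subset has to be a definable subset of the locally definable
  set \<open>S \<times> T\<close>; so \<open>f\<close> sends definable subsets of \<open>S\<close> into finitely many pieces of \<open>T\<close>.
\<close>

definition ld_function ::
  "('s, 'a) fo_structure \<Rightarrow> ('s, 'a) ld_data \<Rightarrow> ('s, 'a) ld_data \<Rightarrow> ('a list \<Rightarrow> 'a list) \<Rightarrow> bool" where
  "ld_function M S T f \<longleftrightarrow> f \<in> points S \<rightarrow> points T \<and>
     (\<forall>D. definable_subset M S D \<longrightarrow> definable_subset M (ld_prod S T) {x @ f x | x. x \<in> D})"

text \<open>A pair of points of \<open>S\<close> is the concatenation of two lists of length \<open>length (arity S)\<close>.\<close>

definition ld_group :: "('s, 'a) fo_structure \<Rightarrow> ('s, 'a) ld_data \<Rightarrow> 'a list monoid \<Rightarrow> bool" where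
  "ld_group M S G \<longleftrightarrow> group G \<and> ld_set M S \<and> carrier G = points S \<and>
     ld_function M (ld_prod S S) S
       (\<lambda>z. take (length (arity S)) z \<otimes>\<^bsub>G\<^esub> drop (length (arity S)) z)"

definition definably_generated ::
  "('s, 'a) fo_structure \<Rightarrow> ('s, 'a) ld_data \<Rightarrow> 'a list monoid \<Rightarrow> bool" where
  "definably_generated M S G \<longleftrightarrow> (\<exists>D. definable_subset M S D \<and> generate G D = carrier G)"

definition ld_hom ::
  "('s, 'a) fo_structure \<Rightarrow> ('s, 'a) ld_data \<Rightarrow> 'a list monoid \<Rightarrow>
   ('s, 'a) ld_data \<Rightarrow> 'a list monoid \<Rightarrow> ('a list \<Rightarrow> 'a list) \<Rightarrow> bool" where
  "ld_hom M S G T H f \<longleftrightarrow> f \<in> hom G H \<and> ld_function M S T f"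

text \<open>A definable set as a locally definable set with a single piece.\<close>

definition single :: "'s list \<Rightarrow> 'a list set \<Rightarrow> ('s, 'a) ld_data" where
  "single w D = \<lparr>arity = w, pieces = {D}\<rparr>"


section \<open>Products of locally definable groups over different sorts\<close>

text \<open>
  For locally definable sets \<open>S i\<close> in \<open>M i\<close>, \<open>i = 1, \<dots>, n\<close>, their product as a locally definable set
  in the disjoint union: an element \<open>(x\<^sub>1, \<dots>, x\<^sub>n)\<close> is represented by the concatenation of the \<open>x\<^sub>i\<close>,
  which is injective because the length of each \<open>x\<^sub>i\<close> is fixed. The product group is the library
  product, transported along this map.
\<close>

definition join :: "nat \<Rightarrow> (nat \<Rightarrow> 'a list) \<Rightarrow> 'a list" where
  "join n x = concat (map x [1..<Suc n])"

definition ld_product :: "nat \<Rightarrow> (nat \<Rightarrow> (unit, 'a) ld_data) \<Rightarrow> (nat, 'a) ld_data" where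
  "ld_product n S =
     \<lparr>arity = join n (\<lambda>i. map (\<lambda>_. i) (arity (S i))),
      pieces = {join n ` (\<Pi>\<^sub>E i\<in>{1..n}. P i) | P. \<forall>i\<in>{1..n}. P i \<in> pieces (S i)}\<rparr>"

definition product_ld_group :: "nat \<Rightarrow> (nat \<Rightarrow> 'a list monoid) \<Rightarrow> 'a list monoid" where
  "product_ld_group n H = image_group (join n) (product_group {1..n} H)"

end

(*
  Elimination of quantifiers makes every definable set of the disjoint union a finite union of
  boxes, so a definable function from sort i to the other sorts has finite image. For a definable
  abelian group G let u_i(g) be the list of the entries of g of sort i and v_i(g) the list of the
  other entries.

  If subsets D_i of G with v_i(D_i) finite generate G together, then the subgroups K_i generated
  by them do the job. Each v_i(K_i) is countable, so after coding its values by elements of the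
  infinite universe of M_i the group K_i becomes locally definable in M_i. In a relation
  g_1 ... g_n = 1 with factors from definable pieces of the K_i, the factor g_i is the inverse of a
  product of elements with finitely many entries of sort i, and v_i(g_i) takes finitely many
  values as well. So the kernel of the product map is discrete.

  To find the D_i it suffices to show: if A x B is a subset of G, where A collects the entries of
  one sort, then A x B is generated by finitely many of its rows and columns. Let N be the number
  of rectangles in the graph of the multiplication, and write F(x,y) for the element of G with
  coordinates x and y. For x_1, ..., x_t in A and y_1, ..., y_t in B the products
  F(x_1,y_p(1)) ... F(x_t,y_p(t)), with p a permutation, have at most N^t first coordinates, and,
  as G is abelian, at most N^t second coordinates; so for t! > N^(2t) two of them coincide. On the
  other hand, the maps x -> F(x,y) F(x,y')^-1 have finitely many different kernels. If A is not a
  finite union of classes of the nontrivial ones and there are t columns which differ pairwise by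
  nontrivial ones, then the rows can be chosen one after another such that all these products are
  distinct. So there are finitely many columns modulo trivial kernels; in general, split A into
  classes, which decreases the number of nontrivial kernels.
*)
theory Submission
  imports Defs "HOL-Combinatorics.Permutations"
begin

section \<open>Operations on definable sets\<close>

text \<open>The group operation does not split into operations on the separate sorts, but the sorts
  interact through finite information only. If a rectangle P x Q lies in the graph as a whole, then
  one fixed point of Q shows that the P-part of a product is a function of the P-parts of its
  factors. So the rectangle that contains the graph entry of a product is all that the other sorts
  contribute; each multiplication costs a factor N, which gives N^t for either coordinate and N^(2t)
  for both. The same information leaves finitely many possibilities for the kernels of the maps x ->
  F(x,y) F(x,y')^-1. The subgroups K_i need not be definable: v_i has finitely many values on the
  products of m generators, but their number may grow with m. This forces countable unions. It also
  permits an arbitrary choice of codes, because on each of these definable levels finitely many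
  parameters describe it.\<close>

lemma tuples_Nil [simp]: "tuples M [] = {[]}"
  by (auto simp: tuples_def)

lemma Cons_in_tuples [simp]: "a # xs \<in> tuples M (s # w) \<longleftrightarrow> a \<in> univ M s \<and> xs \<in> tuples M w"
  by (auto simp: tuples_def)

lemma tuples_Cons: "tuples M (s # w) = {a # xs | a xs. a \<in> univ M s \<and> xs \<in> tuples M w}"
  by (auto simp: tuples_def list_all2_Cons2)

lemma tuples_append: "tuples M (v @ w) = {x @ y | x y. x \<in> tuples M v \<and> y \<in> tuples M w}"
  by (auto simp: tuples_def list_all2_append2 dest: list_all2_lengthD intro!: list_all2_appendI)

lemma length_tuples: "xs \<in> tuples M w \<Longrightarrow> length xs = length w"
  by (auto simp: tuples_def dest: list_all2_lengthD)

lemma append_in_tuples: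
  "length x = length v \<Longrightarrow> x @ y \<in> tuples M (v @ w) \<longleftrightarrow> x \<in> tuples M v \<and> y \<in> tuples M w"
  by (auto simp: tuples_def list_all2_append)

lemma tuples_appendI: "x \<in> tuples M v \<Longrightarrow> y \<in> tuples M w \<Longrightarrow> x @ y \<in> tuples M (v @ w)"
  by (simp add: append_in_tuples length_tuples)

lemma tuples_append_eqD:
  assumes "x @ y = x' @ y'" "x \<in> tuples M v" "x' \<in> tuples M v"
  shows "x = x'" "y = y'"
  using assms by (metis append_eq_append_conv length_tuples)+

lemma nth_in_tuples: "xs \<in> tuples M w \<Longrightarrow> k < length w \<Longrightarrow> xs ! k \<in> univ M (w ! k)"
  by (auto simp: tuples_def list_all2_conv_all_nth)

lemma definable_in_tuples: "definable M w D \<Longrightarrow> D \<subseteq> tuples M w"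
  by (auto simp: definable_def)

lemma definable_sorts: "definable M w D \<Longrightarrow> set w \<subseteq> sorts M"
  by (auto simp: definable_def)

lemma val_in_univ: "wf_tm M w t s \<Longrightarrow> xs \<in> tuples M w \<Longrightarrow> val xs t \<in> univ M s"
  by (cases t) (auto dest: nth_in_tuples)

lemma map_val_in_tuples:
  "list_all2 (wf_tm M w) ts v \<Longrightarrow> xs \<in> tuples M w \<Longrightarrow> map (val xs) ts \<in> tuples M v"
  by (auto simp: tuples_def list_all2_conv_all_nth intro!: val_in_univ)

lemma wf_tm_weaken: "wf_tm M v t s \<Longrightarrow> wf_tm M (v @ w) t s"
  by (cases t) (auto simp: nth_append)

lemma wf_fm_weaken: "wf_fm M v \<phi> \<Longrightarrow> wf_fm M (v @ w) \<phi>"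
  by (induction \<phi> arbitrary: v)
     (auto intro: wf_tm_weaken simp: list_all2_conv_all_nth simp flip: append_Cons)

lemma val_weaken: "wf_tm M v t s \<Longrightarrow> length xs = length v \<Longrightarrow> val (xs @ ys) t = val xs t"
  by (cases t) (auto simp: nth_append)

lemma sat_weaken:
  "wf_fm M v \<phi> \<Longrightarrow> length xs = length v \<Longrightarrow> sat M (xs @ ys) \<phi> \<longleftrightarrow> sat M xs \<phi>"
proof (induction \<phi> arbitrary: v xs)
  case (Rel w R ts)
  then have "map (val (xs @ ys)) ts = map (val xs) ts"
    by (fastforce simp: list_all2_conv_all_nth in_set_conv_nth intro: val_weaken)
  then show ?case by (simp only: sat.simps)
next
  case (Equal s t u)
  then show ?case by (auto simp: val_weaken[of M v _ s])
next
  case (Exists s \<phi>)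
  have "sat M ((a # xs) @ ys) \<phi> \<longleftrightarrow> sat M (a # xs) \<phi>" for a
    using Exists by (intro Exists.IH[of "s # v"]) auto
  then show ?case by simp
qed auto

lemma map_nth_append1: "length x = a \<Longrightarrow> map ((!) (x @ y)) [0..<a] = x"
  by (auto intro: nth_equalityI simp: nth_append)

lemma map_nth_append2:
  "length x = a \<Longrightarrow> b = a + length y \<Longrightarrow> map ((!) (x @ y @ z)) [a..<b] = y"
  by (auto intro: nth_equalityI simp: nth_append)

lemma map_nth_append2':
  "length x = a \<Longrightarrow> b = a + length y \<Longrightarrow> map ((!) (x @ y)) [a..<b] = y"
  by (auto intro: nth_equalityI simp: nth_append)

lemma wf_map_Var:
  assumes "set js \<subseteq> {..<length w}"
  shows "list_all2 (wf_tm M w) (map Var js) (map ((!) w) js)"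
  using assms by (auto simp: list_all2_conv_all_nth dest: nth_mem)

locale fo_struct =
  fixes M :: "('s, 'a) fo_structure"
  assumes is_structure: "is_structure M"
    and sorts_nonempty: "sorts M \<noteq> {}"
begin

lemma definable_compl:
  assumes "definable M w D"
  shows "definable M w (tuples M w - D)"
proof -
  obtain \<phi> where "set w \<subseteq> sorts M" "wf_fm M w \<phi>" "D = {xs \<in> tuples M w. sat M xs \<phi>}"
    using assms unfolding definable_def by blast
  then show ?thesis
    unfolding definable_def by (intro conjI exI[of _ "Neg \<phi>"]) auto
qed

lemma definable_Int:
  assumes "definable M w D" "definable M w E"
  shows "definable M w (D \<inter> E)"
proof -
  obtain \<phi> \<psi> where "set w \<subseteq> sorts M" "wf_fm M w \<phi>" "D = {xs \<in> tuples M w. sat M xs \<phi>}"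
    "wf_fm M w \<psi>" "E = {xs \<in> tuples M w. sat M xs \<psi>}"
    using assms unfolding definable_def by blast
  then show ?thesis
    unfolding definable_def by (intro conjI exI[of _ "Conj \<phi> \<psi>"]) auto
qed

text \<open>The syntax has no constant for truth, so a valid formula is made from an atom. Equating
  a parameter with itself takes a sort and an element of it; here \<open>sorts_nonempty\<close>
  enters.\<close>

lemma definable_tuples:
  assumes "set w \<subseteq> sorts M"
  shows "definable M w (tuples M w)"
proof -
  obtain s a where "s \<in> sorts M" "a \<in> univ M s"
    using is_structure sorts_nonempty unfolding is_structure_def by blast
  with assms show ?thesis
    unfolding definable_def by (intro conjI exI[of _ "Equal s (Par a) (Par a)"]) auto
qed

lemma definable_Diff:
  assumes "definable M w D" "definable M w E"
  shows "definable M w (D - E)"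
proof -
  have "D - E = D \<inter> (tuples M w - E)"
    using definable_in_tuples[OF assms(1)] by auto
  then show ?thesis
    using assms by (simp add: definable_Int definable_compl)
qed

lemma definable_Un:
  assumes "definable M w D" "definable M w E"
  shows "definable M w (D \<union> E)"
proof -
  have "D \<union> E = tuples M w - ((tuples M w - D) \<inter> (tuples M w - E))"
    using assms[THEN definable_in_tuples] by auto
  then show ?thesis
    using assms by (simp add: definable_Int definable_compl)
qed

lemma definable_empty:
  assumes "set w \<subseteq> sorts M"
  shows "definable M w {}"
  using definable_compl[OF definable_tuples[OF assms]] by simp

lemma definable_UN:
  assumes "finite I" "set w \<subseteq> sorts M" "\<And>i. i \<in> I \<Longrightarrow> definable M w (D i)"
  shows "definable M w (\<Union>i\<in>I. D i)"
  using assms(1,3) by (induction I) (auto intro!: definable_empty[OF assms(2)] definable_Un)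

lemma definable_Equal:
  assumes "set w \<subseteq> sorts M" "wf_tm M w t s" "wf_tm M w u s"
  shows "definable M w {xs \<in> tuples M w. val xs t = val xs u}"
  unfolding definable_def using assms by (intro conjI exI[of _ "Equal s t u"]) auto

lemma definable_INT:
  assumes "set w \<subseteq> sorts M" "finite I" "\<And>i. i \<in> I \<Longrightarrow> definable M w {xs \<in> tuples M w. P i xs}"
  shows "definable M w {xs \<in> tuples M w. \<forall>i\<in>I. P i xs}"
proof -
  have "definable M w (tuples M w - (\<Union>i\<in>I. tuples M w - {xs \<in> tuples M w. P i xs}))"
    using assms by (intro definable_Diff definable_UN definable_tuples) auto
  moreover have "tuples M w - (\<Union>i\<in>I. tuples M w - {xs \<in> tuples M w. P i xs}) =
      {xs \<in> tuples M w. \<forall>i\<in>I. P i xs}"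
    by auto
  ultimately show ?thesis by simp
qed

text \<open>\<open>Exists\<close> binds the head of the environment. Hence a block to be projected
  away must stand in front, which dictates the order of the blocks in the later definability proofs
  and is the reason for their swaps.\<close>

lemma definable_proj_Cons:
  assumes "definable M (s # w) D"
  shows "definable M w {y \<in> tuples M w. \<exists>a. a # y \<in> D}"
proof -
  obtain \<phi> where "set (s # w) \<subseteq> sorts M" "wf_fm M (s # w) \<phi>" "D = {xs \<in> tuples M (s # w). sat M xs \<phi>}"
    using assms unfolding definable_def by blast
  then show ?thesis
    unfolding definable_def by (intro conjI exI[of _ "Exists s \<phi>"]) auto
qed

lemma definable_proj:
  "definable M (v @ w) D \<Longrightarrow> definable M w {y. \<exists>x\<in>tuples M v. x @ y \<in> D}"
proof (induction v arbitrary: D)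
  case Nil
  then show ?case by simp
next
  case (Cons s v)
  have "definable M w {y. \<exists>x\<in>tuples M v. x @ y \<in> {z \<in> tuples M (v @ w). \<exists>a. a # z \<in> D}}"
    using Cons by (intro Cons.IH definable_proj_Cons) auto
  also have "{y. \<exists>x\<in>tuples M v. x @ y \<in> {z \<in> tuples M (v @ w). \<exists>a. a # z \<in> D}} =
      {y. \<exists>x\<in>tuples M (s # v). x @ y \<in> D}"
    using definable_in_tuples[OF Cons.prems] by (fastforce simp: tuples_Cons[of M s v])
  finally show ?case .
qed

lemma definable_weaken:
  assumes "definable M v D" "set w \<subseteq> sorts M"
  shows "definable M (v @ w) {x @ y | x y. x \<in> D \<and> y \<in> tuples M w}"
proof -
  obtain \<phi> where \<phi>: "set v \<subseteq> sorts M" "wf_fm M v \<phi>" "D = {xs \<in> tuples M v. sat M xs \<phi>}"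
    using assms unfolding definable_def by blast
  have "{x @ y | x y. x \<in> D \<and> y \<in> tuples M w} = {xs \<in> tuples M (v @ w). sat M xs \<phi>}"
    unfolding tuples_append \<phi>(3) using sat_weaken[OF \<phi>(2)] length_tuples by blast
  then show ?thesis
    unfolding definable_def using \<phi>(1) assms(2) wf_fm_weaken[OF \<phi>(2)]
    by (intro conjI exI[of _ \<phi>]) auto
qed

text \<open>
  Variables added at the end of an environment do not shift the indices of the others
  (\<open>sat_weaken\<close>). So instead of substituting terms in formulas we quantify over their values,
  using the graph of the terms.
\<close>

lemma definable_graph_rev:
  assumes "list_all2 (wf_tm M w) ts v" "set w \<subseteq> sorts M" "set v \<subseteq> sorts M"
  shows "definable M (v @ w) {map (val y) ts @ y | y. y \<in> tuples M w}"
proof -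
  \<comment> \<open>The values stand in front of the environment of the terms, so the variables of
    the terms move up by \<open>length v\<close>.\<close>
  define lift :: "'a tm \<Rightarrow> 'a tm"
    where "lift t = (case t of Var k \<Rightarrow> Var (k + length v) | Par a \<Rightarrow> Par a)" for t
  have len: "length ts = length v"
    using assms(1) by (rule list_all2_lengthD)
  have val_lift: "val (x @ y) (lift t) = val y t" if "x \<in> tuples M v" for x y t
    using length_tuples[OF that] by (cases t) (auto simp: lift_def nth_append)
  have wf_lift: "wf_tm M (v @ w) (lift t) s" if "wf_tm M w t s" for t s
    using that by (cases t) (auto simp: lift_def nth_append)
  have "definable M (v @ w)
      {z \<in> tuples M (v @ w). \<forall>j\<in>{..<length v}. val z (Var j) = val z (lift (ts ! j))}"
    using assms len
    by (intro definable_INT definable_Equal wf_lift)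
       (auto simp: nth_append list_all2_conv_all_nth)
  also have "{z \<in> tuples M (v @ w). \<forall>j\<in>{..<length v}. val z (Var j) = val z (lift (ts ! j))} =
      {map (val y) ts @ y | y. y \<in> tuples M w}" (is "?L = ?R")
  proof (intro Set.equalityI subsetI)
    fix z assume "z \<in> ?L"
    then obtain x y where "z = x @ y" and xy: "x \<in> tuples M v" "y \<in> tuples M w"
      and eq: "\<forall>j<length v. (x @ y) ! j = val (x @ y) (lift (ts ! j))"
      by (auto simp: tuples_append)
    moreover have "x = map (val y) ts"
      using eq len length_tuples[OF xy(1)] val_lift[OF xy(1), of y]
      by (intro nth_equalityI) (auto simp: nth_append split: if_splits)
    ultimately show "z \<in> ?R" by blast
  next
    fix z assume "z \<in> ?R"
    then obtain y where y: "z = map (val y) ts @ y" "y \<in> tuples M w" by blast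
    have "map (val y) ts \<in> tuples M v"
      using assms(1) y(2) by (rule map_val_in_tuples)
    with y show "z \<in> ?L"
      using len by (auto simp: val_lift tuples_append nth_append)
  qed
  finally show ?thesis .
qed

lemma definable_preimage:
  assumes "definable M v D" "list_all2 (wf_tm M w) ts v" "set w \<subseteq> sorts M"
  shows "definable M w {y \<in> tuples M w. map (val y) ts \<in> D}"
proof -
  have "definable M w {y. \<exists>x\<in>tuples M v. x @ y \<in>
      {x @ y | x y. x \<in> D \<and> y \<in> tuples M w} \<inter> {map (val y) ts @ y | y. y \<in> tuples M w}}"
    using assms definable_sorts[OF assms(1)]
    by (intro definable_proj definable_Int definable_weaken definable_graph_rev) auto
  also have "\<dots> = {y \<in> tuples M w. map (val y) ts \<in> D}"
    (is "?L = ?R")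
  proof (intro Set.equalityI subsetI)
    fix y assume "y \<in> ?L"
    then obtain x x' y' y'' where *: "x \<in> tuples M v" "x @ y = x' @ y'" "x' \<in> D" "y' \<in> tuples M w"
      "x @ y = map (val y'') ts @ y''" "y'' \<in> tuples M w"
      by blast
    have "x = x'" "y = y'"
      using tuples_append_eqD[OF *(2,1)] *(3) definable_in_tuples[OF assms(1)] by blast+
    moreover have "x = map (val y'') ts" "y = y''"
      using tuples_append_eqD[OF *(5,1) map_val_in_tuples[OF assms(2) *(6)]] .
    ultimately show "y \<in> ?R"
      using * by simp
  next
    fix y assume y: "y \<in> ?R"
    then have "map (val y) ts \<in> tuples M v"
      using definable_in_tuples[OF assms(1)] by auto
    with y show "y \<in> ?L" by auto
  qed
  finally show ?thesis .
qed

text \<open>The terms are variables only, and \<open>js\<close> may omit, permute and repeat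
  positions. The swaps, compositions and selections of coordinates below are instances.\<close>

lemma definable_reindex:
  assumes "definable M v D" "v = map ((!) w) js" "set js \<subseteq> {..<length w}" "set w \<subseteq> sorts M"
  shows "definable M w {y \<in> tuples M w. map ((!) y) js \<in> D}"
  using definable_preimage[OF _ wf_map_Var] assms by (simp add: comp_def)

lemma definable_swap:
  assumes "definable M (v @ w) D"
  shows "definable M (w @ v) {y @ x | x y. x @ y \<in> D \<and> x \<in> tuples M v \<and> y \<in> tuples M w}"
proof -
  let ?a = "length w" and ?b = "length w + length v"
  have "definable M (w @ v) {z \<in> tuples M (w @ v). map ((!) z) ([?a..<?b] @ [0..<?a]) \<in> D}"
    using definable_sorts[OF assms]
    by (intro definable_reindex[OF assms])
       (auto simp: map_nth_append1 map_nth_append2' simp del: append_assoc)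
  also have "{z \<in> tuples M (w @ v). map ((!) z) ([?a..<?b] @ [0..<?a]) \<in> D} =
      {y @ x | x y. x @ y \<in> D \<and> x \<in> tuples M v \<and> y \<in> tuples M w}"
    unfolding tuples_append[of M w v]
    by (auto simp: map_nth_append1 map_nth_append2' length_tuples)
       (metis append_eq_append_conv length_tuples)+
  finally show ?thesis .
qed

lemma definable_times:
  assumes "definable M v D" "definable M w E"
  shows "definable M (v @ w) {x @ y | x y. x \<in> D \<and> y \<in> E}"
proof -
  have "definable M (v @ w) ({x @ y | x y. x \<in> D \<and> y \<in> tuples M w} \<inter>
      {x @ y | y x. y @ x \<in> {y @ x | y x. y \<in> E \<and> x \<in> tuples M v} \<and> y \<in> tuples M w \<and> x \<in> tuples M v})"
    using assms assms[THEN definable_sorts]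
    by (intro definable_Int definable_weaken definable_swap)
  also have "({x @ y | x y. x \<in> D \<and> y \<in> tuples M w} \<inter>
      {x @ y | y x. y @ x \<in> {y @ x | y x. y \<in> E \<and> x \<in> tuples M v} \<and> y \<in> tuples M w \<and> x \<in> tuples M v}) =
      {x @ y | x y. x \<in> D \<and> y \<in> E}" (is "?L = ?R")
  proof (intro Set.equalityI subsetI)
    fix z assume "z \<in> ?L"
    then obtain x y x1 y1 x2 y2 where *: "z = x @ y" "x \<in> D" "y \<in> tuples M w"
      "z = x1 @ y1" "y1 @ x1 = y2 @ x2" "y2 \<in> E" "x2 \<in> tuples M v" "y1 \<in> tuples M w"  "x1 \<in> tuples M v"
      by blast
    then have "y1 = y2" "x = x1" "y = y1"
      using assms[THEN definable_in_tuples]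
      by (metis append_eq_append_conv length_tuples subsetD)+
    with * show "z \<in> ?R" by blast
  next
    fix z assume "z \<in> ?R"
    then show "z \<in> ?L"
      using assms[THEN definable_in_tuples] by blast
  qed
  finally show ?thesis .
qed

text \<open>Read \<open>I\<close> and \<open>R\<close> as relations leaving the common block
  \<open>w\<close>: the result is the converse of \<open>I\<close> followed by \<open>R\<close>.
  With the graph of a map for \<open>I\<close> it replaces the leading block of \<open>R\<close> by
  its image.\<close>

lemma definable_comp:
  assumes "definable M (w @ r) I" "definable M (w @ v) R"
  shows "definable M (r @ v)
    {z @ y | z y. z \<in> tuples M r \<and> y \<in> tuples M v \<and> (\<exists>g\<in>tuples M w. g @ z \<in> I \<and> g @ y \<in> R)}"
proof -
  let ?a = "length w" and ?b = "length w + length r" and ?c = "length w + length r + length v"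
  have sorts: "set w \<subseteq> sorts M" "set r \<subseteq> sorts M" "set v \<subseteq> sorts M"
    using assms[THEN definable_sorts] by auto
  have "definable M (r @ v) {u. \<exists>g\<in>tuples M w. g @ u \<in>
      {x \<in> tuples M (w @ (r @ v)). map ((!) x) ([0..<?a] @ [?a..<?b]) \<in> I} \<inter>
      {x \<in> tuples M (w @ (r @ v)). map ((!) x) ([0..<?a] @ [?b..<?c]) \<in> R}}"
    using sorts map_nth_append2'[of "w @ r" _ _ v]
    by (intro definable_proj definable_Int definable_reindex[OF assms(1)] definable_reindex[OF assms(2)])
       (auto simp: map_nth_append1 map_nth_append2)
  also have "{u. \<exists>g\<in>tuples M w. g @ u \<in>
      {x \<in> tuples M (w @ (r @ v)). map ((!) x) ([0..<?a] @ [?a..<?b]) \<in> I} \<inter>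
      {x \<in> tuples M (w @ (r @ v)). map ((!) x) ([0..<?a] @ [?b..<?c]) \<in> R}} =
    {z @ y | z y. z \<in> tuples M r \<and> y \<in> tuples M v \<and> (\<exists>g\<in>tuples M w. g @ z \<in> I \<and> g @ y \<in> R)}"
    (is "?L = ?R")
  proof -
    have "g @ u \<in> {x \<in> tuples M (w @ (r @ v)). map ((!) x) ([0..<?a] @ [?a..<?b]) \<in> I} \<inter>
      {x \<in> tuples M (w @ (r @ v)). map ((!) x) ([0..<?a] @ [?b..<?c]) \<in> R} \<longleftrightarrow>
      (\<exists>z y. u = z @ y \<and> z \<in> tuples M r \<and> y \<in> tuples M v \<and> g @ z \<in> I \<and> g @ y \<in> R)"
      if g: "g \<in> tuples M w" for g u
    proof (cases "u \<in> tuples M (r @ v)")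
      case True
      then obtain z y where u: "u = z @ y" "z \<in> tuples M r" "y \<in> tuples M v"
        by (auto simp: tuples_append)
      have "map ((!) (g @ u)) [0..<?a] = g" "map ((!) (g @ u)) [?a..<?b] = z"
        "map ((!) (g @ u)) [?b..<?c] = y"
        using g u map_nth_append2'[of "g @ z" ?b ?c y]
        by (auto simp: map_nth_append1 map_nth_append2 length_tuples)
      then have "g @ u \<in> {x \<in> tuples M (w @ (r @ v)). map ((!) x) ([0..<?a] @ [?a..<?b]) \<in> I} \<inter>
          {x \<in> tuples M (w @ (r @ v)). map ((!) x) ([0..<?a] @ [?b..<?c]) \<in> R} \<longleftrightarrow> g @ z \<in> I \<and> g @ y \<in> R"
        using tuples_appendI[OF g True] by simp
      moreover have "z' = z \<and> y' = y" if "u = z' @ y'" "z' \<in> tuples M r" for z' y'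
        using that u tuples_append_eqD by blast
      ultimately show ?thesis
        using u by blast
    next
      case False
      then show ?thesis
        using g by (auto simp: append_in_tuples length_tuples tuples_appendI)
    qed
    then show ?thesis by blast
  qed
  finally show ?thesis .
qed

lemma definable_graph:
  assumes "definable M w D" "list_all2 (wf_tm M w) ts v" "set v \<subseteq> sorts M"
  shows "definable M (w @ v) {y @ map (val y) ts | y. y \<in> D}"
proof -
  have sorts: "set w \<subseteq> sorts M"
    using assms(1) by (rule definable_sorts)
  have "definable M (w @ v) ({y @ x | y x. y \<in> D \<and> x \<in> tuples M v} \<inter> 
      {y @ x | x y. x @ y \<in> {map (val y) ts @ y | y. y \<in> tuples M w} \<and> x \<in> tuples M v \<and> y \<in> tuples M w})"
    using assms sorts by (intro definable_Int definable_weaken definable_swap definable_graph_rev)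
  also have "({y @ x | y x. y \<in> D \<and> x \<in> tuples M v} \<inter> 
      {y @ x | x y. x @ y \<in> {map (val y) ts @ y | y. y \<in> tuples M w} \<and> x \<in> tuples M v \<and> y \<in> tuples M w}) =
      {y @ map (val y) ts | y. y \<in> D}" (is "?L = ?R")
  proof (intro Set.equalityI subsetI)
    fix z assume "z \<in> ?L"
    then obtain y x y1 x1 y2 where *: "z = y @ x" "y \<in> D" "x \<in> tuples M v" "z = y1 @ x1"
      "x1 @ y1 = map (val y2) ts @ y2" "x1 \<in> tuples M v" "y1 \<in> tuples M w" "y2 \<in> tuples M w"
      by blast
    have "y \<in> tuples M w"
      using *(2) definable_in_tuples[OF assms(1)] by blast
    moreover have "y @ x = y1 @ x1"
      using *(1,4) by simp
    ultimately have y: "y = y1" "x = x1"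
      using tuples_append_eqD[OF _ _ *(7)] by blast+
    have "x1 = map (val y2) ts" "y1 = y2"
      using tuples_append_eqD[OF *(5,6) map_val_in_tuples[OF assms(2) *(8)]] .
    then show "z \<in> ?R" using y *(1,2) by blast
  next
    fix z assume "z \<in> ?R"
    then obtain y where y: "z = y @ map (val y) ts" "y \<in> D" by blast
    then have "y \<in> tuples M w" "map (val y) ts \<in> tuples M v"
      using definable_in_tuples[OF assms(1)] map_val_in_tuples[OF assms(2)] by auto
    with y show "z \<in> ?L" by blast
  qed
  finally show ?thesis .
qed

lemma definable_single:
  assumes "set w \<subseteq> sorts M" "x \<in> tuples M w"
  shows "definable M w {x}"
proof -
  have "definable M w {y \<in> tuples M w. \<forall>j\<in>{..<length w}. val y (Var j) = val y (Par (x ! j))}"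
    using assms by (intro definable_INT definable_Equal[where s = "w ! _"]) (auto simp: nth_in_tuples)
  moreover have "{y \<in> tuples M w. \<forall>j\<in>{..<length w}. val y (Var j) = val y (Par (x ! j))} = {x}"
    using assms(2) by (auto intro!: nth_equalityI simp: length_tuples)
  ultimately show ?thesis by simp
qed

lemma definable_finite:
  assumes "set w \<subseteq> sorts M" "finite D" "D \<subseteq> tuples M w"
  shows "definable M w D"
  using definable_UN[of D w "\<lambda>x. {x}"] assms definable_single by auto

end

section \<open>Orthogonality in the disjoint union\<close>

definition sel :: "('s \<Rightarrow> bool) \<Rightarrow> 's list \<Rightarrow> 'a list \<Rightarrow> 'a list" where
  "sel p w xs = map snd (filter (\<lambda>(s, _). p s) (zip w xs))"

lemma sel_Nil [simp]: "sel p [] xs = []" "sel p w [] = []"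
  by (simp_all add: sel_def)

lemma sel_Cons [simp]: "sel p (s # w) (a # xs) = (if p s then a # sel p w xs else sel p w xs)"
  by (simp add: sel_def)

lemma sel_append:
  "length x = length v \<Longrightarrow> sel p (v @ w) (x @ y) = sel p v x @ sel p w y"
  by (simp add: sel_def)

lemma tuples_induct [consumes 1, case_names Nil Cons]:
  assumes "xs \<in> tuples M w" "P [] []"
    and "\<And>s w a xs. \<lbrakk>a \<in> univ M s; xs \<in> tuples M w; P w xs\<rbrakk> \<Longrightarrow> P (s # w) (a # xs)"
  shows "P w xs"
proof -
  from assms(1) have "list_all2 (\<lambda>a s. a \<in> univ M s) xs w"
    by (simp add: tuples_def)
  then show ?thesis
    by (induction rule: list_all2_induct) (auto intro: assms(2,3) simp: tuples_def)
qed

lemma sel_in_tuples: "xs \<in> tuples M w \<Longrightarrow> sel p w xs \<in> tuples M (filter p w)"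
  by (induction rule: tuples_induct) auto

lemma sel_sel:
  assumes "\<And>s. q s \<Longrightarrow> p s"
  shows "length xs = length w \<Longrightarrow> sel q (filter p w) (sel p w xs) = sel q w xs"
  by (induction xs w rule: list_induct2) (auto dest: assms)

lemma sel_eqI:
  assumes "length x = length w" "length y = length w"
    "\<And>s. s \<in> set w \<Longrightarrow> p s \<Longrightarrow> sel (\<lambda>t. t = s) w x = sel (\<lambda>t. t = s) w y"
  shows "sel p w x = sel p w y"
  using assms
proof (induction w arbitrary: x y)
  case (Cons s w)
  obtain a x' b y' where xy: "x = a # x'" "y = b # y'"
    using Cons.prems by (cases x; cases y) auto
  have "sel p w x' = sel p w y'"
  proof (rule Cons.IH)
    fix t assume "t \<in> set w" "p t"
    then show "sel (\<lambda>s. s = t) w x' = sel (\<lambda>s. s = t) w y'"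
      using Cons.prems(3)[of t] xy by (auto split: if_splits)
  qed (use Cons.prems xy in auto)
  then show ?case
    using Cons.prems(3)[of s] xy by auto
qed auto

lemma sel_inject:
  assumes "length x = length w" "length y = length w"
    "sel p w x = sel p w y" "sel (\<lambda>s. \<not> p s) w x = sel (\<lambda>s. \<not> p s) w y"
  shows "x = y"
  using assms
proof (induction w arbitrary: x y)
  case (Cons s w)
  then show ?case
    by (cases x; cases y) (auto split: if_splits)
qed auto

text \<open>Inverse to splitting a tuple into the entries whose sort satisfies \<open>p\<close> and
  the rest. On lists of the right lengths \<open>hd\<close> and \<open>tl\<close> never meet an
  empty list.\<close>

fun merge :: "('s \<Rightarrow> bool) \<Rightarrow> 's list \<Rightarrow> 'a list \<Rightarrow> 'a list \<Rightarrow> 'a list" where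
  "merge p [] xs ys = []"
| "merge p (s # w) xs ys =
    (if p s then hd xs # merge p w (tl xs) ys else hd ys # merge p w xs (tl ys))"

lemma merge:
  assumes "x \<in> tuples M (filter p w)" "y \<in> tuples M (filter (\<lambda>s. \<not> p s) w)"
  shows "merge p w x y \<in> tuples M w" "sel p w (merge p w x y) = x"
    "sel (\<lambda>s. \<not> p s) w (merge p w x y) = y"
  using assms by (induction w arbitrary: x y) (auto simp: tuples_Cons)

locale union_struct =
  fixes n :: nat and M :: "nat \<Rightarrow> (unit, 'a) fo_structure"
  assumes o_minimal: "\<And>i. i \<in> {1..n} \<Longrightarrow> o_minimal (M i)"
    and n_pos: "n \<ge> 1"
begin

abbreviation "DU \<equiv> disjoint_union n M"

lemma sorts_DU [simp]: "sorts DU = {1..n}"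
  by (simp add: disjoint_union_def)

lemma univ_DU [simp]: "univ DU i = univ (M i) ()"
  by (simp add: disjoint_union_def)

lemma rels_DU: "(w, D) \<in> rels DU \<longleftrightarrow>
    (\<exists>i v. i \<in> {1..n} \<and> w = map (\<lambda>_. i) v \<and> definable (M i) v D)"
  by (auto simp: disjoint_union_def)

lemma tuples_DU_map: "tuples DU (map (\<lambda>_. i) v) = tuples (M i) v"
  by (auto simp: tuples_def list_all2_map2)

lemma comp_fo_struct: "i \<in> {1..n} \<Longrightarrow> fo_struct (M i)"
  using o_minimal unfolding fo_struct_def o_minimal_def by blast

lemma sorts_M: "i \<in> {1..n} \<Longrightarrow> sorts (M i) = {()}"
  using o_minimal unfolding o_minimal_def by blast

sublocale DU: fo_struct DU
proof
  have "univ (M i) () \<noteq> {}" if "i \<in> {1..n}" for i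
    using comp_fo_struct[OF that] sorts_M[OF that] by (auto simp: fo_struct_def is_structure_def)
  moreover have "D \<subseteq> tuples DU w" "set w \<subseteq> {1..n}" if wD: "(w, D) \<in> rels DU" for w D
  proof -
    obtain i v where iv: "i \<in> {1..n}" "w = map (\<lambda>_. i) v" "definable (M i) v D"
      using wD unfolding rels_DU by blast
    then show "D \<subseteq> tuples DU w" "set w \<subseteq> {1..n}"
      using definable_in_tuples[OF iv(3)] tuples_DU_map[of i v] by auto
  qed
  ultimately show "is_structure DU"
    unfolding is_structure_def sorts_DU univ_DU by blast
  show "sorts DU \<noteq> {}"
    using n_pos by simp
qed

text \<open>A finite nonempty strict order has a maximal element, but the order of an o-minimal
  structure has no endpoints. The infinity provides room for countably many codes in one
  sort.\<close>

lemma infinite_univ: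
  assumes "i \<in> {1..n}"
  shows "infinite (univ (M i) ())"
proof
  assume fin: "finite (univ (M i) ())"
  obtain r where r: "r \<subseteq> univ (M i) () \<times> univ (M i) ()" "strict_linear_order_on (univ (M i) ()) r"
    and up: "\<forall>a\<in>univ (M i) (). \<exists>b. (a, b) \<in> r"
    using o_minimal[OF assms] unfolding o_minimal_def by (elim conjE exE) (erule that, blast+)
  have "univ (M i) () \<noteq> {}"
    using comp_fo_struct[OF assms] sorts_M[OF assms]
    by (auto simp: fo_struct_def is_structure_def)
  have "finite r"
    using r(1) fin by (meson finite_SigmaI finite_subset)
  moreover have "acyclic r"
    using r(2) unfolding strict_linear_order_on_def
    by (metis acyclic_irrefl trancl_id)
  ultimately have "wf (r\<inverse>)"
    by (rule finite_acyclic_wf_converse)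
  then obtain a where "a \<in> univ (M i) ()" "\<forall>b. (b, a) \<in> r\<inverse> \<longrightarrow> b \<notin> univ (M i) ()"
    using \<open>univ (M i) () \<noteq> {}\<close> by (meson all_not_in_conv wfE_min)
  with up r(1) show False by blast
qed

section \<open>Boxes and elimination of quantifiers\<close>

definition box :: "nat list \<Rightarrow> (nat \<Rightarrow> 'a list set) \<Rightarrow> 'a list set" where
  "box w C = {xs \<in> tuples DU w. \<forall>i\<in>{1..n}. sel (\<lambda>s. s = i) w xs \<in> C i}"

definition sort_arity :: "nat list \<Rightarrow> nat \<Rightarrow> unit list" where
  "sort_arity w i = map (\<lambda>_. ()) (filter (\<lambda>s. s = i) w)"

lemma sort_arity_Nil [simp]: "sort_arity [] i = []"
  by (simp add: sort_arity_def)

lemma sort_arity_Cons [simp]: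
  "sort_arity (s # w) i = (if s = i then () # sort_arity w i else sort_arity w i)"
  by (simp add: sort_arity_def)

lemma sel_in_tuples_M: "xs \<in> tuples DU w \<Longrightarrow> sel (\<lambda>s. s = i) w xs \<in> tuples (M i) (sort_arity w i)"
  by (induction rule: tuples_induct) auto

definition box_union :: "nat list \<Rightarrow> 'a list set \<Rightarrow> bool" where
  "box_union w D \<longleftrightarrow> (\<exists>\<B>. finite \<B> \<and>
     (\<forall>C\<in>\<B>. \<forall>i\<in>{1..n}. definable (M i) (sort_arity w i) (C i)) \<and> D = (\<Union>C\<in>\<B>. box w C))"

lemma box_union_box:
  "(\<And>i. i \<in> {1..n} \<Longrightarrow> definable (M i) (sort_arity w i) (C i)) \<Longrightarrow> box_union w (box w C)"
  unfolding box_union_def by (intro exI[of _ "{C}"]) auto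

lemma box_union_empty: "box_union w {}"
  unfolding box_union_def by (intro exI[of _ "{}"]) auto

lemma box_union_Un:
  assumes "box_union w D" "box_union w E"
  shows "box_union w (D \<union> E)"
proof -
  from assms obtain \<B> \<C> where "finite \<B>" "D = (\<Union>C\<in>\<B>. box w C)"
    "\<forall>C\<in>\<B>. \<forall>i\<in>{1..n}. definable (M i) (sort_arity w i) (C i)"
    "finite \<C>" "E = (\<Union>C\<in>\<C>. box w C)"
    "\<forall>C\<in>\<C>. \<forall>i\<in>{1..n}. definable (M i) (sort_arity w i) (C i)"
    unfolding box_union_def by metis
  then show ?thesis
    unfolding box_union_def by (intro exI[of _ "\<B> \<union> \<C>"]) auto
qed

lemma box_union_UN: "finite I \<Longrightarrow> (\<And>i. i \<in> I \<Longrightarrow> box_union w (D i)) \<Longrightarrow> box_union w (\<Union>i\<in>I. D i)"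
  by (induction I rule: finite_induct) (auto intro: box_union_empty box_union_Un)

lemma box_Int: "box w C \<inter> box w C' = box w (\<lambda>i. C i \<inter> C' i)"
  by (auto simp: box_def)

lemma box_union_Int:
  assumes "box_union w D" "box_union w E"
  shows "box_union w (D \<inter> E)"
proof -
  from assms obtain \<B> \<C> where *: "finite \<B>" "D = (\<Union>C\<in>\<B>. box w C)"
    "\<forall>C\<in>\<B>. \<forall>i\<in>{1..n}. definable (M i) (sort_arity w i) (C i)"
    "finite \<C>" "E = (\<Union>C\<in>\<C>. box w C)"
    "\<forall>C\<in>\<C>. \<forall>i\<in>{1..n}. definable (M i) (sort_arity w i) (C i)"
    unfolding box_union_def by metis
  have "box_union w (\<Union>C\<in>\<B>. \<Union>C'\<in>\<C>. box w (\<lambda>i. C i \<inter> C' i))"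
    using * by (intro box_union_UN box_union_box fo_struct.definable_Int comp_fo_struct) auto
  also have "(\<Union>C\<in>\<B>. \<Union>C'\<in>\<C>. box w (\<lambda>i. C i \<inter> C' i)) = D \<inter> E"
    unfolding * box_Int[symmetric] by blast
  finally show ?thesis .
qed

lemma set_sort_arity: "i \<in> {1..n} \<Longrightarrow> set (sort_arity w i) \<subseteq> sorts (M i)"
  using sorts_M by auto

lemma box_tuples: "box w (\<lambda>i. tuples (M i) (sort_arity w i)) = tuples DU w"
  by (auto simp: box_def sel_in_tuples_M)

lemma box_union_tuples: "box_union w (tuples DU w)"
  using box_union_box[of w "\<lambda>i. tuples (M i) (sort_arity w i)"] set_sort_arity
  by (simp add: fo_struct.definable_tuples comp_fo_struct box_tuples)

lemma box_union_sort:
  assumes "i \<in> {1..n}" "definable (M i) (sort_arity w i) D"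
  shows "box_union w {xs \<in> tuples DU w. sel (\<lambda>s. s = i) w xs \<in> D}"
proof -
  have "box_union w (box w (\<lambda>j. if j = i then D else tuples (M j) (sort_arity w j)))"
    using assms set_sort_arity
    by (intro box_union_box) (auto intro!: fo_struct.definable_tuples comp_fo_struct)
  also have "box w (\<lambda>j. if j = i then D else tuples (M j) (sort_arity w j)) =
      {xs \<in> tuples DU w. sel (\<lambda>s. s = i) w xs \<in> D}"
    using assms(1) by (auto simp: box_def sel_in_tuples_M split: if_splits)
  finally show ?thesis .
qed

lemma box_union_Inter:
  assumes "finite I" "\<And>i. i \<in> I \<Longrightarrow> box_union w (D i)"
  shows "box_union w {xs \<in> tuples DU w. \<forall>i\<in>I. xs \<in> D i}"
  using assms
proof (induction I rule: finite_induct)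
  case empty
  then show ?case by (simp add: box_union_tuples)
next
  case (insert i I)
  have "{xs \<in> tuples DU w. \<forall>j\<in>insert i I. xs \<in> D j} = D i \<inter> {xs \<in> tuples DU w. \<forall>j\<in>I. xs \<in> D j}"
    using insert.prems[of i] by (auto simp: box_union_def box_def)
  then show ?case
    using insert by (simp add: box_union_Int)
qed

text \<open>A tuple misses a box when its entries of some sort leave their factor, so the complement
  of a box is a union over the sorts. The complement of a union of boxes is a finite intersection of
  such unions.\<close>

lemma box_union_compl:
  assumes "box_union w D"
  shows "box_union w (tuples DU w - D)"
proof -
  from assms obtain \<B> where \<B>: "finite \<B>" "D = (\<Union>C\<in>\<B>. box w C)"
    "\<And>C i. C \<in> \<B> \<Longrightarrow> i \<in> {1..n} \<Longrightarrow> definable (M i) (sort_arity w i) (C i)"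
    unfolding box_union_def by auto
  have "box_union w {xs \<in> tuples DU w. \<forall>C\<in>\<B>. xs \<in> (\<Union>i\<in>{1..n}.
      {xs \<in> tuples DU w. sel (\<lambda>s. s = i) w xs \<in> tuples (M i) (sort_arity w i) - C i})}"
    using \<B> by (intro box_union_Inter box_union_UN box_union_sort fo_struct.definable_compl
        comp_fo_struct) auto
  also have "{xs \<in> tuples DU w. \<forall>C\<in>\<B>. xs \<in> (\<Union>i\<in>{1..n}.
      {xs \<in> tuples DU w. sel (\<lambda>s. s = i) w xs \<in> tuples (M i) (sort_arity w i) - C i})} =
      tuples DU w - D"
    unfolding \<B>(2) by (auto simp: box_def sel_in_tuples_M)
  finally show ?thesis .
qed

text \<open>The quantifier passes through the union. On a box it affects the factor of its own sort
  only, so the projection takes place inside \<open>M s\<close>.\<close>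

lemma box_union_proj_Cons:
  assumes s: "s \<in> {1..n}" and "box_union (s # w) D"
  shows "box_union w {xs \<in> tuples DU w. \<exists>a\<in>univ (M s) (). a # xs \<in> D}"
proof -
  from assms(2) obtain \<B> where \<B>: "finite \<B>" "D = (\<Union>C\<in>\<B>. box (s # w) C)"
    "\<And>C i. C \<in> \<B> \<Longrightarrow> i \<in> {1..n} \<Longrightarrow> definable (M i) (sort_arity (s # w) i) (C i)"
    unfolding box_union_def by auto
  let ?P = "\<lambda>C i. if i = s then {ys \<in> tuples (M s) (sort_arity w s). \<exists>a. a # ys \<in> C s} else C i"
  have "box_union w (\<Union>C\<in>\<B>. box w (?P C))"
  proof (intro box_union_UN box_union_box)
    fix C i assume "C \<in> \<B>" "i \<in> {1..n}"
    then show "definable (M i) (sort_arity w i) (?P C i)"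
      using \<B>(3)[of C i] comp_fo_struct[OF s, THEN fo_struct.definable_proj_Cons, of "()" "sort_arity w s"]
      by (cases "i = s") auto
  qed (fact \<B>(1))
  moreover have "{xs \<in> tuples DU w. \<exists>a\<in>univ (M s) (). a # xs \<in> box (s # w) C} = box w (?P C)"
    if "C \<in> \<B>" for C
  proof (intro Set.equalityI subsetI)
    fix xs assume "xs \<in> {xs \<in> tuples DU w. \<exists>a\<in>univ (M s) (). a # xs \<in> box (s # w) C}"
    then obtain a where "xs \<in> tuples DU w" "a \<in> univ (M s) ()"
      "\<forall>i\<in>{1..n}. sel (\<lambda>s. s = i) (s # w) (a # xs) \<in> C i"
      by (auto simp: box_def)
    then show "xs \<in> box w (?P C)"
      using s by (auto simp: box_def sel_in_tuples_M split: if_splits)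
  next
    fix xs assume xs: "xs \<in> box w (?P C)"
    then obtain a where a: "a # sel (\<lambda>t. t = s) w xs \<in> C s"
      using bspec[OF _ s, of "\<lambda>i. sel (\<lambda>s. s = i) w xs \<in> ?P C i"] by (auto simp: box_def)
    then have "a \<in> univ (M s) ()"
      using definable_in_tuples[OF \<B>(3)[OF that s]] by auto
    then show "xs \<in> {xs \<in> tuples DU w. \<exists>a\<in>univ (M s) (). a # xs \<in> box (s # w) C}"
      using xs a by (auto simp: box_def split: if_splits intro!: bexI[of _ a])
  qed
  then have "(\<Union>C\<in>\<B>. box w (?P C)) =
      (\<Union>C\<in>\<B>. {xs \<in> tuples DU w. \<exists>a\<in>univ (M s) (). a # xs \<in> box (s # w) C})"
    by simp
  moreover have "\<dots> = {xs \<in> tuples DU w. \<exists>a\<in>univ (M s) (). a # xs \<in> D}"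
    unfolding \<B>(2) by blast
  ultimately show ?thesis
    by simp
qed

text \<open>Adapts a term of sort \<open>i\<close> to the environment from which the other sorts are
  deleted: the new index counts the entries of sort \<open>i\<close> before position
  \<open>k\<close>.\<close>

definition sort_tm :: "nat list \<Rightarrow> nat \<Rightarrow> 'a tm \<Rightarrow> 'a tm" where
  "sort_tm w i t = (case t of Var k \<Rightarrow> Var (length (filter (\<lambda>s. s = i) (take k w))) | Par a \<Rightarrow> Par a)"

lemma sort_tm:
  assumes "wf_tm DU w t i" "i \<in> {1..n}"
  shows "wf_tm (M i) (sort_arity w i) (sort_tm w i t) ()"
    and "length xs = length w \<Longrightarrow> val (sel (\<lambda>s. s = i) w xs) (sort_tm w i t) = val xs t"
proof -
  have *: "length (filter (\<lambda>s. s = i) (take k w)) < length (filter (\<lambda>s. s = i) w) \<and>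
      (length xs = length w \<longrightarrow>
        sel (\<lambda>s. s = i) w xs ! length (filter (\<lambda>s. s = i) (take k w)) = xs ! k)"
    if "k < length w" "w ! k = i" for k xs
    using that
  proof (induction w arbitrary: k xs)
    case (Cons s w)
    then show ?case
      by (cases k; cases xs) auto
  qed simp
  show "wf_tm (M i) (sort_arity w i) (sort_tm w i t) ()"
    using assms * by (cases t) (auto simp: sort_tm_def sort_arity_def sorts_M)
  show "length xs = length w \<Longrightarrow> val (sel (\<lambda>s. s = i) w xs) (sort_tm w i t) = val xs t"
    using assms * by (cases t) (auto simp: sort_tm_def)
qed

text \<open>Atoms never mix sorts: a basic relation of the disjoint union comes from a single
  \<open>M i\<close>, and an equation compares terms of one sort. So an atom constrains one factor,
  and the closure properties above do the rest.\<close>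

lemma box_union_sat:
  "set w \<subseteq> {1..n} \<Longrightarrow> wf_fm DU w \<phi> \<Longrightarrow> box_union w {xs \<in> tuples DU w. sat DU xs \<phi>}"
proof (induction \<phi> arbitrary: w)
  case (Rel v R ts)
  then obtain i v' where i: "i \<in> {1..n}" "v = map (\<lambda>_. i) v'" "definable (M i) v' R"
    by (auto simp: rels_DU)
  have wf: "list_all2 (wf_tm (M i) (sort_arity w i)) (map (sort_tm w i) ts) v'"
    using Rel.prems(2) i sort_tm(1)[of w _ i] by (auto simp: list_all2_conv_all_nth)
  have ts: "wf_tm DU w t i" if "t \<in> set ts" for t
    using that Rel.prems(2) i by (auto simp: list_all2_conv_all_nth in_set_conv_nth)
  have "box_union w {xs \<in> tuples DU w. sel (\<lambda>s. s = i) w xs \<in>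
      {ys \<in> tuples (M i) (sort_arity w i). map (val ys) (map (sort_tm w i) ts) \<in> R}}"
    using i wf set_sort_arity
    by (intro box_union_sort fo_struct.definable_preimage comp_fo_struct) auto
  also have "{xs \<in> tuples DU w. sel (\<lambda>s. s = i) w xs \<in>
      {ys \<in> tuples (M i) (sort_arity w i). map (val ys) (map (sort_tm w i) ts) \<in> R}} =
      {xs \<in> tuples DU w. sat DU xs (Rel v R ts)}"
  proof -
    have "map (val (sel (\<lambda>s. s = i) w xs)) (map (sort_tm w i) ts) = map (val xs) ts"
      if "xs \<in> tuples DU w" for xs
      using sort_tm(2)[OF ts i(1) length_tuples[OF that]] by (simp add: comp_def)
    then show ?thesis
      by (auto simp: sel_in_tuples_M simp del: map_map)
  qed
  finally show ?case .
next
  case (Equal i t u)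
  then have wf: "wf_tm DU w t i" "wf_tm DU w u i"
    by auto
  have i: "i \<in> {1..n}"
    using wf(1) Equal.prems(1) by (cases t) (auto dest: nth_mem)
  have "box_union w {xs \<in> tuples DU w. sel (\<lambda>s. s = i) w xs \<in>
      {ys \<in> tuples (M i) (sort_arity w i). val ys (sort_tm w i t) = val ys (sort_tm w i u)}}"
    using i set_sort_arity sort_tm(1)[OF wf(1)] sort_tm(1)[OF wf(2)]
    by (intro box_union_sort fo_struct.definable_Equal[where s = "()"] comp_fo_struct) auto
  also have "{xs \<in> tuples DU w. sel (\<lambda>s. s = i) w xs \<in>
      {ys \<in> tuples (M i) (sort_arity w i). val ys (sort_tm w i t) = val ys (sort_tm w i u)}} =
      {xs \<in> tuples DU w. sat DU xs (Equal i t u)}"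
    using sort_tm(2)[OF wf(1) i] sort_tm(2)[OF wf(2) i]
    by (auto simp: sel_in_tuples_M length_tuples)
  finally show ?case .
next
  case (Neg \<phi>)
  then have "box_union w (tuples DU w - {xs \<in> tuples DU w. sat DU xs \<phi>})"
    by (intro box_union_compl) auto
  also have "tuples DU w - {xs \<in> tuples DU w. sat DU xs \<phi>} = {xs \<in> tuples DU w. sat DU xs (Neg \<phi>)}"
    by auto
  finally show ?case .
next
  case (Conj \<phi> \<psi>)
  then have "box_union w ({xs \<in> tuples DU w. sat DU xs \<phi>} \<inter> {xs \<in> tuples DU w. sat DU xs \<psi>})"
    by (intro box_union_Int) auto
  also have "{xs \<in> tuples DU w. sat DU xs \<phi>} \<inter> {xs \<in> tuples DU w. sat DU xs \<psi>} =
      {xs \<in> tuples DU w. sat DU xs (Conj \<phi> \<psi>)}"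
    by auto
  finally show ?case .
next
  case (Exists s \<phi>)
  then have "box_union w {xs \<in> tuples DU w. \<exists>a\<in>univ (M s) (). a # xs \<in>
      {xs \<in> tuples DU (s # w). sat DU xs \<phi>}}"
    by (intro box_union_proj_Cons Exists.IH) auto
  also have "{xs \<in> tuples DU w. \<exists>a\<in>univ (M s) (). a # xs \<in>
      {xs \<in> tuples DU (s # w). sat DU xs \<phi>}} = {xs \<in> tuples DU w. sat DU xs (Exists s \<phi>)}"
    by auto
  finally show ?case .
qed

lemma definable_box_union: "definable DU w D \<Longrightarrow> box_union w D"
  unfolding definable_def using box_union_sat by auto

lemma sel_single_sort:
  "length xs = length v \<Longrightarrow> sel (\<lambda>s. s = j) (map (\<lambda>_. i) v) xs = (if i = j then xs else [])"
  by (induction xs v rule: list_induct2) auto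

text \<open>The disjoint union induces no new definable sets on a sort. So one-sorted sets may be
  treated in the disjoint union, where the group lives, and then be moved to
  \<open>M i\<close>.\<close>

lemma definable_trace:
  assumes i: "i \<in> {1..n}" and "definable DU (map (\<lambda>_. i) v) D"
  shows "definable (M i) v D"
proof -
  let ?w = "map (\<lambda>_. i) v"
  obtain \<B> where \<B>: "finite \<B>" "D = (\<Union>C\<in>\<B>. box ?w C)"
    "\<And>C i. C \<in> \<B> \<Longrightarrow> i \<in> {1..n} \<Longrightarrow> definable (M i) (sort_arity ?w i) (C i)"
    using definable_box_union[OF assms(2)] unfolding box_union_def by auto
  have code_arity: "sort_arity ?w i = v"
    by (simp add: sort_arity_def comp_def map_idI)
  \<comment> \<open>A one-sorted tuple has no entries of a sort \<open>j\<close> other than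
    \<open>i\<close>, so the factor of \<open>j\<close> reduces to the condition
    \<open>[] \<in> C j\<close>. Boxes that violate it are empty, and in the others only
    \<open>C i\<close> remains.\<close>
  let ?\<B> = "{C \<in> \<B>. \<forall>j\<in>{1..n} - {i}. [] \<in> C j}"
  have "definable (M i) v (\<Union>C\<in>?\<B>. C i)"
    using \<B>(1) \<B>(3)[OF _ i] i code_arity by (intro fo_struct.definable_UN comp_fo_struct) (auto simp: sorts_M)
  also have "(\<Union>C\<in>?\<B>. C i) = D"
  proof -
    have "xs \<in> box ?w C \<longleftrightarrow> xs \<in> C i \<and> (\<forall>j\<in>{1..n} - {i}. [] \<in> C j)" if "C \<in> \<B>" for C xs
    proof -
      have "C i \<subseteq> tuples (M i) v"
        using \<B>(3)[OF that i] code_arity definable_in_tuples by metis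
      then show ?thesis
        using i by (auto simp: box_def tuples_DU_map sel_single_sort length_tuples subset_iff
          split: if_splits)
    qed
    then show ?thesis
      unfolding \<B>(2) by blast
  qed
  finally show ?thesis .
qed

end

section \<open>Groups whose multiplication is a union of rectangles\<close>

lemma ex_power_less_fact: "\<exists>t. (c::nat) ^ t < fact t"
proof (cases "c = 0")
  case True
  then show ?thesis by (intro exI[of _ 1]) auto
next
  case False
  \<comment> \<open>Every factor of the factorial beyond \<open>N = 2 * c\<close> is at least twice
    \<open>c\<close>. The first \<open>N\<close> factors may lose up to \<open>c ^ N = k\<close>,
    which \<open>k\<close> further factors make up for, since \<open>k < 2 ^ k\<close>.\<close>
  define N k where "N = 2 * c" and "k = c ^ N"
  have *: "N ^ j \<le> fact (N + j)" for j
  proof (induction j)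
    case (Suc j)
    have "N ^ Suc j \<le> (N + Suc j) * fact (N + j)"
      unfolding power_Suc using Suc by (intro mult_mono) auto
    then show ?case by simp
  qed simp
  have "c ^ (N + k) = k * c ^ k"
    by (simp add: power_add k_def)
  also have "\<dots> < 2 ^ k * c ^ k"
    using False by (intro mult_strict_right_mono) auto
  also have "\<dots> = N ^ k"
    by (simp add: N_def power_mult_distrib)
  also have "\<dots> \<le> fact (N + k)"
    by (rule *)
  finally show ?thesis by blast
qed

text \<open>
  The rectangles in \<open>L\<close> serve as labels of the products \<open>g \<otimes> h\<close>. As all of \<open>P \<times> Q\<close> lies in the graph,
  the label and the \<open>u\<close>-coordinates of \<open>g\<close> and \<open>h\<close> determine that of \<open>g \<otimes> h\<close>, and likewise for \<open>v\<close>.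
\<close>

locale rect_group = comm_group G for G (structure) +
  fixes u :: "'a \<Rightarrow> 'u" and v :: "'a \<Rightarrow> 'v"
    and L :: "(('u \<times> 'u \<times> 'u) set \<times> ('v \<times> 'v \<times> 'v) set) set"
  assumes uv_inject: "\<lbrakk>g \<in> carrier G; h \<in> carrier G; u g = u h; v g = v h\<rbrakk> \<Longrightarrow> g = h"
    and finite_L: "finite L"
    and graph_eq: "{((u g, u h, u (g \<otimes> h)), (v g, v h, v (g \<otimes> h))) | g h.
      g \<in> carrier G \<and> h \<in> carrier G} = (\<Union>(P, Q)\<in>L. P \<times> Q)"
begin

lemma swap: "rect_group G v u ((\<lambda>(P, Q). (Q, P)) ` L)"
proof unfold_locales
  have "{((v g, v h, v (g \<otimes> h)), (u g, u h, u (g \<otimes> h))) | g h. g \<in> carrier G \<and> h \<in> carrier G} =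
      prod.swap ` {((u g, u h, u (g \<otimes> h)), (v g, v h, v (g \<otimes> h))) | g h.
        g \<in> carrier G \<and> h \<in> carrier G}"
    by force
  also have "\<dots> = (\<Union>(P, Q)\<in>(\<lambda>(P, Q). (Q, P)) ` L. P \<times> Q)"
    unfolding graph_eq by force
  finally show "{((v g, v h, v (g \<otimes> h)), (u g, u h, u (g \<otimes> h))) | g h.
      g \<in> carrier G \<and> h \<in> carrier G} = (\<Union>(P, Q)\<in>(\<lambda>(P, Q). (Q, P)) ` L. P \<times> Q)" .
qed (use uv_inject finite_L in auto)

lemma label_exists:
  assumes "g \<in> carrier G" "h \<in> carrier G"
  obtains l where "l \<in> L" "(u g, u h, u (g \<otimes> h)) \<in> fst l" "(v g, v h, v (g \<otimes> h)) \<in> snd l"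
proof -
  have "((u g, u h, u (g \<otimes> h)), (v g, v h, v (g \<otimes> h))) \<in> (\<Union>(P, Q)\<in>L. P \<times> Q)"
    using assms graph_eq by blast
  then show ?thesis using that by force
qed

lemma label_realized:
  assumes "l \<in> L" "(a, b, c) \<in> fst l" "(a', b', c') \<in> snd l"
  obtains g h where "g \<in> carrier G" "h \<in> carrier G" "a = u g" "b = u h" "c = u (g \<otimes> h)"
    "a' = v g" "b' = v h" "c' = v (g \<otimes> h)"
proof -
  have "((a, b, c), (a', b', c')) \<in> (\<Union>(P, Q)\<in>L. P \<times> Q)"
    using assms by force
  then show ?thesis using that unfolding graph_eq[symmetric] by blast
qed

text \<open>Pair both triples with the same triple of \<open>snd l\<close>: the two products then
  have the same factors, so they coincide. If \<open>snd l\<close> were empty, the graph would say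
  nothing about \<open>fst l\<close>.\<close>

lemma label_mult_unique:
  assumes "l \<in> L" "snd l \<noteq> {}" "(a, b, c) \<in> fst l" "(a, b, c') \<in> fst l"
  shows "c = c'"
proof -
  obtain p q r where pqr: "(p, q, r) \<in> snd l" using assms(2) by auto
  from label_realized[OF assms(1,3) pqr] obtain g h where gh: "g \<in> carrier G" "h \<in> carrier G"
    "a = u g" "b = u h" "c = u (g \<otimes> h)" "p = v g" "q = v h" by metis
  from label_realized[OF assms(1,4) pqr] obtain g' h' where gh': "g' \<in> carrier G" "h' \<in> carrier G"
    "a = u g'" "b = u h'" "c' = u (g' \<otimes> h')" "p = v g'" "q = v h'" by metis
  have "g = g'" "h = h'" using gh gh' uv_inject by auto
  then show ?thesis using gh gh' by simp
qed

text \<open>The same pairing as for products; now the first factors and the products agree, and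
  cancellation gives the second factors.\<close>

lemma label_div_unique:
  assumes "l \<in> L" "snd l \<noteq> {}" "(a, b, c) \<in> fst l" "(a, b', c) \<in> fst l"
  shows "b = b'"
proof -
  obtain p q r where pqr: "(p, q, r) \<in> snd l" using assms(2) by auto
  from label_realized[OF assms(1,3) pqr] obtain g h where gh: "g \<in> carrier G" "h \<in> carrier G"
    "a = u g" "b = u h" "c = u (g \<otimes> h)" "p = v g" "r = v (g \<otimes> h)" by metis
  from label_realized[OF assms(1,4) pqr] obtain g' h' where gh': "g' \<in> carrier G" "h' \<in> carrier G"
    "a = u g'" "b' = u h'" "c = u (g' \<otimes> h')" "p = v g'" "r = v (g' \<otimes> h')" by metis
  have "g = g'" "g \<otimes> h = g' \<otimes> h'"
    using gh gh' uv_inject[of g g'] uv_inject[of "g \<otimes> h" "g' \<otimes> h'"] by auto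
  then show ?thesis using gh gh' by simp
qed

lemma finite_u_mult:
  assumes "S \<subseteq> carrier G" "S' \<subseteq> carrier G" "finite (u ` S)" "finite (u ` S')"
  shows "finite (u ` (S <#> S'))"
proof (rule finite_subset)
  show "u ` (S <#> S') \<subseteq> (\<lambda>(a, b, l). THE c. (a, b, c) \<in> fst l) ` (u ` S \<times> u ` S' \<times> L)"
  proof
    fix c assume "c \<in> u ` (S <#> S')"
    then obtain g h where gh: "g \<in> S" "h \<in> S'" "c = u (g \<otimes> h)"
      unfolding set_mult_def by auto
    then obtain l where l: "l \<in> L" "(u g, u h, c) \<in> fst l" "snd l \<noteq> {}"
      using assms label_exists[of g h] by (metis empty_iff subsetD)
    have "(THE c. (u g, u h, c) \<in> fst l) = c"
      using l label_mult_unique by (intro the_equality) auto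
    then show "c \<in> (\<lambda>(a, b, l). THE c. (a, b, c) \<in> fst l) ` (u ` S \<times> u ` S' \<times> L)"
      using gh l by force
  qed
qed (use assms finite_L in auto)

text \<open>The inverse of \<open>g\<close> is the second factor of a product with value
  \<open>\<one>\<close>, so division determines its coordinate from \<open>u g\<close> and a
  label.\<close>

lemma finite_u_inv:
  assumes "S \<subseteq> carrier G" "finite (u ` S)"
  shows "finite (u ` m_inv G ` S)"
proof (rule finite_subset)
  show "u ` m_inv G ` S \<subseteq> (\<lambda>(a, l). THE b. (a, b, u \<one>) \<in> fst l) ` (u ` S \<times> L)"
  proof
    fix b assume "b \<in> u ` m_inv G ` S"
    then obtain g where g: "g \<in> S" "b = u (inv g)" by auto
    then have "g \<in> carrier G" "inv g \<in> carrier G"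
      using assms(1) by auto
    then obtain l where l: "l \<in> L" "(u g, b, u \<one>) \<in> fst l" "snd l \<noteq> {}"
      using label_exists[of g "inv g"] g(2) by (metis empty_iff r_inv)
    have "(THE b. (u g, b, u \<one>) \<in> fst l) = b"
      using l label_div_unique by (intro the_equality) auto
    then show "b \<in> (\<lambda>(a, l). THE b. (a, b, u \<one>) \<in> fst l) ` (u ` S \<times> L)"
      using g l by force
  qed
qed (use assms finite_L in auto)

lemma finprod_lessThan_Suc:
  assumes "\<And>p. p < Suc m \<Longrightarrow> f p \<in> carrier G"
  shows "finprod G f {..<Suc m} = finprod G f {..<m} \<otimes> f m"
proof -
  have "finprod G f (insert m {..<m}) = f m \<otimes> finprod G f {..<m}"
    using assms by (intro finprod_insert) auto
  moreover have "finprod G f {..<m} \<in> carrier G"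
    using assms by (intro finprod_closed) auto
  ultimately show ?thesis
    using assms by (simp add: lessThan_Suc m_comm)
qed

text \<open>
  Once the \<open>u\<close>-coordinates of the factors are fixed, the \<open>u\<close>-coordinate of a product of \<open>m\<close> factors
  depends only on the labels met while multiplying.
\<close>

lemma few_u_values:
  "\<exists>X. finite X \<and> card X \<le> card L ^ m \<and>
    (\<forall>g. (\<forall>p<m. g p \<in> carrier G \<and> u (g p) = xs p) \<longrightarrow> u (finprod G g {..<m}) \<in> X)"
proof (induction m)
  case 0
  then show ?case by (intro exI[of _ "{u \<one>}"]) auto
next
  case (Suc m)
  then obtain X where X: "finite X" "card X \<le> card L ^ m"
    "\<And>g. (\<And>p. p < m \<Longrightarrow> g p \<in> carrier G \<and> u (g p) = xs p) \<Longrightarrow> u (finprod G g {..<m}) \<in> X"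
    by blast
  define Y where "Y = (\<lambda>(a, l). THE c. (a, xs m, c) \<in> fst l) ` (X \<times> L)"
  have "finite Y"
    unfolding Y_def using X finite_L by auto
  moreover have "card Y \<le> card L ^ Suc m"
  proof -
    have "card Y \<le> card (X \<times> L)"
      unfolding Y_def using X finite_L by (intro card_image_le) auto
    also have "\<dots> \<le> card L ^ m * card L"
      using X(2) by (simp add: card_cartesian_product)
    finally show ?thesis by (simp add: mult.commute)
  qed
  moreover have "u (finprod G g {..<Suc m}) \<in> Y"
    if g: "\<forall>p<Suc m. g p \<in> carrier G \<and> u (g p) = xs p" for g
  proof -
    let ?h = "finprod G g {..<m}"
    have h: "?h \<in> carrier G" "u ?h \<in> X"
      using g by (auto intro!: finprod_closed X(3))
    have eq: "finprod G g {..<Suc m} = ?h \<otimes> g m"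
      using g by (intro finprod_lessThan_Suc) auto
    obtain l where l: "l \<in> L" "(u ?h, xs m, u (?h \<otimes> g m)) \<in> fst l" "snd l \<noteq> {}"
      using label_exists[OF h(1), of "g m"] g by (metis empty_iff lessI)
    have "(THE c. (u ?h, xs m, c) \<in> fst l) = u (?h \<otimes> g m)"
      using l label_mult_unique by (intro the_equality) auto
    then show ?thesis
      unfolding eq Y_def using h l by force
  qed
  ultimately show ?case by blast
qed

end

section \<open>Rectangles of coordinates inside the group\<close>

locale rect_patch = rect_group +
  fixes A :: "'u set" and B :: "'v set" and F :: "'u \<Rightarrow> 'v \<Rightarrow> 'a"
  assumes F_closed [simp]: "x \<in> A \<Longrightarrow> y \<in> B \<Longrightarrow> F x y \<in> carrier G"
    and u_F: "x \<in> A \<Longrightarrow> y \<in> B \<Longrightarrow> u (F x y) = x"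
    and v_F: "x \<in> A \<Longrightarrow> y \<in> B \<Longrightarrow> v (F x y) = y"
begin

text \<open>
  By commutativity the product can be taken in the order of the rows or of the columns, so both
  of its coordinates take few values, while there are \<open>t!\<close> permutations.
\<close>

lemma permutations_collide:
  assumes t: "(card L * card L) ^ t < fact t"
    and xs: "\<And>p. p < t \<Longrightarrow> xs p \<in> A" and ys: "\<And>p. p < t \<Longrightarrow> ys p \<in> B"
  obtains \<pi> \<pi>' where "\<pi> permutes {..<t}" "\<pi>' permutes {..<t}" "\<pi> \<noteq> \<pi>'"
    "finprod G (\<lambda>p. F (xs p) (ys (\<pi> p))) {..<t} = finprod G (\<lambda>p. F (xs p) (ys (\<pi>' p))) {..<t}"
proof -
  interpret sw: rect_group G v u "(\<lambda>(P, Q). (Q, P)) ` L"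
    by (rule swap)
  define e where "e \<pi> = finprod G (\<lambda>p. F (xs p) (ys (\<pi> p))) {..<t}" for \<pi>
  obtain X where X: "finite X" "card X \<le> card L ^ t"
    "\<And>g. (\<forall>p<t. g p \<in> carrier G \<and> u (g p) = xs p) \<Longrightarrow> u (finprod G g {..<t}) \<in> X"
    using few_u_values[of t xs] by auto
  have "card ((\<lambda>(P, Q). (Q, P)) ` L) \<le> card L"
    using finite_L by (rule card_image_le)
  then obtain Y where Y: "finite Y" "card Y \<le> card L ^ t"
    "\<And>g. (\<forall>p<t. g p \<in> carrier G \<and> v (g p) = ys p) \<Longrightarrow> v (finprod G g {..<t}) \<in> Y"
    using sw.few_u_values[of t ys] by (meson le_trans power_mono zero_le)
  let ?Perm = "{\<pi>. \<pi> permutes {..<t}}"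
  have e_closed: "e \<pi> \<in> carrier G" and uX: "u (e \<pi>) \<in> X" and vY: "v (e \<pi>) \<in> Y"
    if \<pi>: "\<pi> permutes {..<t}" for \<pi>
  proof -
    have lt: "\<pi> p < t" if "p < t" for p
      using permutes_in_image[OF \<pi>] that by auto
    have lt': "inv_into UNIV \<pi> p < t" if "p < t" for p
      using permutes_in_image[OF permutes_inv[OF \<pi>]] that by auto
    show "e \<pi> \<in> carrier G"
      unfolding e_def using xs ys lt by (intro finprod_closed) auto
    show "u (e \<pi>) \<in> X"
      unfolding e_def using xs ys lt u_F by (intro X(3)) auto
    \<comment> \<open>Reindexing by \<open>\<pi>\<close> attaches the \<open>q\<close>-th factor to
      the column \<open>ys q\<close>, whatever \<open>\<pi>\<close> is, as the count of the
      \<open>v\<close>-values requires.\<close>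
    have "finprod G (\<lambda>q. F (xs (inv_into UNIV \<pi> q)) (ys q)) (\<pi> ` {..<t}) =
        finprod G (\<lambda>p. F (xs (inv_into UNIV \<pi> (\<pi> p))) (ys (\<pi> p))) {..<t}"
      using xs ys lt lt' permutes_inj_on[OF \<pi>] permutes_image[OF \<pi>]
      by (intro finprod_reindex) auto
    then have "e \<pi> = finprod G (\<lambda>q. F (xs (inv_into UNIV \<pi> q)) (ys q)) {..<t}"
      using permutes_image[OF \<pi>] permutes_inverses(2)[OF \<pi>] by (simp add: e_def)
    also have "v \<dots> \<in> Y"
      using xs ys lt' v_F by (intro Y(3)) auto
    finally show "v (e \<pi>) \<in> Y" .
  qed
  have "\<not> inj_on (\<lambda>\<pi>. (u (e \<pi>), v (e \<pi>))) ?Perm"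
  proof
    assume "inj_on (\<lambda>\<pi>. (u (e \<pi>), v (e \<pi>))) ?Perm"
    then have "card ?Perm \<le> card (X \<times> Y)"
      using X Y uX vY by (intro card_inj_on_le) auto
    also have "\<dots> \<le> card L ^ t * card L ^ t"
      using X Y by (auto simp: card_cartesian_product intro: mult_mono)
    also have "\<dots> < fact t"
      using t by (simp add: power_mult_distrib)
    finally show False
      by (simp add: card_permutations)
  qed
  then obtain \<pi> \<pi>' where "\<pi> permutes {..<t}" "\<pi>' permutes {..<t}" "\<pi> \<noteq> \<pi>'"
    "u (e \<pi>) = u (e \<pi>')" "v (e \<pi>) = v (e \<pi>')"
    unfolding inj_on_def by auto
  then show ?thesis
    using that uv_inject e_closed unfolding e_def by blast
qed

text \<open>The difference of two columns in row \<open>x\<close>: the element that carries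
  \<open>F x y'\<close> to \<open>F x y\<close>.\<close>

definition D :: "'v \<Rightarrow> 'v \<Rightarrow> 'u \<Rightarrow> 'a" where
  "D y y' x = F x y \<otimes> inv F x y'"

text \<open>The kernel of \<open>D y y'\<close> as a map of sets, an equivalence relation on
  \<open>A\<close> whose classes are the fibres. It is trivial on \<open>A'\<close> if it contains
  \<open>A' \<times> A'\<close>, that is, if the two columns differ by a constant there.\<close>

definition kerD :: "'v \<Rightarrow> 'v \<Rightarrow> ('u \<times> 'u) set" where
  "kerD y y' = {(x, x'). x \<in> A \<and> x' \<in> A \<and> D y y' x = D y y' x'}"

definition kers :: "('u \<times> 'u) set set" where
  "kers = {kerD y y' | y y'. y \<in> B \<and> y' \<in> B}"

lemma D_closed [simp]: "x \<in> A \<Longrightarrow> y \<in> B \<Longrightarrow> y' \<in> B \<Longrightarrow> D y y' x \<in> carrier G"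
  by (simp add: D_def)

lemma D_eq_iff:
  assumes "x \<in> A" "y \<in> B" "y' \<in> B" "g \<in> carrier G"
  shows "D y y' x = g \<longleftrightarrow> F x y' \<otimes> g = F x y"
  using assms unfolding D_def by (metis F_closed inv_solve_right m_comm)

lemma kerD_sym:
  assumes "y \<in> B" "y' \<in> B"
  shows "kerD y y' = kerD y' y"
proof -
  have "D y y' x = inv (D y' y x)" if "x \<in> A" for x
    using that assms by (simp add: D_def inv_mult_group)
  then show ?thesis
    using assms unfolding kerD_def by (auto dest: inv_eq_imp_eq simp: inv_equality)
qed

text \<open>For \<open>g = D y y' x\<close> the graph entry of
  \<open>F x y' \<otimes> g = F x y\<close> has the parts \<open>(x, u g, x)\<close> and
  \<open>(y', v g, y)\<close>. Two rows are related iff they share \<open>g\<close>, that is, both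
  of its coordinates. So the columns matter only through the set of pairs of labels whose second
  parts have some \<open>(y', k, y)\<close> in common, and there are finitely many such
  sets.\<close>

lemma finite_kers: "finite kers"
proof -
  define K where "K l l' = {(x, x'). x \<in> A \<and> x' \<in> A \<and> (\<exists>k. (x, k, x) \<in> fst l \<and> (x', k, x') \<in> fst l')}"
    for l l' :: "('u \<times> 'u \<times> 'u) set \<times> ('v \<times> 'v \<times> 'v) set"
  have "kerD y y' \<in> (\<lambda>I. \<Union>(l, l')\<in>I. K l l') ` Pow (L \<times> L)" if y: "y \<in> B" "y' \<in> B" for y y'
  proof
    let ?I = "{(l, l'). l \<in> L \<and> l' \<in> L \<and> (\<exists>k. (y', k, y) \<in> snd l \<and> (y', k, y) \<in> snd l')}"
    show "?I \<in> Pow (L \<times> L)" by auto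
    show "kerD y y' = (\<Union>(l, l')\<in>?I. K l l')"
    proof (intro Set.equalityI subsetI)
      fix z assume "z \<in> kerD y y'"
      then obtain x x' where z: "z = (x, x')" "x \<in> A" "x' \<in> A" "D y y' x = D y y' x'"
        by (auto simp: kerD_def)
      define g where "g = D y y' x"
      have g: "g \<in> carrier G" "F x y' \<otimes> g = F x y" "F x' y' \<otimes> g = F x' y"
        using z y D_eq_iff unfolding g_def by (metis D_closed)+
      obtain l where l: "l \<in> L" "(x, u g, x) \<in> fst l" "(y', v g, y) \<in> snd l"
        using label_exists[of "F x y'" g] g z y by (metis F_closed u_F v_F)
      obtain l' where l': "l' \<in> L" "(x', u g, x') \<in> fst l'" "(y', v g, y) \<in> snd l'"
        using label_exists[of "F x' y'" g] g z y by (metis F_closed u_F v_F)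
      show "z \<in> (\<Union>(l, l')\<in>?I. K l l')"
        using l l' z unfolding K_def by blast
    next
      \<comment> \<open>\<open>k\<close> and \<open>k'\<close> may come from unrelated graph
        entries. As the whole rectangle lies in the graph, they are still the coordinates of one
        element, and it has to be \<open>D y y' x\<close>.\<close>
      have *: "\<exists>h\<in>carrier G. u h = k \<and> v h = k' \<and> D y y' x = h"
        if "l \<in> L" "x \<in> A" "(x, k, x) \<in> fst l" "(y', k', y) \<in> snd l" for l x k k'
      proof -
        from label_realized[OF that(1,3,4)] obtain g h where gh: "g \<in> carrier G" "h \<in> carrier G"
          "x = u g" "k = u h" "x = u (g \<otimes> h)" "y' = v g" "k' = v h" "y = v (g \<otimes> h)" .
        have "F x y' = g" "F x y = g \<otimes> h"
          using gh that(2) y by (auto intro!: uv_inject simp: u_F v_F)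
        then show ?thesis
          using gh that(2) y D_eq_iff[of x y y' h] by auto
      qed
      fix z assume "z \<in> (\<Union>(l, l')\<in>?I. K l l')"
      then obtain l l' x x' k k' where z: "z = (x, x')" "x \<in> A" "x' \<in> A" "l \<in> L" "l' \<in> L"
        "(x, k, x) \<in> fst l" "(x', k, x') \<in> fst l'" "(y', k', y) \<in> snd l" "(y', k', y) \<in> snd l'"
        unfolding K_def by blast
      then obtain h h' where "h \<in> carrier G" "h' \<in> carrier G" "u h = u h'" "v h = v h'"
        "D y y' x = h" "D y y' x' = h'"
        using * by metis
      then show "z \<in> kerD y y'"
        using uv_inject[of h h'] z by (auto simp: kerD_def)
    qed
  qed
  then have "kers \<subseteq> (\<lambda>I. \<Union>(l, l')\<in>I. K l l') ` Pow (L \<times> L)"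
    unfolding kers_def by auto
  then show ?thesis
    using finite_L by (meson finite_SigmaI finite_Pow_iff finite_imageI finite_subset)
qed

definition patch_gen :: "'u set \<Rightarrow> 'v set \<Rightarrow> 'a set" where
  "patch_gen A0 B0 = generate G ({F x y | x y. x \<in> A \<and> y \<in> B0} \<union> {F x y | x y. x \<in> A0 \<and> y \<in> B})"

lemma patch_gen_mono: "A0 \<subseteq> A1 \<Longrightarrow> B0 \<subseteq> B1 \<Longrightarrow> patch_gen A0 B0 \<subseteq> patch_gen A1 B1"
  unfolding patch_gen_def by (intro mono_generate) blast

lemma patch_gen_subgroup: "A0 \<subseteq> A \<Longrightarrow> B0 \<subseteq> B \<Longrightarrow> subgroup (patch_gen A0 B0) G"
  unfolding patch_gen_def by (intro generate_is_subgroup) auto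

text \<open>
  Rows chosen one after another outside finitely many kernel classes make all products over
  choice functions distinct, against \<open>permutations_collide\<close>.
\<close>

lemma few_columns:
  assumes t: "(card L * card L) ^ t < fact t" and A': "A' \<subseteq> A"
    and not_covered: "\<And>K. finite K \<Longrightarrow> K \<subseteq> {\<theta> \<in> kers. \<not> A' \<times> A' \<subseteq> \<theta>} \<times> A' \<Longrightarrow>
      \<not> A' \<subseteq> (\<Union>(\<theta>, x)\<in>K. \<theta> `` {x})"
    and ys: "\<And>a. a < t \<Longrightarrow> ys a \<in> B"
    and nontrivial: "\<And>a b. a < t \<Longrightarrow> b < t \<Longrightarrow> a \<noteq> b \<Longrightarrow> \<not> A' \<times> A' \<subseteq> kerD (ys a) (ys b)"
  shows False
proof -
  define S where "S xs \<phi> m = finprod G (\<lambda>p. F (xs p) (ys (\<phi> p))) {..<m}" for xs \<phi> and m :: nat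
  have S_closed: "S xs \<phi> m \<in> carrier G" if "\<And>p. p < m \<Longrightarrow> xs p \<in> A'" "\<And>p. p < m \<Longrightarrow> \<phi> p < t" for xs \<phi> m
    unfolding S_def using that ys by (intro finprod_closed) (auto intro!: F_closed intro: subsetD[OF A'])
  have "\<exists>xs. (\<forall>p<m. xs p \<in> A') \<and> (\<forall>\<phi> \<psi>. (\<forall>p<m. \<phi> p < t \<and> \<psi> p < t) \<longrightarrow>
      S xs \<phi> m = S xs \<psi> m \<longrightarrow> (\<forall>p<m. \<phi> p = \<psi> p))" for m
  proof (induction m)
    case (Suc m)
    then obtain xs where xs: "\<And>p. p < m \<Longrightarrow> xs p \<in> A'"
      and inj: "\<And>\<phi> \<psi>. (\<And>p. p < m \<Longrightarrow> \<phi> p < t \<and> \<psi> p < t) \<Longrightarrow>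
        S xs \<phi> m = S xs \<psi> m \<Longrightarrow> (\<forall>p<m. \<phi> p = \<psi> p)"
      by blast
    \<comment> \<open>Only the values of \<open>\<phi>\<close> below \<open>m\<close> matter, so the
      partial products range over a finite set.\<close>
    define V where "V = (\<lambda>\<phi>. S xs \<phi> m) ` ({..<m} \<rightarrow>\<^sub>E {..<t})"
    have "finite V"
      unfolding V_def by (auto intro!: finite_PiE)
    have V_closed: "V \<subseteq> carrier G"
      unfolding V_def using xs by (auto intro!: S_closed)
    have S_in_V: "S xs \<phi> m \<in> V" if "\<And>p. p < m \<Longrightarrow> \<phi> p < t" for \<phi>
      unfolding V_def
    proof
      show "S xs \<phi> m = S xs (restrict \<phi> {..<m}) m"
        unfolding S_def using that xs ys by (intro finprod_cong') (auto intro!: F_closed intro: subsetD[OF A'])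
    qed (use that in auto)
    \<comment> \<open>These are the rows at which \<open>g\<close>, extended in column
      \<open>ys a\<close>, and \<open>h\<close>, extended in column \<open>ys b\<close>, give the
      same product. \<open>D (ys a) (ys b)\<close> is constant on them, so they lie in one kernel
      class; \<open>K\<close> collects a representative of each. A new row outside the classes in
      \<open>K\<close> keeps the products distinct.\<close>
    define X where "X g h a b = {x \<in> A'. D (ys a) (ys b) x = inv g \<otimes> h}" for g h a b
    define I where "I = {(g, h, a, b). (g, h, a, b) \<in> V \<times> V \<times> {..<t} \<times> {..<t} \<and> a \<noteq> b \<and> X g h a b \<noteq> {}}"
    define K where "K = (\<lambda>(g, h, a, b). (kerD (ys a) (ys b), SOME x. x \<in> X g h a b)) ` I"
    have "finite I"
      by (rule finite_subset[of _ "V \<times> V \<times> {..<t} \<times> {..<t}"]) (use \<open>finite V\<close> in \<open>auto simp: I_def\<close>)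
    then have "finite K"
      by (simp add: K_def)
    moreover have some_X: "(SOME x. x \<in> X g h a b) \<in> X g h a b" if "X g h a b \<noteq> {}" for g h a b
      using that by (auto intro: someI)
    have "K \<subseteq> {\<theta> \<in> kers. \<not> A' \<times> A' \<subseteq> \<theta>} \<times> A'"
    proof
      fix k assume "k \<in> K"
      then obtain g h a b where "k = (kerD (ys a) (ys b), SOME x. x \<in> X g h a b)"
        "a < t" "b < t" "a \<noteq> b" "X g h a b \<noteq> {}"
      proof -
        from \<open>k \<in> K\<close> obtain i where "i \<in> I"
          "k = (\<lambda>(g, h, a, b). (kerD (ys a) (ys b), SOME x. x \<in> X g h a b)) i"
          unfolding K_def by blast
        moreover obtain g h a b where "i = (g, h, a, b)"
          by (cases i)
        ultimately show ?thesis
          using that[of a b g h] by (simp add: I_def)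
      qed
      then show "k \<in> {\<theta> \<in> kers. \<not> A' \<times> A' \<subseteq> \<theta>} \<times> A'"
        using some_X[of g h a b] nontrivial[of a b] ys unfolding kers_def X_def by auto
    qed
    ultimately obtain x where x: "x \<in> A'" "x \<notin> (\<Union>(\<theta>, x)\<in>K. \<theta> `` {x})"
      using not_covered[of K] by blast
    have avoid: "g \<otimes> F x (ys a) \<noteq> h \<otimes> F x (ys b)"
      if "g \<in> V" "h \<in> V" "a < t" "b < t" "a \<noteq> b" for g h a b
    proof
      assume eq: "g \<otimes> F x (ys a) = h \<otimes> F x (ys b)"
      have c: "g \<in> carrier G" "h \<in> carrier G" "F x (ys a) \<in> carrier G" "F x (ys b) \<in> carrier G"
        using that V_closed x(1) A' ys by auto
      have "F x (ys b) \<otimes> (inv g \<otimes> h) = inv g \<otimes> (h \<otimes> F x (ys b))"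
        using c by (simp add: m_ac)
      also have "\<dots> = F x (ys a)"
        using c by (simp flip: eq add: m_assoc[symmetric])
      finally have "D (ys a) (ys b) x = inv g \<otimes> h"
        using c x(1) A' ys that by (subst D_eq_iff) auto
      then have X: "x \<in> X g h a b"
        using x(1) by (simp add: X_def)
      define x' where "x' = (SOME x. x \<in> X g h a b)"
      have "(kerD (ys a) (ys b), x') \<in> K"
        unfolding K_def I_def x'_def using that X by force
      moreover have "(x', x) \<in> kerD (ys a) (ys b)"
        using some_X[of g h a b] X A' unfolding x'_def[symmetric] by (auto simp: X_def kerD_def)
      ultimately show False
        using x(2) by blast
    qed
    define xs' where "xs' = xs(m := x)"
    have S_Suc: "S xs' \<phi> (Suc m) = S xs \<phi> m \<otimes> F x (ys (\<phi> m))" if "\<forall>p<Suc m. \<phi> p < t" for \<phi>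
    proof -
      have "S xs' \<phi> (Suc m) = S xs' \<phi> m \<otimes> F x (ys (\<phi> m))"
        unfolding S_def using that xs x ys
        by (subst finprod_lessThan_Suc)
           (auto simp: xs'_def less_Suc_eq intro!: F_closed intro: subsetD[OF A'])
      also have "S xs' \<phi> m = S xs \<phi> m"
        unfolding S_def using that xs ys
        by (intro finprod_cong') (auto simp: xs'_def intro!: F_closed intro: subsetD[OF A'])
      finally show ?thesis .
    qed
    have "\<forall>p<Suc m. \<phi> p = \<psi> p"
      if lt: "\<forall>p<Suc m. \<phi> p < t \<and> \<psi> p < t" and eq: "S xs' \<phi> (Suc m) = S xs' \<psi> (Suc m)" for \<phi> \<psi>
    proof -
      have eq': "S xs \<phi> m \<otimes> F x (ys (\<phi> m)) = S xs \<psi> m \<otimes> F x (ys (\<psi> m))"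
        using S_Suc[of \<phi>] S_Suc[of \<psi>] lt eq by auto
      have "\<phi> m = \<psi> m"
      proof (rule ccontr)
        assume "\<phi> m \<noteq> \<psi> m"
        then show False
          using avoid[of "S xs \<phi> m" "S xs \<psi> m" "\<phi> m" "\<psi> m"] eq' lt S_in_V by auto
      qed
      moreover have "S xs \<phi> m \<in> carrier G" "S xs \<psi> m \<in> carrier G" "F x (ys (\<psi> m)) \<in> carrier G"
        using lt xs x A' ys by (auto intro!: S_closed)
      ultimately have "S xs \<phi> m = S xs \<psi> m"
        using eq' by auto
      then have "\<forall>p<m. \<phi> p = \<psi> p"
        using lt by (intro inj) auto
      with \<open>\<phi> m = \<psi> m\<close> show ?thesis
        by (auto simp: less_Suc_eq)
    qed
    moreover have "\<forall>p<Suc m. xs' p \<in> A'"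
      using xs x(1) by (auto simp: xs'_def less_Suc_eq)
    ultimately show ?case by blast
  qed simp
  from this[of t] obtain xs where xs: "\<And>p. p < t \<Longrightarrow> xs p \<in> A'"
    and inj: "\<And>\<phi> \<psi>. (\<forall>p<t. \<phi> p < t \<and> \<psi> p < t) \<Longrightarrow> S xs \<phi> t = S xs \<psi> t \<Longrightarrow> (\<forall>p<t. \<phi> p = \<psi> p)"
    by blast
  obtain \<pi> \<pi>' where \<pi>: "\<pi> permutes {..<t}" "\<pi>' permutes {..<t}" "\<pi> \<noteq> \<pi>'" "S xs \<pi> t = S xs \<pi>' t"
    using permutations_collide[OF t, of xs ys] xs A' ys unfolding S_def by blast
  have "\<forall>p<t. \<pi> p < t \<and> \<pi>' p < t"
    using permutes_in_image[OF \<pi>(1)] permutes_in_image[OF \<pi>(2)] by auto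
  then have "\<forall>p<t. \<pi> p = \<pi>' p"
    using \<pi>(4) by (rule inj)
  then have "\<pi> = \<pi>'"
    using \<pi>(1,2) unfolding permutes_def by (metis ext lessThan_iff)
  with \<pi>(3) show False by simp
qed

text \<open>Induction on the number of kernels that are nontrivial on \<open>A'\<close>. The part of
  \<open>A'\<close> in a class of such a kernel makes this kernel trivial, while trivial ones stay
  trivial, so the number drops if finitely many classes cover \<open>A'\<close>. If they do not,
  \<open>few_columns\<close> applies.\<close>

lemma sub_patch_generated:
  "A' \<subseteq> A \<Longrightarrow> \<exists>A0 B0. finite A0 \<and> finite B0 \<and> A0 \<subseteq> A \<and> B0 \<subseteq> B \<and>
    (\<forall>x\<in>A'. \<forall>y\<in>B. F x y \<in> patch_gen A0 B0)"
proof (induction "card {\<theta> \<in> kers. \<not> A' \<times> A' \<subseteq> \<theta>}" arbitrary: A' rule: less_induct)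
  case less
  let ?N = "\<lambda>A'. {\<theta> \<in> kers. \<not> A' \<times> A' \<subseteq> \<theta>}"
  show ?case
  proof (cases "\<exists>K. finite K \<and> K \<subseteq> ?N A' \<times> A' \<and> A' \<subseteq> (\<Union>(\<theta>, x)\<in>K. \<theta> `` {x})")
    case True
    then obtain K where K: "finite K" "K \<subseteq> ?N A' \<times> A'" "A' \<subseteq> (\<Union>(\<theta>, x)\<in>K. \<theta> `` {x})"
      by blast
    let ?C = "\<lambda>(\<theta>, x). A' \<inter> \<theta> `` {x}"
    have "\<exists>A0 B0. finite A0 \<and> finite B0 \<and> A0 \<subseteq> A \<and> B0 \<subseteq> B \<and>
      (\<forall>x\<in>?C \<kappa>. \<forall>y\<in>B. F x y \<in> patch_gen A0 B0)" if "\<kappa> \<in> K" for \<kappa>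
    proof (rule less.hyps)
      obtain \<theta> x where "\<kappa> = (\<theta>, x)"
        by (cases \<kappa>)
      then have \<kappa>: "\<kappa> = (\<theta>, x)" "\<theta> \<in> ?N A'"
        using subsetD[OF K(2) that] by auto
      have "?C \<kappa> \<times> ?C \<kappa> \<subseteq> \<theta>"
        using \<kappa> unfolding kers_def kerD_def by auto
      then have "?N (?C \<kappa>) \<subset> ?N A'"
        using \<kappa> by blast
      then show "card (?N (?C \<kappa>)) < card (?N A')"
        using finite_kers by (intro psubset_card_mono) auto
      show "?C \<kappa> \<subseteq> A"
        using less.prems \<kappa> by auto
    qed
    then obtain A0 B0 where AB: "\<And>\<kappa>. \<kappa> \<in> K \<Longrightarrow> finite (A0 \<kappa>) \<and> finite (B0 \<kappa>) \<and> A0 \<kappa> \<subseteq> A \<and>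
      B0 \<kappa> \<subseteq> B \<and> (\<forall>x\<in>?C \<kappa>. \<forall>y\<in>B. F x y \<in> patch_gen (A0 \<kappa>) (B0 \<kappa>))"
      by metis
    have "F x y \<in> patch_gen (\<Union>\<kappa>\<in>K. A0 \<kappa>) (\<Union>\<kappa>\<in>K. B0 \<kappa>)" if "x \<in> A'" "y \<in> B" for x y
    proof -
      obtain \<theta> x' where \<kappa>: "(\<theta>, x') \<in> K" "x \<in> \<theta> `` {x'}"
        using subsetD[OF K(3) \<open>x \<in> A'\<close>] by auto
      then have "F x y \<in> patch_gen (A0 (\<theta>, x')) (B0 (\<theta>, x'))"
        using AB[OF \<kappa>(1)] that by auto
      also have "\<dots> \<subseteq> patch_gen (\<Union>\<kappa>\<in>K. A0 \<kappa>) (\<Union>\<kappa>\<in>K. B0 \<kappa>)"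
        using \<kappa>(1) by (intro patch_gen_mono) auto
      finally show ?thesis .
    qed
    moreover have "(\<Union>\<kappa>\<in>K. A0 \<kappa>) \<subseteq> A" "(\<Union>\<kappa>\<in>K. B0 \<kappa>) \<subseteq> B"
      "finite (\<Union>\<kappa>\<in>K. A0 \<kappa>)" "finite (\<Union>\<kappa>\<in>K. B0 \<kappa>)"
      using AB K(1) by blast+
    ultimately show ?thesis by blast
  next
    case False
    obtain t where t: "(card L * card L) ^ t < fact t"
      using ex_power_less_fact by blast
    have "\<exists>B0. finite B0 \<and> B0 \<subseteq> B \<and> (\<forall>y\<in>B. \<exists>y0\<in>B0. A' \<times> A' \<subseteq> kerD y y0)"
    proof (rule ccontr)
      assume none: "\<not> ?thesis"
      \<comment> \<open>If no finite \<open>B0\<close> suffices, any finite list of columns can be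
        extended by one whose kernels with all earlier ones are nontrivial on \<open>A'\<close>. The
        list of length \<open>t\<close> contradicts \<open>few_columns\<close>.\<close>
      have "\<exists>ys. (\<forall>a<m. ys a \<in> B) \<and>
          (\<forall>a<m. \<forall>b<m. a \<noteq> b \<longrightarrow> \<not> A' \<times> A' \<subseteq> kerD (ys a) (ys b))" for m :: nat
      proof (induction m)
        case (Suc m)
        then obtain ys where ys: "\<forall>a<m. ys a \<in> B"
          "\<forall>a<m. \<forall>b<m. a \<noteq> b \<longrightarrow> \<not> A' \<times> A' \<subseteq> kerD (ys a) (ys b)" by blast
        obtain y where y: "y \<in> B" "\<forall>y0\<in>ys ` {..<m}. \<not> A' \<times> A' \<subseteq> kerD y y0"
          using none ys(1) by (metis (no_types, lifting) finite_imageI finite_lessThan image_subset_iff lessThan_iff)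
        show ?case
          using ys y kerD_sym[of y] by (intro exI[of _ "ys(m := y)"]) (auto simp: less_Suc_eq)
      qed simp
      from this[of t] obtain ys where "\<And>a. a < t \<Longrightarrow> ys a \<in> B"
        "\<And>a b. a < t \<Longrightarrow> b < t \<Longrightarrow> a \<noteq> b \<Longrightarrow> \<not> A' \<times> A' \<subseteq> kerD (ys a) (ys b)"
        by blast
      then show False
        using few_columns[OF t less.prems] False by blast
    qed
    then obtain B0 where B0: "finite B0" "B0 \<subseteq> B" "\<And>y. y \<in> B \<Longrightarrow> \<exists>y0\<in>B0. A' \<times> A' \<subseteq> kerD y y0"
      by blast
    show ?thesis
    proof (cases "A' = {}")
      case False
      then obtain x0 where x0: "x0 \<in> A'" by blast
      have "F x y \<in> patch_gen {x0} B0" if xy: "x \<in> A'" "y \<in> B" for x y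
      proof -
        obtain y0 where y0: "y0 \<in> B0" "A' \<times> A' \<subseteq> kerD y y0"
          using B0(3) xy(2) by blast
        have c: "x \<in> A" "x0 \<in> A" "y0 \<in> B" "y \<in> B"
          using less.prems xy x0 y0 B0 by auto
        interpret sub: subgroup "patch_gen {x0} B0" G
          using c B0 by (intro patch_gen_subgroup) auto
        have gens: "F x y0 \<in> patch_gen {x0} B0" "F x0 y0 \<in> patch_gen {x0} B0" "F x0 y \<in> patch_gen {x0} B0"
          unfolding patch_gen_def using c y0 by (auto intro!: generate.incl)
        \<comment> \<open>The difference of the two columns is constant on \<open>A'\<close> and can
          be read off in the row \<open>x0\<close>. So \<open>F x y\<close> is the product of
          \<open>F x y0\<close>, \<open>F x0 y\<close> and the inverse of \<open>F x0 y0\<close>,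
          all taken from generating rows and columns.\<close>
        have "D y y0 x = D y y0 x0"
          using y0 x0 xy by (auto simp: kerD_def)
        then have "F x y0 \<otimes> D y y0 x0 = F x y"
          using c by (subst D_eq_iff[symmetric]) auto
        moreover have "F x y0 \<otimes> D y y0 x0 \<in> patch_gen {x0} B0"
          using gens unfolding D_def by simp
        ultimately show ?thesis by simp
      qed
      then show ?thesis
        using B0 x0 less.prems by (intro exI[of _ "{x0}"] exI[of _ B0]) auto
    qed (auto intro!: exI[of _ "{}"])
  qed
qed

end

section \<open>Generation of definable groups\<close>

lemma sel_eq_map_nth:
  assumes "length xs = length w"
  shows "sel p w xs = map ((!) xs) (filter (\<lambda>k. p (w ! k)) [0..<length w])"
proof -
  have "zip w xs = map (\<lambda>k. (w ! k, xs ! k)) [0..<length w]"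
    using assms by (intro nth_equalityI) auto
  then show ?thesis
    by (simp add: sel_def filter_map comp_def)
qed

lemma filter_eq_map_nth: "filter p w = map ((!) w) (filter (\<lambda>k. p (w ! k)) [0..<length w])"
  using filter_map[of p "(!) w" "[0..<length w]"] by (simp add: map_nth comp_def)

lemma (in fo_struct) definable_sel:
  assumes "definable M (filter p w) E" "set w \<subseteq> sorts M"
  shows "definable M w {g \<in> tuples M w. sel p w g \<in> E}"
proof -
  have "{g \<in> tuples M w. sel p w g \<in> E} =
      {g \<in> tuples M w. map ((!) g) (filter (\<lambda>k. p (w ! k)) [0..<length w]) \<in> E}"
    by (auto simp: sel_eq_map_nth length_tuples)
  then show ?thesis
    using definable_reindex[OF assms(1) filter_eq_map_nth _ assms(2)] by auto
qed

section \<open>Definable abelian groups in the disjoint union\<close>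

locale du_group = union_struct + comm_group G for G (structure) +
  fixes w :: "nat list"
  assumes definable_G: "definable_group DU w G"
begin

abbreviation u :: "nat \<Rightarrow> 'a list \<Rightarrow> 'a list" where "u i \<equiv> sel (\<lambda>s. s = i) w"

abbreviation v :: "nat \<Rightarrow> 'a list \<Rightarrow> 'a list" where "v i \<equiv> sel (\<lambda>s. \<not> s = i) w"

definition Gr :: "'a list set" where
  "Gr = {x @ y @ (x \<otimes> y) | x y. x \<in> carrier G \<and> y \<in> carrier G}"

lemma definable_carrier: "definable DU w (carrier G)"
  and definable_Gr: "definable DU (w @ w @ w) Gr"
  using definable_G by (auto simp: definable_group_def Gr_def)

lemma carrier_tuples: "g \<in> carrier G \<Longrightarrow> g \<in> tuples DU w"
  using definable_in_tuples[OF definable_carrier] by auto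

lemma set_w: "set w \<subseteq> {1..n}"
  using definable_sorts[OF definable_carrier] by simp

lemma Gr_iff:
  assumes "g \<in> tuples DU w" "h \<in> tuples DU w"
  shows "g @ h @ k \<in> Gr \<longleftrightarrow> g \<in> carrier G \<and> h \<in> carrier G \<and> k = g \<otimes> h"
proof
  assume "g @ h @ k \<in> Gr"
  then obtain x y where xy: "g @ h @ k = x @ y @ (x \<otimes> y)" "x \<in> carrier G" "y \<in> carrier G"
    unfolding Gr_def by blast
  then have "g = x" "h @ k = y @ (x \<otimes> y)"
    using tuples_append_eqD[OF xy(1) assms(1) carrier_tuples] by auto
  moreover have "h = y" "k = x \<otimes> y"
    using tuples_append_eqD[OF calculation(2) assms(2) carrier_tuples] xy by auto
  ultimately show "g \<in> carrier G \<and> h \<in> carrier G \<and> k = g \<otimes> h"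
    using xy by auto
qed (auto simp: Gr_def)

text \<open>Each box in the graph of the multiplication is split at sort \<open>i\<close>: the
  factor of \<open>i\<close> becomes the first side of a rectangle, the factors of all other sorts
  together become the second.\<close>

lemma rect:
  assumes i: "i \<in> {1..n}"
  shows "\<exists>L. rect_group G (u i) (v i) L"
proof -
  obtain \<B> where \<B>: "finite \<B>" "Gr = (\<Union>C\<in>\<B>. box (w @ w @ w) C)"
    using definable_box_union[OF definable_Gr] unfolding box_union_def by auto
  let ?wu = "filter (\<lambda>s. s = i) w" and ?wv = "filter (\<lambda>s. \<not> s = i) w"
  define P where "P C = {(a, b, c). a \<in> tuples DU ?wu \<and> b \<in> tuples DU ?wu \<and> c \<in> tuples DU ?wu \<and>
    a @ b @ c \<in> C i}" for C :: "nat \<Rightarrow> 'a list set"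
  define Q where "Q C = {(a, b, c). a \<in> tuples DU ?wv \<and> b \<in> tuples DU ?wv \<and> c \<in> tuples DU ?wv \<and>
    (\<forall>j\<in>{1..n} - {i}. sel (\<lambda>s. s = j) ?wv a @ sel (\<lambda>s. s = j) ?wv b @ sel (\<lambda>s. s = j) ?wv c \<in> C j)}"
    for C :: "nat \<Rightarrow> 'a list set"
  have key: "g @ h @ k \<in> box (w @ w @ w) C \<longleftrightarrow>
      (u i g, u i h, u i k) \<in> P C \<and> (v i g, v i h, v i k) \<in> Q C"
    if ghk: "g \<in> tuples DU w" "h \<in> tuples DU w" "k \<in> tuples DU w" for g h k C
  proof -
    have "sel (\<lambda>s. s = j) (w @ w @ w) (g @ h @ k) = u j g @ u j h @ u j k" for j
      using ghk by (simp add: sel_append length_tuples)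
    moreover have "sel (\<lambda>s. s = j) ?wv (v i x) = u j x" if "x \<in> tuples DU w" "j \<noteq> i" for x j
      using that by (intro sel_sel) (auto simp: length_tuples)
    ultimately show ?thesis
      using ghk i by (auto simp: box_def P_def Q_def tuples_appendI sel_in_tuples)
  qed
  have "rect_group G (u i) (v i) ((\<lambda>C. (P C, Q C)) ` \<B>)"
  proof unfold_locales
    show "g = h" if "g \<in> carrier G" "h \<in> carrier G" "u i g = u i h" "v i g = v i h" for g h
      using that carrier_tuples length_tuples sel_inject[of g w h "\<lambda>s. s = i"] by metis
    show "finite ((\<lambda>C. (P C, Q C)) ` \<B>)"
      using \<B>(1) by simp
    show "{((u i g, u i h, u i (g \<otimes> h)), (v i g, v i h, v i (g \<otimes> h))) | g h.
        g \<in> carrier G \<and> h \<in> carrier G} = (\<Union>(P, Q)\<in>(\<lambda>C. (P C, Q C)) ` \<B>. P \<times> Q)" (is "?T = ?R")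
    proof (intro Set.equalityI subsetI)
      fix z assume "z \<in> ?T"
      then obtain g h where z: "z = ((u i g, u i h, u i (g \<otimes> h)), (v i g, v i h, v i (g \<otimes> h)))"
        and gh: "g \<in> carrier G" "h \<in> carrier G"
        by blast
      then have "g @ h @ (g \<otimes> h) \<in> Gr"
        unfolding Gr_def by blast
      then obtain C where "C \<in> \<B>" "g @ h @ (g \<otimes> h) \<in> box (w @ w @ w) C"
        unfolding \<B>(2) by blast
      then show "z \<in> ?R"
        using key[of g h "g \<otimes> h" C] gh by (auto simp: z carrier_tuples)
    next
      fix z assume "z \<in> ?R"
      then obtain C a b c a' b' c' where z: "z = ((a, b, c), (a', b', c'))"
        and C: "C \<in> \<B>" "(a, b, c) \<in> P C" "(a', b', c') \<in> Q C"
        by auto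
      let ?m = "merge (\<lambda>s. s = i) w"
      have t: "a \<in> tuples DU ?wu" "b \<in> tuples DU ?wu" "c \<in> tuples DU ?wu"
        "a' \<in> tuples DU ?wv" "b' \<in> tuples DU ?wv" "c' \<in> tuples DU ?wv"
        using C by (auto simp: P_def Q_def)
      note m = merge[OF t(1,4)] merge[OF t(2,5)] merge[OF t(3,6)]
      \<comment> \<open>The two sides are chosen independently; merging them gives three tuples in
        the box. Thus every point of the rectangle is realised in the group.\<close>
      have "?m a a' @ ?m b b' @ ?m c c' \<in> box (w @ w @ w) C"
        using key[OF m(1,4,7), of C] C m by simp
      then have "?m a a' @ ?m b b' @ ?m c c' \<in> Gr"
        unfolding \<B>(2) using C(1) by blast
      then have "?m a a' \<in> carrier G" "?m b b' \<in> carrier G" "?m c c' = ?m a a' \<otimes> ?m b b'"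
        using Gr_iff[OF m(1,4)] by auto
      then show "z \<in> ?T"
        unfolding z using m by (intro CollectI exI[of _ "?m a a'"] exI[of _ "?m b b'"]) auto
    qed
  qed
  then show ?thesis by blast
qed

text \<open>For finite \<open>B i\<close> the \<open>i\<close>-th set of generators is one-sorted up
  to finite data: outside sort \<open>i\<close> its elements have finitely many possible
  entries.\<close>

definition gen_by :: "(nat \<Rightarrow> 'a list set) \<Rightarrow> 'a list set" where
  "gen_by B = generate G (\<Union>i\<in>{1..n}. {g \<in> carrier G. v i g \<in> B i})"

lemma gen_by_mono: "(\<And>i. i \<in> {1..n} \<Longrightarrow> B i \<subseteq> B' i) \<Longrightarrow> gen_by B \<subseteq> gen_by B'"
  unfolding gen_by_def by (intro mono_generate UN_mono) auto

lemma gen_by_subgroup: "subgroup (gen_by B) G"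
  unfolding gen_by_def by (intro generate_is_subgroup) auto

lemma gen_by_incl: "g \<in> carrier G \<Longrightarrow> i \<in> {1..n} \<Longrightarrow> v i g \<in> B i \<Longrightarrow> g \<in> gen_by B"
  unfolding gen_by_def by (rule generate.incl) blast

lemma finite_box:
  assumes "\<And>i. i \<in> {1..n} \<Longrightarrow> finite (C i)"
  shows "finite (box w C)"
proof (rule inj_on_finite)
  show "finite (\<Pi>\<^sub>E i\<in>{1..n}. C i)"
    using assms by (intro finite_PiE) auto
  show "(\<lambda>g. \<lambda>i\<in>{1..n}. u i g) ` box w C \<subseteq> (\<Pi>\<^sub>E i\<in>{1..n}. C i)"
    by (auto simp: box_def)
  show "inj_on (\<lambda>g. \<lambda>i\<in>{1..n}. u i g) (box w C)"
  proof (rule inj_onI)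
    fix g h assume gh: "g \<in> box w C" "h \<in> box w C"
      and eq: "(\<lambda>i\<in>{1..n}. u i g) = (\<lambda>i\<in>{1..n}. u i h)"
    have len: "length g = length w" "length h = length w"
      using gh by (auto simp: box_def length_tuples)
    have u_eq: "u i g = u i h" if "i \<in> {1..n}" for i
      using fun_cong[OF eq, of i] that by simp
    have "sel P w g = sel P w h" for P
      by (rule sel_eqI[OF len], rule u_eq) (use set_w in blast)
    then show "g = h"
      by (intro sel_inject[OF len, of "\<lambda>_. True"])
  qed
qed

text \<open>Induction on the number of infinite factors. At a sort \<open>i\<close> with infinite
  factor the box is a patch, generated by finitely many full columns and finitely many full rows.
  The columns have finitely many values of \<open>v i\<close> and are admissible generators for
  \<open>i\<close>. The rows form the box with the finite set \<open>A0\<close> as factor of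
  \<open>i\<close>, which has one infinite factor less.\<close>

lemma box_generated:
  "box w C \<subseteq> carrier G \<Longrightarrow> \<exists>B. (\<forall>i\<in>{1..n}. finite (B i)) \<and> box w C \<subseteq> gen_by B"
proof (induction "card {i \<in> {1..n}. infinite (C i)}" arbitrary: C rule: less_induct)
  case less
  show ?case
  proof (cases "\<exists>i\<in>{1..n}. infinite (C i)")
    case False
    then have "finite (box w C)"
      by (intro finite_box) auto
    moreover have "box w C \<subseteq> gen_by (\<lambda>i. v i ` box w C)"
    proof
      fix g assume g: "g \<in> box w C"
      \<comment> \<open>The box is finite, so a single sort can account for all of it; sort 1 exists
        by \<open>n_pos\<close>.\<close>
      show "g \<in> gen_by (\<lambda>i. v i ` box w C)"
        by (rule gen_by_incl[of _ 1]) (use g less.prems n_pos in auto)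
    qed
    ultimately show ?thesis
      by (intro exI[of _ "\<lambda>i. v i ` box w C"] conjI ballI finite_imageI)
  next
    case True
    then obtain i where i: "i \<in> {1..n}" "infinite (C i)" by blast
    obtain L where L: "rect_group G (u i) (v i) L"
      using rect[OF i(1)] by blast
    let ?wu = "filter (\<lambda>s. s = i) w" and ?wv = "filter (\<lambda>s. \<not> s = i) w"
    define A where "A = {a \<in> tuples DU ?wu. a \<in> C i}"
    define B where "B = {b \<in> tuples DU ?wv. \<forall>j\<in>{1..n} - {i}. sel (\<lambda>s. s = j) ?wv b \<in> C j}"
    let ?F = "merge (\<lambda>s. s = i) w"
    have v_sel: "sel (\<lambda>s. s = j) ?wv (v i x) = u j x" if "x \<in> tuples DU w" "j \<noteq> i" for x j
      using that by (intro sel_sel) (auto simp: length_tuples)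
    have F: "?F x y \<in> tuples DU w" "u i (?F x y) = x" "v i (?F x y) = y" if "x \<in> A" "y \<in> B" for x y
      using that merge[of x DU "\<lambda>s. s = i" w y] by (auto simp: A_def B_def)
    have F_box: "?F x y \<in> box w (C(i := X))" if "x \<in> A" "y \<in> B" "x \<in> X" for x y X
      using that F[OF that(1,2)] v_sel[OF F(1)[OF that(1,2)]]
      by (auto simp: box_def B_def)
    have "?F x y \<in> box w C" if "x \<in> A" "y \<in> B" for x y
      using F_box[OF that, of "C i"] that(1) by (simp add: A_def)
    then interpret rect_patch G "u i" "v i" L A B ?F
      using L less.prems F unfolding rect_patch_def rect_patch_axioms_def by blast
    obtain A0 B0 where AB: "finite A0" "finite B0" "A0 \<subseteq> A" "B0 \<subseteq> B"
      "\<forall>x\<in>A. \<forall>y\<in>B. ?F x y \<in> patch_gen A0 B0"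
      using sub_patch_generated[OF order_refl] by (elim exE conjE)
    have "box w (C(i := A0)) \<subseteq> box w C"
      using AB(3) by (auto simp: box_def A_def split: if_splits)
    moreover have "{j \<in> {1..n}. infinite ((C(i := A0)) j)} \<subset> {j \<in> {1..n}. infinite (C j)}"
      using i AB(1) by auto
    then have "card {j \<in> {1..n}. infinite ((C(i := A0)) j)} < card {j \<in> {1..n}. infinite (C j)}"
      by (intro psubset_card_mono) auto
    ultimately obtain B1 where B1: "\<forall>j\<in>{1..n}. finite (B1 j)" "box w (C(i := A0)) \<subseteq> gen_by B1"
      using less.hyps[of "C(i := A0)"] less.prems by blast
    define B2 where "B2 = B1(i := B1 i \<union> B0)"
    have "gen_by B1 \<subseteq> gen_by B2"
      by (intro gen_by_mono) (auto simp: B2_def)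
    have "patch_gen A0 B0 \<subseteq> gen_by B2"
      unfolding patch_gen_def
    proof (intro generate_subgroup_incl gen_by_subgroup Un_least subsetI)
      fix g assume "g \<in> {?F x y | x y. x \<in> A \<and> y \<in> B0}"
      then show "g \<in> gen_by B2"
        using AB(4) i(1) F by (auto intro!: gen_by_incl[of _ i] simp: B2_def subset_iff)
    next
      fix g assume "g \<in> {?F x y | x y. x \<in> A0 \<and> y \<in> B}"
      then have "g \<in> box w (C(i := A0))"
        using AB(3) F_box by blast
      then show "g \<in> gen_by B2"
        using B1(2) \<open>gen_by B1 \<subseteq> gen_by B2\<close> by blast
    qed
    moreover have "g \<in> patch_gen A0 B0" if g: "g \<in> box w C" for g
    proof -
      have t: "g \<in> tuples DU w"
        using g by (simp add: box_def)
      have sel_C: "u j g \<in> C j" if "j \<in> {1..n}" for j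
        using g that by (simp add: box_def)
      have uA: "u i g \<in> A"
        using sel_C[OF i(1)] sel_in_tuples[OF t] by (simp add: A_def)
      have vB: "v i g \<in> B"
        unfolding B_def
      proof (intro CollectI conjI ballI)
        fix j assume "j \<in> {1..n} - {i}"
        then show "sel (\<lambda>s. s = j) ?wv (v i g) \<in> C j"
          using v_sel[OF t, of j] sel_C[of j] by simp
      qed (rule sel_in_tuples[OF t])
      have "?F (u i g) (v i g) = g"
        by (rule uv_inject) (use uA vB g less.prems F in auto)
      then show ?thesis
        using AB(5) uA vB by metis
    qed
    moreover have "\<forall>j\<in>{1..n}. finite (B2 j)"
      using B1(1) AB(2) by (simp add: B2_def)
    ultimately show ?thesis by blast
  qed
qed

theorem carrier_generated: "\<exists>B. (\<forall>i\<in>{1..n}. finite (B i)) \<and> carrier G = gen_by B"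
proof -
  obtain \<B> where \<B>: "finite \<B>" "carrier G = (\<Union>C\<in>\<B>. box w C)"
    using definable_box_union[OF definable_carrier] unfolding box_union_def by auto
  then have "\<forall>C\<in>\<B>. \<exists>B. (\<forall>i\<in>{1..n}. finite (B i)) \<and> box w C \<subseteq> gen_by B"
    using box_generated by blast
  then obtain B where B: "\<And>C. C \<in> \<B> \<Longrightarrow> (\<forall>i\<in>{1..n}. finite (B C i)) \<and> box w C \<subseteq> gen_by (B C)"
    by metis
  have "box w C \<subseteq> gen_by (\<lambda>i. \<Union>C\<in>\<B>. B C i)" if "C \<in> \<B>" for C
    using B[OF that] gen_by_mono[of "B C" "\<lambda>i. \<Union>C\<in>\<B>. B C i"] that by blast
  then have "carrier G \<subseteq> gen_by (\<lambda>i. \<Union>C\<in>\<B>. B C i)"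
    unfolding \<B>(2) by blast
  then have "carrier G = gen_by (\<lambda>i. \<Union>C\<in>\<B>. B C i)"
    using subgroup.subset[OF gen_by_subgroup] by blast
  moreover have "\<forall>i\<in>{1..n}. finite (\<Union>C\<in>\<B>. B C i)"
    using B \<B>(1) by simp
  ultimately show ?thesis
    by (intro exI[of _ "\<lambda>i. \<Union>C\<in>\<B>. B C i"] conjI)
qed

section \<open>Definability of products and inverses of subsets\<close>

lemma set_mult_eq: "S <#> T = {g \<otimes> h | g h. g \<in> S \<and> h \<in> T}"
  by (auto simp: set_mult_def)

lemma definable_mult:
  assumes "definable DU w S" "definable DU w T" "S \<subseteq> carrier G" "T \<subseteq> carrier G"
  shows "definable DU w (S <#> T)"
proof -
  let ?R = "{x @ y | x y. x \<in> S \<and> y \<in> tuples DU (w @ w)} \<inter> Gr"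
  let ?R' = "{y. \<exists>x\<in>tuples DU w. x @ y \<in> ?R} \<inter> {x @ y | x y. x \<in> T \<and> y \<in> tuples DU w}"
  have "definable DU w {k. \<exists>h\<in>tuples DU w. h @ k \<in> ?R'}"
    using assms set_w definable_Gr
    by (intro DU.definable_proj DU.definable_Int DU.definable_weaken) auto
  moreover have "(\<exists>h\<in>tuples DU w. h @ k \<in> ?R') \<longleftrightarrow> k \<in> S <#> T" for k
  proof
    assume "\<exists>h\<in>tuples DU w. h @ k \<in> ?R'"
    then obtain h g g' y h' y' where *: "h \<in> tuples DU w" "g \<in> tuples DU w" "g @ h @ k = g' @ y"
      "g' \<in> S" "g @ h @ k \<in> Gr" "h @ k = h' @ y'" "h' \<in> T"
      by blast
    have "g = g'" "h = h'"
      using tuples_append_eqD(1)[OF *(3,2)] tuples_append_eqD(1)[OF *(6,1)] *(4,7) assms carrier_tuples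
      by blast+
    then show "k \<in> S <#> T"
      using * Gr_iff[OF *(2,1)] by (auto simp: set_mult_eq)
  next
    assume "k \<in> S <#> T"
    then obtain g h where gh: "g \<in> S" "h \<in> T" "k = g \<otimes> h"
      by (auto simp: set_mult_eq)
    then have "g \<in> carrier G" "h \<in> carrier G"
      using assms by auto
    then have t: "g \<in> tuples DU w" "h \<in> tuples DU w" "k \<in> tuples DU w" "g @ h @ k \<in> Gr"
      using gh(3) carrier_tuples Gr_iff by auto
    then have "h @ k \<in> ?R'"
      using gh tuples_appendI[OF t(2,3)] by blast
    with t show "\<exists>h\<in>tuples DU w. h @ k \<in> ?R'"
      by blast
  qed
  ultimately show ?thesis by simp
qed

text \<open>The inverses are the middle entries of the graph triples that start in \<open>S\<close>
  and end in \<open>\<one>\<close>. As only leading blocks can be projected away, the last two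
  blocks are swapped once the first is gone.\<close>

lemma definable_inv:
  assumes "definable DU w S" "S \<subseteq> carrier G"
  shows "definable DU w (m_inv G ` S)"
proof -
  let ?R = "{y. \<exists>x\<in>tuples DU w. x @ y \<in> {x @ y | x y. x \<in> S \<and> y \<in> tuples DU (w @ w)} \<inter> Gr}"
  let ?R' = "{y @ x | x y. x @ y \<in> ?R \<and> x \<in> tuples DU w \<and> y \<in> tuples DU w} \<inter>
    {x @ y | x y. x \<in> {\<one>} \<and> y \<in> tuples DU w}"
  have "definable DU w {h. \<exists>k\<in>tuples DU w. k @ h \<in> ?R'}"
    using assms set_w definable_Gr carrier_tuples
    by (intro DU.definable_proj DU.definable_Int DU.definable_weaken DU.definable_swap
        DU.definable_single) auto
  moreover have "(\<exists>k\<in>tuples DU w. k @ h \<in> ?R') \<longleftrightarrow> h \<in> m_inv G ` S" for h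
  proof
    assume "\<exists>k\<in>tuples DU w. k @ h \<in> ?R'"
    then obtain k x y y' where *: "k \<in> tuples DU w" "k @ h = y @ x" "x @ y \<in> ?R" "x \<in> tuples DU w"
      "y \<in> tuples DU w" "k @ h = \<one> @ y'"
      by blast
    have xy: "k = y" "h = x" "y = \<one>"
      using tuples_append_eqD[OF *(2,1,5)] tuples_append_eqD(1)[OF *(6,1)] carrier_tuples[of \<one>] by auto
    obtain g g' z where g: "g \<in> tuples DU w" "g @ x @ y = g' @ z" "g' \<in> S" "g @ x @ y \<in> Gr"
      using *(3) by blast
    have "g = g'"
      using tuples_append_eqD(1)[OF g(2,1)] g(3) assms(2) carrier_tuples by blast
    have "g \<in> carrier G" "h \<in> carrier G" "\<one> = g \<otimes> h"
      using Gr_iff[OF g(1) *(4)] g(4) xy by auto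
    then have "h = inv g"
      using inv_equality[of h g] m_comm[of g h] by simp
    then show "h \<in> m_inv G ` S"
      using g(3) \<open>g = g'\<close> by blast
  next
    assume "h \<in> m_inv G ` S"
    then obtain g where g: "g \<in> S" "h = inv g"
      by auto
    then have "g \<in> carrier G" "h \<in> carrier G" "g \<otimes> h = \<one>"
      using assms by auto
    then have t: "g \<in> tuples DU w" "h \<in> tuples DU w" "\<one> \<in> tuples DU w" "g @ h @ \<one> \<in> Gr"
      using carrier_tuples Gr_iff by auto
    then have "h @ \<one> \<in> ?R"
      using g tuples_appendI[OF t(2,3)] by blast
    with t show "\<exists>k\<in>tuples DU w. k @ h \<in> ?R'"
      by blast
  qed
  ultimately show ?thesis by simp
qed

end

section \<open>Coding the one-sorted subgroups\<close>

lemma join_0 [simp]: "join 0 x = []"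
  by (simp add: join_def)

lemma join_Suc [simp]: "join (Suc m) x = join m x @ x (Suc m)"
  by (simp add: join_def)

lemma join_cong: "(\<And>i. i \<in> {1..m} \<Longrightarrow> x i = y i) \<Longrightarrow> join m x = join m y"
  unfolding join_def by (intro arg_cong[where f = concat] map_cong) auto

lemma join_inject:
  "(\<And>i. i \<in> {1..m} \<Longrightarrow> length (x i) = length (y i)) \<Longrightarrow> join m x = join m y \<Longrightarrow>
    i \<in> {1..m} \<Longrightarrow> x i = y i"
proof (induction m)
  case (Suc m)
  then have "length (x (Suc m)) = length (y (Suc m))" by simp
  with Suc.prems(2) have "join m x = join m y" "x (Suc m) = y (Suc m)"
    by auto
  with Suc show ?case
    by (cases "i = Suc m") auto
qed simp

lemma join_in_tuples:
  "(\<And>i. i \<in> {1..m} \<Longrightarrow> x i \<in> tuples M (r i)) \<Longrightarrow> join m x \<in> tuples M (join m r)"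
  by (induction m) (auto intro!: tuples_appendI)

lemma (in group) image_group_iso:
  assumes "inj_on f (carrier G)"
  shows "group (image_group f G)" "f \<in> iso G (image_group f G)"
proof -
  show iso: "f \<in> iso G (image_group f G)"
    using assms by (auto simp: iso_def hom_def image_group_def bij_betw_def)
  show "group (image_group f G)"
    using iso_imp_img_group[OF iso] by (simp add: image_group_def)
qed

context fo_struct
begin

text \<open>Relations are given by a parametrising family here, so that chains of block operations
  need not take concatenations apart again.\<close>

lemma definable_swap_indexed:
  assumes "definable M (v @ w) {f a @ g a | a. a \<in> X}"
    and "\<And>a. a \<in> X \<Longrightarrow> f a \<in> tuples M v \<and> g a \<in> tuples M w"
  shows "definable M (w @ v) {g a @ f a | a. a \<in> X}"
proof -
  have "{y @ x | x y. x @ y \<in> {f a @ g a | a. a \<in> X} \<and> x \<in> tuples M v \<and> y \<in> tuples M w} =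
      {g a @ f a | a. a \<in> X}" (is "?L = ?R")
  proof (intro Set.equalityI subsetI)
    fix z assume "z \<in> ?L"
    then obtain x y a where *: "z = y @ x" "x @ y = f a @ g a" "a \<in> X" "x \<in> tuples M v"
      by blast
    then have "x = f a" "y = g a"
      using tuples_append_eqD[OF *(2,4)] assms(2) by auto
    with * show "z \<in> ?R" by blast
  qed (use assms(2) in blast)
  with definable_swap[OF assms(1)] show ?thesis by simp
qed

lemma definable_comp_indexed:
  assumes "definable M (w @ r) {f a @ z a | a. a \<in> X}" "definable M (w @ v) {g b @ y b | b. b \<in> Y}"
    and "\<And>a. a \<in> X \<Longrightarrow> f a \<in> tuples M w \<and> z a \<in> tuples M r"
    and "\<And>b. b \<in> Y \<Longrightarrow> g b \<in> tuples M w \<and> y b \<in> tuples M v"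
  shows "definable M (r @ v) {z a @ y b | a b. a \<in> X \<and> b \<in> Y \<and> f a = g b}"
proof -
  have "{z' @ y' | z' y'. z' \<in> tuples M r \<and> y' \<in> tuples M v \<and>
      (\<exists>h\<in>tuples M w. h @ z' \<in> {f a @ z a | a. a \<in> X} \<and> h @ y' \<in> {g b @ y b | b. b \<in> Y})} =
      {z a @ y b | a b. a \<in> X \<and> b \<in> Y \<and> f a = g b}" (is "?L = ?R")
  proof (intro Set.equalityI subsetI)
    fix x assume "x \<in> ?L"
    then obtain z' y' h a b where *: "x = z' @ y'" "h \<in> tuples M w"
      "h @ z' = f a @ z a" "a \<in> X" "h @ y' = g b @ y b" "b \<in> Y"
      by blast
    have "h = f a" "z' = z a" "h = g b" "y' = y b"
      using tuples_append_eqD[OF *(3,2)] tuples_append_eqD[OF *(5,2)] assms(3,4) *(4,6) by auto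
    with * show "x \<in> ?R" by blast
  next
    fix x assume "x \<in> ?R"
    then obtain a b where ab: "x = z a @ y b" "a \<in> X" "b \<in> Y" "f a = g b"
      by blast
    have "f a @ z a \<in> {f a @ z a | a. a \<in> X}"
      using ab(2) by blast
    moreover have "f a @ y b \<in> {g b @ y b | b. b \<in> Y}"
      unfolding ab(4) using ab(3) by blast
    ultimately show "x \<in> ?L"
      using ab(1) assms(3)[OF ab(2)] assms(4)[OF ab(3)] by blast
  qed
  with definable_comp[OF assms(1,2)] show ?thesis by simp
qed

lemma definable_graph_restrict:
  assumes "definable M (v @ w) {x @ f x | x. x \<in> P}" "definable M v D" "set w \<subseteq> sorts M"
    and "\<And>x. x \<in> P \<Longrightarrow> x \<in> tuples M v \<and> f x \<in> tuples M w"
  shows "definable M (v @ w) {x @ f x | x. x \<in> D \<inter> P}"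
proof -
  have "definable M (v @ w) ({x @ f x | x. x \<in> P} \<inter> {x @ y | x y. x \<in> D \<and> y \<in> tuples M w})"
    using assms by (intro definable_Int definable_weaken)
  also have "{x @ f x | x. x \<in> P} \<inter> {x @ y | x y. x \<in> D \<and> y \<in> tuples M w} =
      {x @ f x | x. x \<in> D \<inter> P}" (is "?L = ?R")
  proof (intro Set.equalityI subsetI)
    fix z assume "z \<in> ?L"
    then obtain x x' y where *: "z = x @ f x" "x \<in> P" "z = x' @ y" "x' \<in> D"
      by blast
    then have "x' = x"
      using tuples_append_eqD(1)[of x "f x" x' y M v] assms(4) definable_in_tuples[OF assms(2)] by auto
    with * show "z \<in> ?R" by blast
  qed (use assms(4) in blast)
  finally show ?thesis .
qed

text \<open>A definable subset is covered by finitely many pieces. Its graph is the finite union of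
  the restricted graphs on these pieces, and each image stays in one piece of the target.\<close>

lemma ld_functionI:
  assumes S: "\<And>P. P \<in> pieces S \<Longrightarrow> definable M (arity S) P"
    and T: "\<And>Q. Q \<in> pieces T \<Longrightarrow> definable M (arity T) Q"
    and sorts: "set (arity S) \<subseteq> sorts M" "set (arity T) \<subseteq> sorts M"
    and graph: "\<And>P. P \<in> pieces S \<Longrightarrow> definable M (arity S @ arity T) {x @ f x | x. x \<in> P}"
    and image: "\<And>P. P \<in> pieces S \<Longrightarrow> \<exists>Q\<in>pieces T. f ` P \<subseteq> Q"
  shows "ld_function M S T f"
  unfolding ld_function_def
proof (intro conjI allI impI)
  show "f \<in> points S \<rightarrow> points T"
    unfolding points_def using image by blast
  fix D assume D: "definable_subset M S D"
  then obtain F where F: "finite F" "F \<subseteq> pieces S" "D \<subseteq> \<Union>F"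
    unfolding definable_subset_def by blast
  from image obtain Q where Q: "\<And>P. P \<in> pieces S \<Longrightarrow> Q P \<in> pieces T \<and> f ` P \<subseteq> Q P"
    by metis
  have "definable M (arity S @ arity T) (\<Union>P\<in>F. {x @ f x | x. x \<in> D \<inter> P})"
  proof (intro definable_UN definable_graph_restrict F(1))
    fix P x assume x: "P \<in> F" "x \<in> P"
    then have P: "P \<in> pieces S"
      using F(2) by blast
    have "x \<in> tuples M (arity S)"
      using definable_in_tuples[OF S[OF P]] x(2) by blast
    moreover have "f x \<in> Q P" "Q P \<in> pieces T"
      using Q[OF P] x(2) by auto
    then have "f x \<in> tuples M (arity T)"
      using definable_in_tuples[OF T] by blast
    ultimately show "x \<in> tuples M (arity S) \<and> f x \<in> tuples M (arity T)" ..
  qed (use F D graph sorts in \<open>auto simp: definable_subset_def\<close>)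
  also have "(\<Union>P\<in>F. {x @ f x | x. x \<in> D \<inter> P}) = {x @ f x | x. x \<in> D}"
    using F(3) by blast
  finally have "definable M (arity (ld_prod S T)) {x @ f x | x. x \<in> D}"
    by (simp add: ld_prod_def)
  moreover have "{x @ f x | x. x \<in> D} \<subseteq> (\<Union>P\<in>F. {x @ y | x y. x \<in> P \<and> y \<in> Q P})"
  proof
    fix z assume "z \<in> {x @ f x | x. x \<in> D}"
    then obtain x P where "z = x @ f x" "x \<in> P" "P \<in> F"
      using F(3) by blast
    moreover have "f x \<in> Q P"
      using Q[of P] F(2) calculation by auto
    ultimately show "z \<in> (\<Union>P\<in>F. {x @ y | x y. x \<in> P \<and> y \<in> Q P})"
      by blast
  qed
  moreover have "(\<lambda>P. {x @ y | x y. x \<in> P \<and> y \<in> Q P}) ` F \<subseteq> pieces (ld_prod S T)"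
    using F(2) Q unfolding ld_prod_def by auto
  ultimately show "definable_subset M (ld_prod S T) {x @ f x | x. x \<in> D}"
    unfolding definable_subset_def using F(1)
    by (intro conjI exI[of _ "(\<lambda>P. {x @ y | x y. x \<in> P \<and> y \<in> Q P}) ` F"]) auto
qed

end

section \<open>The subgroup belonging to one sort and its definable levels\<close>

locale du_group_gen = du_group +
  fixes B :: "nat \<Rightarrow> 'a list set"
  assumes finite_B: "i \<in> {1..n} \<Longrightarrow> finite (B i)"
    and carrier_gen: "carrier G = gen_by B"
begin

definition E :: "nat \<Rightarrow> 'a list set" where
  "E i = {g \<in> carrier G. v i g \<in> B i}"

text \<open>With inverses included, the products of generators form a group; \<open>\<one>\<close>
  makes the levels increase.\<close>

definition sgens :: "nat \<Rightarrow> 'a list set" where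
  "sgens i = insert \<one> (E i \<union> m_inv G ` E i)"

text \<open>A definable exhaustion of the subgroup for \<open>i\<close>. On each level
  \<open>v i\<close> takes finitely many values, on the union possibly infinitely many.\<close>

primrec level :: "nat \<Rightarrow> nat \<Rightarrow> 'a list set" where
  "level i 0 = {\<one>}"
| "level i (Suc m) = sgens i <#> level i m"

definition K :: "nat \<Rightarrow> 'a list set" where
  "K i = generate G (sgens i)"

lemma sgens_carrier: "sgens i \<subseteq> carrier G"
  by (auto simp: sgens_def E_def)

lemma level_carrier: "level i m \<subseteq> carrier G"
  by (induction m) (use sgens_carrier in \<open>auto simp: set_mult_eq subset_iff\<close>)

lemma level_1: "level i (Suc 0) = sgens i"
  using sgens_carrier by (force simp: set_mult_eq)

lemma level_mono: "m \<le> m' \<Longrightarrow> level i m \<subseteq> level i m'"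
proof (rule lift_Suc_mono_le)
  fix m show "level i m \<subseteq> level i (Suc m)"
  proof
    fix g assume "g \<in> level i m"
    then have "g = \<one> \<otimes> g" "\<one> \<in> sgens i"
      using level_carrier[of i m] by (auto simp: sgens_def)
    with \<open>g \<in> level i m\<close> show "g \<in> level i (Suc m)"
      by (auto simp: set_mult_eq)
  qed
qed

lemma level_mult: "g \<in> level i m \<Longrightarrow> h \<in> level i m' \<Longrightarrow> g \<otimes> h \<in> level i (m + m')"
proof (induction m arbitrary: g)
  case 0
  then show ?case using level_carrier[of i m'] by auto
next
  case (Suc m)
  then obtain a b where ab: "a \<in> sgens i" "b \<in> level i m" "g = a \<otimes> b"
    by (auto simp: set_mult_eq)
  have "a \<in> carrier G" "b \<in> carrier G" "h \<in> carrier G"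
    using ab Suc.prems(2) sgens_carrier[of i] level_carrier[of i] by blast+
  then have "g \<otimes> h = a \<otimes> (b \<otimes> h)"
    using ab(3) by (simp add: m_assoc)
  then show ?case
    using Suc.IH[OF ab(2) Suc.prems(2)] ab(1) by (auto simp: set_mult_eq)
qed

lemma sgens_inv: "g \<in> sgens i \<Longrightarrow> inv g \<in> sgens i"
  by (auto simp: sgens_def E_def)

lemma K_subgroup: "subgroup (K i) G"
  unfolding K_def using sgens_carrier by (intro generate_is_subgroup)

lemma K_carrier: "K i \<subseteq> carrier G"
  using K_subgroup by (rule subgroup.subset)

lemma K_eq: "K i = (\<Union>m. level i m)"
proof (intro Set.equalityI subsetI)
  fix g assume "g \<in> K i"
  then have "g \<in> generate G (sgens i)"
    by (simp add: K_def)
  then show "g \<in> (\<Union>m. level i m)"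
  proof (induction rule: generate.induct)
    case one
    show ?case by (intro UN_I[of 0]) auto
  next
    case (incl h)
    then show ?case using level_1[of i] by blast
  next
    case (inv h)
    then show ?case using level_1[of i] sgens_inv[of h i] by blast
  next
    case (eng g h)
    then show ?case using level_mult by blast
  qed
next
  fix g assume "g \<in> (\<Union>m. level i m)"
  then obtain m where "g \<in> level i m" by blast
  then show "g \<in> K i"
  proof (induction m arbitrary: g)
    case 0
    then show ?case by (simp add: K_def generate.one)
  next
    case (Suc m)
    then obtain a b where "a \<in> sgens i" "b \<in> K i" "g = a \<otimes> b"
      by (auto simp: set_mult_eq)
    then show ?case
      unfolding K_def by (auto intro: generate.eng generate.incl)
  qed
qed

lemma E_subset_K: "E i \<subseteq> K i"
  unfolding K_def sgens_def by (auto intro: generate.incl)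

lemma level_subset_K: "level i m \<subseteq> K i"
  unfolding K_eq by blast

lemma level_tuples: "g \<in> level i m \<Longrightarrow> g \<in> tuples DU w"
  using level_carrier carrier_tuples by blast

lemma definable_sgens:
  assumes "i \<in> {1..n}"
  shows "definable DU w (sgens i)"
proof -
  let ?wv = "filter (\<lambda>s. \<not> s = i) w"
  have "definable DU w (carrier G \<inter> {g \<in> tuples DU w. v i g \<in> B i \<inter> tuples DU ?wv})"
    using set_w finite_B[OF assms]
    by (intro DU.definable_Int DU.definable_sel definable_carrier DU.definable_finite) auto
  moreover have "carrier G \<inter> {g \<in> tuples DU w. v i g \<in> B i \<inter> tuples DU ?wv} = E i"
    by (auto simp: E_def carrier_tuples sel_in_tuples)
  ultimately have E: "definable DU w (E i)" by simp
  have "definable DU w ({\<one>} \<union> (E i \<union> m_inv G ` E i))"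
    using E set_w carrier_tuples
    by (intro DU.definable_Un definable_inv DU.definable_single) (auto simp: E_def)
  then show ?thesis by (simp add: sgens_def)
qed

lemma definable_level: "i \<in> {1..n} \<Longrightarrow> definable DU w (level i m)"
proof (induction m)
  case 0
  then show ?case using set_w carrier_tuples by (auto intro!: DU.definable_single)
next
  case (Suc m)
  then show ?case using definable_sgens by (auto intro!: definable_mult[OF _ _ sgens_carrier level_carrier])
qed

text \<open>On \<open>E i\<close> the values of \<open>v i\<close> lie in the finite set
  \<open>B i\<close>. Products and inverses keep them finite, by the finiteness lemmas for the first
  coordinate with the two coordinates exchanged.\<close>

lemma finite_v_level:
  assumes i: "i \<in> {1..n}"
  shows "finite (v i ` level i m)"
proof -
  obtain L where "rect_group G (u i) (v i) L"
    using rect[OF i] by blast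
  then interpret sw: rect_group G "v i" "u i" "(\<lambda>(P, Q). (Q, P)) ` L"
    by (rule rect_group.swap)
  have E: "finite (v i ` E i)"
    by (rule finite_subset[OF _ finite_B[OF i]]) (auto simp: E_def)
  have "finite (v i ` m_inv G ` E i)"
    by (rule sw.finite_u_inv[OF _ E]) (auto simp: E_def)
  with E have "finite (v i ` sgens i)"
    by (simp add: sgens_def image_Un)
  then show ?thesis
    by (induction m) (auto intro!: sw.finite_u_mult[OF sgens_carrier level_carrier])
qed

text \<open>
  An element of \<open>K i\<close> has one of countably many values of \<open>v i\<close>; coding these by elements of the
  infinite universe of \<open>M i\<close> turns \<open>K i\<close> into a set of tuples of \<open>M i\<close>.
\<close>

definition code :: "nat \<Rightarrow> 'a list \<Rightarrow> 'a" where
  "code i = (SOME c. inj_on c (v i ` K i) \<and> range c \<subseteq> univ (M i) ())"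

lemma code:
  assumes i: "i \<in> {1..n}"
  shows "inj_on (code i) (v i ` K i)" "code i b \<in> univ (M i) ()"
proof -
  have "countable (v i ` K i)"
    unfolding K_eq image_UN using finite_v_level[OF i] by (auto intro: countable_finite)
  moreover obtain f :: "nat \<Rightarrow> 'a" where f: "inj f" "range f \<subseteq> univ (M i) ()"
    using infinite_countable_subset[OF infinite_univ[OF i]] by blast
  ultimately have "inj_on (f \<circ> to_nat_on (v i ` K i)) (v i ` K i)"
    using comp_inj_on[OF inj_on_to_nat_on inj_on_subset[OF f(1) subset_UNIV]] by blast
  then have "inj_on (f \<circ> to_nat_on (v i ` K i)) (v i ` K i) \<and>
      range (f \<circ> to_nat_on (v i ` K i)) \<subseteq> univ (M i) ()"
    using f(2) by auto
  then have "\<exists>c. inj_on c (v i ` K i) \<and> range c \<subseteq> univ (M i) ()"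
    by (rule exI[of _ "f \<circ> to_nat_on (v i ` K i)"])
  then have "inj_on (code i) (v i ` K i) \<and> range (code i) \<subseteq> univ (M i) ()"
    unfolding code_def by (rule someI_ex)
  then show "inj_on (code i) (v i ` K i)" "code i b \<in> univ (M i) ()"
    by auto
qed

definition enc :: "nat \<Rightarrow> 'a list \<Rightarrow> 'a list" where
  "enc i g = u i g @ [code i (v i g)]"

definition code_arity :: "nat \<Rightarrow> unit list" where
  "code_arity i = sort_arity w i @ [()]"

text \<open>The arity of the codes as seen in the disjoint union, where the multiplication is known
  to be definable; \<open>definable_trace\<close> carries the results back to
  \<open>code_arity\<close>.\<close>

definition du_arity :: "nat \<Rightarrow> nat list" where
  "du_arity i = map (\<lambda>_. i) (code_arity i)"

lemma du_arity_eq: "du_arity i = filter (\<lambda>s. s = i) w @ [i]"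
proof -
  have "map (\<lambda>_. i) (filter (\<lambda>s. s = i) w) = filter (\<lambda>s. s = i) w"
    by (rule map_idI) auto
  then show ?thesis
    by (simp add: du_arity_def code_arity_def sort_arity_def comp_def)
qed

lemma set_du_arity: "i \<in> {1..n} \<Longrightarrow> set (du_arity i) \<subseteq> {1..n}"
  by (auto simp: du_arity_def)

lemma enc_tuples: "i \<in> {1..n} \<Longrightarrow> g \<in> tuples DU w \<Longrightarrow> enc i g \<in> tuples DU (du_arity i)"
  unfolding enc_def du_arity_eq by (intro tuples_appendI sel_in_tuples) (auto simp: code)

lemma inj_enc:
  assumes i: "i \<in> {1..n}"
  shows "inj_on (enc i) (K i)"
proof (rule inj_onI)
  fix g h assume gh: "g \<in> K i" "h \<in> K i" "enc i g = enc i h"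
  then have "u i g = u i h" "code i (v i g) = code i (v i h)"
    by (simp_all add: enc_def)
  moreover have "v i g = v i h"
    by (rule inj_onD[OF code(1)[OF i] calculation(2)]) (use gh in auto)
  ultimately show "g = h"
    using gh K_carrier carrier_tuples length_tuples sel_inject[of g w h "\<lambda>s. s = i"] by (metis subsetD)
qed

text \<open>\<open>code i\<close> is an arbitrary injection, but a level splits into finitely many
  definable parts on which \<open>v i\<close> is constant. On each of them the code is a fixed
  parameter and the other entries of \<open>enc i g\<close> are variables, as listed in
  \<open>?ts\<close>.\<close>

lemma definable_enc_graph:
  assumes i: "i \<in> {1..n}"
  shows "definable DU (w @ du_arity i) {g @ enc i g | g. g \<in> level i m}"
proof -
  let ?wv = "filter (\<lambda>s. \<not> s = i) w" and ?js = "filter (\<lambda>k. w ! k = i) [0..<length w]"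
  let ?ts = "\<lambda>b. map Var ?js @ [Par (code i b)]"
  have wf: "list_all2 (wf_tm DU w) (?ts b) (du_arity i)" for b
  proof -
    have "list_all2 (wf_tm DU w) (map Var ?js) (map ((!) w) ?js)"
      by (rule wf_map_Var) auto
    then show ?thesis
      unfolding du_arity_eq filter_eq_map_nth[of "\<lambda>s. s = i" w] using code(2)[OF i] i
      by (auto intro!: list_all2_appendI)
  qed
  have "definable DU (w @ du_arity i) (\<Union>b\<in>v i ` level i m.
      {g @ map (val g) (?ts b) | g. g \<in> level i m \<inter> {g \<in> tuples DU w. v i g \<in> {b}}})"
    using set_w set_du_arity[OF i] wf finite_v_level[OF i] definable_level[OF i] level_tuples
    by (intro DU.definable_UN DU.definable_graph DU.definable_Int DU.definable_sel
        DU.definable_single) (auto intro: sel_in_tuples)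
  also have "(\<Union>b\<in>v i ` level i m.
      {g @ map (val g) (?ts b) | g. g \<in> level i m \<inter> {g \<in> tuples DU w. v i g \<in> {b}}}) =
      {g @ enc i g | g. g \<in> level i m}"
  proof -
    have enc: "map (val g) (?ts (v i g)) = enc i g" if "g \<in> level i m" for g
      using sel_eq_map_nth[OF length_tuples[OF level_tuples[OF that]], of "\<lambda>s. s = i"]
      by (simp add: enc_def comp_def)
    show ?thesis (is "?L = ?R")
    proof (intro Set.equalityI subsetI)
      fix z assume "z \<in> ?L"
      then obtain g where "z = g @ map (val g) (?ts (v i g))" "g \<in> level i m"
        by auto
      then show "z \<in> ?R"
        using enc by auto
    next
      fix z assume "z \<in> ?R"
      then obtain g where g: "z = g @ enc i g" "g \<in> level i m"
        by blast
      then have "z \<in> {g' @ map (val g') (?ts (v i g)) | g'.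
          g' \<in> level i m \<inter> {g' \<in> tuples DU w. v i g' \<in> {v i g}}}"
        unfolding enc[OF g(2), symmetric] using level_tuples[OF g(2)] by blast
      then show "z \<in> ?L"
        using g(2) by blast
    qed
  qed
  finally show ?thesis .
qed

lemma definable_enc_image:
  assumes i: "i \<in> {1..n}"
  shows "definable DU (du_arity i) (enc i ` level i m)"
proof -
  have "{y. \<exists>x\<in>tuples DU w. x @ y \<in> {g @ enc i g | g. g \<in> level i m}} = enc i ` level i m"
  proof (intro Set.equalityI subsetI)
    fix y assume "y \<in> {y. \<exists>x\<in>tuples DU w. x @ y \<in> {g @ enc i g | g. g \<in> level i m}}"
    then obtain x g where *: "x \<in> tuples DU w" "x @ y = g @ enc i g" "g \<in> level i m"
      by blast
    then show "y \<in> enc i ` level i m"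
      using tuples_append_eqD(2)[OF *(2,1) level_tuples[OF *(3)]] by blast
  qed (use level_tuples in blast)
  with DU.definable_proj[OF definable_enc_graph[OF i], of m] show ?thesis
    by (rule back_subst)
qed

text \<open>Composition along the graph of \<open>enc i\<close> replaces a leading block by its
  code, provided that the block stays in one level.\<close>

lemma definable_enc_indexed:
  assumes i: "i \<in> {1..n}" and "definable DU (w @ r) {p a @ q a | a. a \<in> X}"
    and "\<And>a. a \<in> X \<Longrightarrow> p a \<in> level i m \<and> q a \<in> tuples DU r"
  shows "definable DU (du_arity i @ r) {enc i (p a) @ q a | a. a \<in> X}"
proof -
  have "definable DU (du_arity i @ r) {enc i g @ q a | g a. g \<in> level i m \<and> a \<in> X \<and> g = p a}"
    using assms level_tuples enc_tuples[OF i]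
    by (intro DU.definable_comp_indexed[OF definable_enc_graph[OF i] assms(2)]) auto
  also have "{enc i g @ q a | g a. g \<in> level i m \<and> a \<in> X \<and> g = p a} = {enc i (p a) @ q a | a. a \<in> X}"
    using assms(3) by blast
  finally show ?thesis .
qed

lemma definable_mult_graph:
  assumes "definable DU w D" "definable DU w D'" "D \<subseteq> carrier G" "D' \<subseteq> carrier G"
  shows "definable DU (w @ w @ w) {g @ h @ (g \<otimes> h) | g h. g \<in> D \<and> h \<in> D'}"
proof -
  have "definable DU (w @ w @ w)
      (Gr \<inter> {x @ y | x y. x \<in> D \<and> y \<in> {x @ y | x y. x \<in> D' \<and> y \<in> tuples DU w}})"
    using assms set_w by (intro DU.definable_Int DU.definable_times DU.definable_weaken definable_Gr) auto
  also have "Gr \<inter> {x @ y | x y. x \<in> D \<and> y \<in> {x @ y | x y. x \<in> D' \<and> y \<in> tuples DU w}} =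
      {g @ h @ (g \<otimes> h) | g h. g \<in> D \<and> h \<in> D'}" (is "?L = ?R")
  proof (intro Set.equalityI subsetI)
    fix z assume "z \<in> ?L"
    then obtain g h k where *: "z = g @ h @ k" "g \<in> D" "h \<in> D'" "g @ h @ k \<in> Gr"
      by blast
    then have "k = g \<otimes> h"
      using assms Gr_iff[of g h k] carrier_tuples by blast
    with * show "z \<in> ?R" by blast
  next
    fix z assume "z \<in> ?R"
    then obtain g h where *: "z = g @ h @ (g \<otimes> h)" "g \<in> D" "h \<in> D'"
      by blast
    moreover have "g \<in> carrier G" "h \<in> carrier G"
      using * assms by auto
    moreover have "g \<otimes> h \<in> tuples DU w"
      using calculation by (intro carrier_tuples) auto
    ultimately show "z \<in> ?L"
      using Gr_def by blast
  qed
  finally show ?thesis .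
qed

text \<open>Starting from the graph of the multiplication, the leading block is encoded and rotated
  to the end. Three rounds encode all blocks and restore their order.\<close>

lemma definable_enc_mult:
  assumes i: "i \<in> {1..n}"
  shows "definable DU (du_arity i @ du_arity i @ du_arity i)
    {enc i g @ enc i h @ enc i (g \<otimes> h) | g h. g \<in> level i m \<and> h \<in> level i m'}"
proof -
  let ?X = "level i m \<times> level i m'" and ?p = "\<lambda>a. fst a \<otimes> snd a"
  have X: "fst a \<in> level i m" "snd a \<in> level i m'" "?p a \<in> level i (m + m')"
    "fst a \<in> tuples DU w" "snd a \<in> tuples DU w" "?p a \<in> tuples DU w" if "a \<in> ?X" for a
    using that level_mult[of "fst a" i m "snd a" m'] level_tuples by auto
  have "definable DU (w @ (w @ w)) {fst a @ (snd a @ ?p a) | a. a \<in> ?X}"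
  proof -
    have "{fst a @ (snd a @ ?p a) | a. a \<in> ?X} = {g @ h @ (g \<otimes> h) | g h. g \<in> level i m \<and> h \<in> level i m'}"
      by force
    then show ?thesis
      using definable_mult_graph[OF definable_level[OF i] definable_level[OF i] level_carrier level_carrier] by simp
  qed
  then have "definable DU (du_arity i @ (w @ w)) {enc i (fst a) @ (snd a @ ?p a) | a. a \<in> ?X}"
    by (rule definable_enc_indexed[OF i, where m = "m"]) (intro conjI tuples_appendI X enc_tuples[OF i]; assumption)
  then have "definable DU ((w @ w) @ du_arity i) {(snd a @ ?p a) @ enc i (fst a) | a. a \<in> ?X}"
    by (rule DU.definable_swap_indexed) (intro conjI tuples_appendI X enc_tuples[OF i]; assumption)
  then have "definable DU (w @ (w @ du_arity i)) {snd a @ (?p a @ enc i (fst a)) | a. a \<in> ?X}"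
    by simp
  then have "definable DU (du_arity i @ (w @ du_arity i)) {enc i (snd a) @ (?p a @ enc i (fst a)) | a. a \<in> ?X}"
    by (rule definable_enc_indexed[OF i, where m = "m'"]) (intro conjI tuples_appendI X enc_tuples[OF i]; assumption)
  then have "definable DU ((w @ du_arity i) @ du_arity i) {(?p a @ enc i (fst a)) @ enc i (snd a) | a. a \<in> ?X}"
    by (rule DU.definable_swap_indexed) (intro conjI tuples_appendI X enc_tuples[OF i]; assumption)
  then have "definable DU (w @ (du_arity i @ du_arity i)) {?p a @ (enc i (fst a) @ enc i (snd a)) | a. a \<in> ?X}"
    by simp
  then have "definable DU (du_arity i @ (du_arity i @ du_arity i))
      {enc i (?p a) @ (enc i (fst a) @ enc i (snd a)) | a. a \<in> ?X}"
    by (rule definable_enc_indexed[OF i, where m = "m + m'"]) (intro conjI tuples_appendI X enc_tuples[OF i]; assumption)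
  then have "definable DU ((du_arity i @ du_arity i) @ du_arity i)
      {(enc i (fst a) @ enc i (snd a)) @ enc i (?p a) | a. a \<in> ?X}"
    by (rule DU.definable_swap_indexed) (intro conjI tuples_appendI X enc_tuples[OF i]; assumption)
  moreover have "{(enc i (fst a) @ enc i (snd a)) @ enc i (?p a) | a. a \<in> ?X} =
      {enc i g @ enc i h @ enc i (g \<otimes> h) | g h. g \<in> level i m \<and> h \<in> level i m'}"
    by force
  ultimately show ?thesis by simp
qed

text \<open>Bounding each factor by a level gives the pieces of the product. Values outside
  \<open>{1..m}\<close> are arbitrary; \<open>finprod\<close> over \<open>{1..m}\<close> and
  \<open>join m\<close> do not see them.\<close>

definition fam :: "nat \<Rightarrow> (nat \<Rightarrow> nat) \<Rightarrow> (nat \<Rightarrow> 'a list) set" where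
  "fam m \<mu> = {g. \<forall>i\<in>{1..m}. g i \<in> level i (\<mu> i)}"

lemma famD: "g \<in> fam m \<mu> \<Longrightarrow> i \<in> {1..m} \<Longrightarrow> g i \<in> level i (\<mu> i)"
  by (simp add: fam_def)

lemma fam_carrier: "g \<in> fam m \<mu> \<Longrightarrow> g \<in> {1..m} \<rightarrow> carrier G"
  using level_carrier unfolding fam_def by blast

lemma join_enc_tuples:
  assumes "m \<le> n" "g \<in> fam m \<mu>"
  shows "join m (\<lambda>i. enc i (g i)) \<in> tuples DU (join m du_arity)"
proof (rule join_in_tuples)
  fix i assume i: "i \<in> {1..m}"
  then have "i \<in> {1..n}" using assms(1) by auto
  then show "enc i (g i) \<in> tuples DU (du_arity i)"
    using famD[OF assms(2) i] level_tuples by (intro enc_tuples) auto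
qed

text \<open>The product stands in front so that the next multiplication can be composed along it.
  The new factor is then brought to the front, encoded and rotated to the end, behind the codes
  already collected.\<close>

lemma definable_finprod_graph:
  "m \<le> n \<Longrightarrow> definable DU (w @ join m du_arity)
    {finprod G g {1..m} @ join m (\<lambda>i. enc i (g i)) | g. g \<in> fam m \<mu>}"
proof (induction m)
  case 0
  have "{finprod G g {1..0} @ join 0 (\<lambda>i. enc i (g i)) | g. g \<in> fam 0 \<mu>} = {\<one>}"
    by (auto simp: fam_def)
  then show ?case
    using DU.definable_single[of w \<one>] set_w carrier_tuples[OF one_closed] by (simp add: join_0)
next
  case (Suc m)
  let ?j = "Suc m" let ?l = "level ?j (\<mu> ?j)"
  have j: "?j \<in> {1..n}" using Suc.prems by auto
  let ?e = "\<lambda>g. join m (\<lambda>i. enc i (g i))" and ?s = "\<lambda>g. finprod G g {1..m}"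
  have T: "definable DU (w @ join m du_arity) {?s g @ ?e g | g. g \<in> fam m \<mu>}"
    using Suc by simp
  have s: "?s g \<in> carrier G" if "g \<in> fam m \<mu>" for g
    using fam_carrier[OF that] by (rule finprod_closed)
  have e: "?e g \<in> tuples DU (join m du_arity)" if "g \<in> fam m \<mu>" for g
    using Suc.prems that by (intro join_enc_tuples) auto
  have l: "h \<in> carrier G" "h \<in> tuples DU w" if "h \<in> ?l" for h
    using that level_carrier[of ?j] level_tuples by auto
  have a: "snd a \<in> ?l" "snd a \<in> tuples DU w" "?s (fst a) \<otimes> snd a \<in> tuples DU w"
    "?e (fst a) \<in> tuples DU (join m du_arity)" "enc ?j (snd a) \<in> tuples DU (du_arity ?j)"
    if "a \<in> fam m \<mu> \<times> ?l" for a
    using that s e l enc_tuples[OF j] carrier_tuples by auto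
  \<comment> \<open>The partial product mixes several subgroups, so its range is taken to be all of
    \<open>G\<close>; only the new factor is confined to a level.\<close>
  let ?Y = "carrier G \<times> ?l"
  have Z: "definable DU (w @ (w @ w)) {fst b @ (snd b @ (fst b \<otimes> snd b)) | b. b \<in> ?Y}"
  proof -
    have "{fst b @ (snd b @ (fst b \<otimes> snd b)) | b. b \<in> ?Y} =
        {g @ h @ (g \<otimes> h) | g h. g \<in> carrier G \<and> h \<in> ?l}"
      by force
    then show ?thesis
      using definable_mult_graph[OF definable_carrier definable_level[OF j] _ level_carrier] by simp
  qed
  have "definable DU (join m du_arity @ (w @ w)) {?e g @ (snd b @ (fst b \<otimes> snd b)) | g b.
      g \<in> fam m \<mu> \<and> b \<in> ?Y \<and> ?s g = fst b}"
    by (rule DU.definable_comp_indexed[OF T Z])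
       (use s e l carrier_tuples in \<open>auto intro!: tuples_appendI\<close>)
  also have "{?e g @ (snd b @ (fst b \<otimes> snd b)) | g b. g \<in> fam m \<mu> \<and> b \<in> ?Y \<and> ?s g = fst b} =
      {?e (fst a) @ (snd a @ (?s (fst a) \<otimes> snd a)) | a. a \<in> fam m \<mu> \<times> ?l}"
    using s by force
  finally have "definable DU ((w @ w) @ join m du_arity)
      {(snd a @ (?s (fst a) \<otimes> snd a)) @ ?e (fst a) | a. a \<in> fam m \<mu> \<times> ?l}"
    by (rule DU.definable_swap_indexed) (use a in \<open>intro conjI tuples_appendI; blast\<close>)
  then have "definable DU (w @ (w @ join m du_arity))
      {snd a @ ((?s (fst a) \<otimes> snd a) @ ?e (fst a)) | a. a \<in> fam m \<mu> \<times> ?l}"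
    by simp
  then have "definable DU (du_arity ?j @ (w @ join m du_arity))
      {enc ?j (snd a) @ ((?s (fst a) \<otimes> snd a) @ ?e (fst a)) | a. a \<in> fam m \<mu> \<times> ?l}"
    by (rule definable_enc_indexed[OF j, where m = "\<mu> ?j"]) (use a in \<open>intro conjI tuples_appendI; blast\<close>)
  then have "definable DU ((w @ join m du_arity) @ du_arity ?j)
      {((?s (fst a) \<otimes> snd a) @ ?e (fst a)) @ enc ?j (snd a) | a. a \<in> fam m \<mu> \<times> ?l}"
    by (rule DU.definable_swap_indexed) (use a in \<open>intro conjI tuples_appendI; blast\<close>)
  moreover have "{((?s (fst a) \<otimes> snd a) @ ?e (fst a)) @ enc ?j (snd a) | a. a \<in> fam m \<mu> \<times> ?l} =
      {finprod G g {1..?j} @ join ?j (\<lambda>i. enc i (g i)) | g. g \<in> fam ?j \<mu>}" (is "?L = ?R")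
  proof -
    have fin: "finprod G g {1..?j} = ?s g \<otimes> g ?j" if "g \<in> fam ?j \<mu>" for g
    proof -
      have c: "g \<in> {1..m} \<rightarrow> carrier G" "g ?j \<in> carrier G"
        using fam_carrier[OF that] by auto
      have "finprod G g (insert ?j {1..m}) = g ?j \<otimes> ?s g"
        using c by (intro finprod_insert) auto
      moreover have "?s g \<in> carrier G"
        using c(1) by (rule finprod_closed)
      ultimately show ?thesis
        using c m_comm by (simp add: atLeastAtMostSuc_conv)
    qed
    show ?thesis
    proof (intro Set.equalityI subsetI)
      fix z assume "z \<in> ?L"
      then obtain g h where z: "z = ((?s g \<otimes> h) @ ?e g) @ enc ?j h" "g \<in> fam m \<mu>" "h \<in> ?l"
        by auto
      let ?g = "g(?j := h)"
      have g: "?g \<in> fam ?j \<mu>"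
        using z by (auto simp: fam_def)
      have "?s ?g = ?s g"
        using fam_carrier[OF z(2)] by (intro finprod_cong') auto
      moreover have "?e ?g = ?e g"
        by (intro join_cong) auto
      ultimately have "z = finprod G ?g {1..?j} @ join ?j (\<lambda>i. enc i (?g i))"
        using z fin[OF g] by simp
      with g show "z \<in> ?R" by blast
    next
      fix z assume "z \<in> ?R"
      then obtain g where z: "z = finprod G g {1..?j} @ join ?j (\<lambda>i. enc i (g i))" "g \<in> fam ?j \<mu>"
        by blast
      then have "z = ((?s g \<otimes> g ?j) @ ?e g) @ enc ?j (g ?j)" "(g, g ?j) \<in> fam m \<mu> \<times> ?l"
        using fin[OF z(2)] by (auto simp: fam_def)
      then show "z \<in> ?L" by force
    qed
  qed
  ultimately show ?case by simp
qed

end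

section \<open>The product of the one-sorted subgroups\<close>

context du_group_gen
begin

definition S :: "nat \<Rightarrow> (unit, 'a) ld_data" where
  "S i = \<lparr>arity = code_arity i, pieces = range (\<lambda>m. enc i ` level i m)\<rparr>"

definition H :: "nat \<Rightarrow> 'a list monoid" where
  "H i = image_group (enc i) (G\<lparr>carrier := K i\<rparr>)"

lemma K_group: "group (G\<lparr>carrier := K i\<rparr>)"
  using K_subgroup by (rule subgroup_imp_group)

lemma K_closed: "g \<in> K i \<Longrightarrow> g \<in> carrier G"
  using K_carrier by blast

lemma K_funcset: "(\<And>i. i \<in> I \<Longrightarrow> g i \<in> K i) \<Longrightarrow> g \<in> I \<rightarrow> carrier G"
  by (intro Pi_I K_closed)

lemma level_in_K: "g \<in> level i m \<Longrightarrow> g \<in> K i"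
  using level_subset_K by blast

lemma carrier_H: "carrier (H i) = enc i ` K i"
  by (simp add: H_def image_group_def)

lemma points_S: "points (S i) = carrier (H i)"
  by (auto simp: points_def S_def carrier_H K_eq)

lemma enc_iso:
  assumes "i \<in> {1..n}"
  shows "group (H i)" "enc i \<in> iso (G\<lparr>carrier := K i\<rparr>) (H i)"
  unfolding H_def using group.image_group_iso[OF K_group, of "enc i" i] inj_enc[OF assms] by auto

lemma mult_H:
  assumes "i \<in> {1..n}" "g \<in> K i" "h \<in> K i"
  shows "enc i g \<otimes>\<^bsub>H i\<^esub> enc i h = enc i (g \<otimes> h)"
  using enc_iso(2)[OF assms(1)] assms(2,3) by (auto simp: iso_def hom_def)

lemma carrier_H_tuples: "i \<in> {1..n} \<Longrightarrow> x \<in> carrier (H i) \<Longrightarrow> x \<in> tuples DU (du_arity i)"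
  unfolding carrier_H using K_carrier carrier_tuples enc_tuples by blast

lemma definable_piece:
  assumes "i \<in> {1..n}"
  shows "definable (M i) (code_arity i) (enc i ` level i m)"
  using definable_trace[OF assms, of "code_arity i"] definable_enc_image[OF assms] by (simp add: du_arity_def)

text \<open>Multiplication sends levels \<open>m\<close> and \<open>m'\<close> into level
  \<open>m + m'\<close>, a single piece. Its graph on them is definable in the disjoint union and
  involves sort \<open>i\<close> only, so it is definable in \<open>M i\<close>.\<close>

lemma ld_group_H:
  assumes i: "i \<in> {1..n}"
  shows "ld_group (M i) (S i) (H i)"
proof -
  interpret Mi: fo_struct "M i"
    using i by (rule comp_fo_struct)
  let ?k = "length (code_arity i)"
  let ?f = "\<lambda>z. take ?k z \<otimes>\<^bsub>H i\<^esub> drop ?k z"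
  have len: "length (enc i g) = ?k" if "g \<in> level i m" for g m
    using length_tuples[OF enc_tuples[OF i level_tuples[OF that]]] by (simp add: du_arity_def)
  have f: "?f (enc i g @ enc i h) = enc i (g \<otimes> h)" if "g \<in> level i m" "h \<in> level i m'" for g h m m'
    using len[OF that(1)] mult_H[OF i level_in_K[OF that(1)] level_in_K[OF that(2)]] by simp
  have P: "\<exists>m m'. P = {enc i g @ enc i h | g h. g \<in> level i m \<and> h \<in> level i m'}"
    if P: "P \<in> pieces (ld_prod (S i) (S i))" for P
  proof -
    obtain A A' where "P = {x @ y | x y. x \<in> A \<and> y \<in> A'}" "A \<in> pieces (S i)" "A' \<in> pieces (S i)"
      using P unfolding ld_prod_def by auto
    then obtain m m' where "P = {x @ y | x y. x \<in> enc i ` level i m \<and> y \<in> enc i ` level i m'}"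
      by (auto simp: S_def)
    then have "P = {enc i g @ enc i h | g h. g \<in> level i m \<and> h \<in> level i m'}"
      by blast
    then show ?thesis by blast
  qed
  have arity: "set (code_arity i) \<subseteq> sorts (M i)"
    unfolding sorts_M[OF i] by (rule subsetI) (simp only: singleton_iff unit_eq)
  have "ld_function (M i) (ld_prod (S i) (S i)) (S i) ?f"
  proof (rule Mi.ld_functionI)
    fix P assume "P \<in> pieces (ld_prod (S i) (S i))"
    then obtain A A' where "P = {x @ y | x y. x \<in> A \<and> y \<in> A'}" "A \<in> pieces (S i)" "A' \<in> pieces (S i)"
      unfolding ld_prod_def by auto
    then show "definable (M i) (arity (ld_prod (S i) (S i))) P"
      using definable_piece[OF i] by (auto simp: S_def ld_prod_def intro!: Mi.definable_times)
  next
    fix P assume "P \<in> pieces (ld_prod (S i) (S i))"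
    then obtain m m' where P: "P = {enc i g @ enc i h | g h. g \<in> level i m \<and> h \<in> level i m'}"
      using P by blast
    have eq: "{z @ ?f z | z. z \<in> P} =
        {enc i g @ enc i h @ enc i (g \<otimes> h) | g h. g \<in> level i m \<and> h \<in> level i m'}"
    proof -
      have "{z @ ?f z | z. z \<in> P} =
          {(enc i g @ enc i h) @ ?f (enc i g @ enc i h) | g h. g \<in> level i m \<and> h \<in> level i m'}"
        unfolding P by blast
      also have "\<dots> = {enc i g @ enc i h @ enc i (g \<otimes> h) | g h. g \<in> level i m \<and> h \<in> level i m'}"
        by (rule Collect_cong) (metis append_assoc f)
      finally show ?thesis .
    qed
    have "definable (M i) (code_arity i @ code_arity i @ code_arity i) {z @ ?f z | z. z \<in> P}"
      unfolding eq using definable_enc_mult[OF i] by (intro definable_trace[OF i]) (simp add: du_arity_def)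
    then show "definable (M i) (arity (ld_prod (S i) (S i)) @ arity (S i)) {z @ ?f z | z. z \<in> P}"
      by (simp add: ld_prod_def S_def)
    have "?f ` P \<subseteq> enc i ` level i (m + m')"
      unfolding P using f level_mult by auto
    then show "\<exists>Q\<in>pieces (S i). ?f ` P \<subseteq> Q"
      by (auto simp: S_def)
  qed (use arity definable_piece[OF i] in \<open>auto simp: ld_prod_def S_def\<close>)
  moreover have "ld_set (M i) (S i)"
    using definable_piece[OF i] by (auto simp: ld_set_def S_def)
  ultimately show ?thesis
    using enc_iso(1)[OF i] points_S[of i] by (simp add: ld_group_def S_def)
qed

text \<open>The first level is the set of generators, and its code is one of the pieces.\<close>

lemma definably_generated_H:
  assumes i: "i \<in> {1..n}"
  shows "definably_generated (M i) (S i) (H i)"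
proof -
  interpret enc: group_hom "G\<lparr>carrier := K i\<rparr>" "H i" "enc i"
    using enc_iso[OF i] K_group by (auto simp: group_hom_def group_hom_axioms_def iso_def)
  have "generate (H i) (enc i ` sgens i) = enc i ` generate (G\<lparr>carrier := K i\<rparr>) (sgens i)"
    using level_subset_K[of i "Suc 0"] by (intro enc.generate_img) (simp only: level_1; simp)
  also have "generate (G\<lparr>carrier := K i\<rparr>) (sgens i) = K i"
    unfolding K_def[of i, symmetric]
    using generate_consistent[OF _ K_subgroup, of "sgens i" i] level_subset_K[of i "Suc 0"]
    by (simp only: level_1 K_def)
  finally have "generate (H i) (enc i ` level i (Suc 0)) = carrier (H i)"
    by (simp only: level_1 carrier_H)
  moreover have "definable_subset (M i) (S i) (enc i ` level i (Suc 0))"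
    unfolding definable_subset_def S_def using definable_piece[OF i, of "Suc 0"]
    by (intro conjI exI[of _ "{enc i ` level i (Suc 0)}"]) (auto simp del: level.simps)
  ultimately show ?thesis
    unfolding definably_generated_def by blast
qed

section \<open>The product group and its map onto the given group\<close>

abbreviation "PG \<equiv> product_ld_group n H"

definition encode :: "(nat \<Rightarrow> 'a list) \<Rightarrow> 'a list" where
  "encode g = join n (\<lambda>i. enc i (g i))"

lemma inj_join: "inj_on (join n) (\<Pi>\<^sub>E i\<in>{1..n}. carrier (H i))"
proof (rule inj_onI)
  fix x y assume xy: "x \<in> (\<Pi>\<^sub>E i\<in>{1..n}. carrier (H i))" "y \<in> (\<Pi>\<^sub>E i\<in>{1..n}. carrier (H i))"
    "join n x = join n y"
  have "length (x i) = length (y i)" if "i \<in> {1..n}" for i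
    using PiE_mem[OF xy(1) that] PiE_mem[OF xy(2) that]
    by (simp add: length_tuples[OF carrier_H_tuples[OF that]])
  then show "x = y"
    using xy by (intro PiE_ext[OF xy(1,2)] join_inject[OF _ xy(3)]) auto
qed

lemma encode_restrict:
  "encode g = join n (\<lambda>i\<in>{1..n}. enc i (g i))"
  unfolding encode_def by (rule join_cong) simp

lemma enc_PiE:
  "(\<And>i. i \<in> {1..n} \<Longrightarrow> g i \<in> K i) \<Longrightarrow> (\<lambda>i\<in>{1..n}. enc i (g i)) \<in> (\<Pi>\<^sub>E i\<in>{1..n}. carrier (H i))"
  by (auto simp: carrier_H)

lemma carrier_PG: "carrier PG = encode ` {g. \<forall>i\<in>{1..n}. g i \<in> K i}"
proof -
  have "carrier PG = join n ` (\<Pi>\<^sub>E i\<in>{1..n}. carrier (H i))"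
    by (simp add: product_ld_group_def image_group_def)
  also have "\<dots> = encode ` {g. \<forall>i\<in>{1..n}. g i \<in> K i}"
  proof (intro Set.equalityI subsetI)
    fix z assume "z \<in> join n ` (\<Pi>\<^sub>E i\<in>{1..n}. carrier (H i))"
    then obtain x where x: "z = join n x" "x \<in> (\<Pi>\<^sub>E i\<in>{1..n}. carrier (H i))"
      by blast
    have "\<exists>h. h \<in> K i \<and> x i = enc i h" if "i \<in> {1..n}" for i
      using PiE_mem[OF x(2) that] unfolding carrier_H by blast
    then obtain g where g: "\<And>i. i \<in> {1..n} \<Longrightarrow> g i \<in> K i \<and> x i = enc i (g i)"
      by metis
    then have "z = encode g"
      unfolding encode_def x(1) by (intro join_cong) auto
    with g show "z \<in> encode ` {g. \<forall>i\<in>{1..n}. g i \<in> K i}"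
      by auto
  next
    fix z assume "z \<in> encode ` {g. \<forall>i\<in>{1..n}. g i \<in> K i}"
    then show "z \<in> join n ` (\<Pi>\<^sub>E i\<in>{1..n}. carrier (H i))"
      using enc_PiE by (auto simp: encode_restrict)
  qed
  finally show ?thesis .
qed

lemma group_PG: "group PG"
  unfolding product_ld_group_def
  by (intro group.image_group_iso(1) product_group enc_iso(1)) (use inj_join in auto)

lemma inv_join:
  assumes "\<And>i. i \<in> {1..n} \<Longrightarrow> g i \<in> K i"
  shows "inv_into (\<Pi>\<^sub>E i\<in>{1..n}. carrier (H i)) (join n) (encode g) = (\<lambda>i\<in>{1..n}. enc i (g i))"
  unfolding encode_restrict using inj_join enc_PiE[of g] assms by (intro inv_into_f_f) auto

lemma mult_PG:
  assumes "\<And>i. i \<in> {1..n} \<Longrightarrow> g i \<in> K i" "\<And>i. i \<in> {1..n} \<Longrightarrow> h i \<in> K i"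
  shows "encode g \<otimes>\<^bsub>PG\<^esub> encode h = encode (\<lambda>i. g i \<otimes> h i)"
proof -
  have "encode g \<otimes>\<^bsub>PG\<^esub> encode h = join n (\<lambda>i\<in>{1..n}. (\<lambda>i\<in>{1..n}. enc i (g i)) i \<otimes>\<^bsub>H i\<^esub>
      (\<lambda>i\<in>{1..n}. enc i (h i)) i)"
    using inv_join[of g] inv_join[of h] assms by (simp add: product_ld_group_def image_group_def)
  also have "\<dots> = encode (\<lambda>i. g i \<otimes> h i)"
    unfolding encode_def using assms by (intro join_cong) (simp add: mult_H)
  finally show ?thesis .
qed

text \<open>The product map: the two inverse functions cut a tuple into its blocks and decode them.
  Further facts about it go through \<open>f_encode\<close>.\<close>

definition f :: "'a list \<Rightarrow> 'a list" where
  "f z = finprod G (\<lambda>i. inv_into (K i) (enc i)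
    (inv_into (\<Pi>\<^sub>E i\<in>{1..n}. carrier (H i)) (join n) z i)) {1..n}"

lemma f_encode:
  assumes "\<And>i. i \<in> {1..n} \<Longrightarrow> g i \<in> K i"
  shows "f (encode g) = finprod G g {1..n}"
proof -
  have "f (encode g) = finprod G (\<lambda>i. inv_into (K i) (enc i)
      ((\<lambda>i\<in>{1..n}. enc i (g i)) i)) {1..n}"
    using inv_join[of g] assms by (simp add: f_def)
  also have "\<dots> = finprod G g {1..n}"
    using K_funcset[of "{1..n}" g] assms
    by (intro finprod_cong') (simp_all add: inv_into_f_f[OF inj_enc])
  finally show ?thesis .
qed

lemma f_hom: "f \<in> hom PG G"
proof (rule homI)
  fix x assume "x \<in> carrier PG"
  then show "f x \<in> carrier G"
  proof -
    obtain g where "x = encode g" "\<And>i. i \<in> {1..n} \<Longrightarrow> g i \<in> K i"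
      using \<open>x \<in> carrier PG\<close> unfolding carrier_PG by auto
    then show ?thesis
      using f_encode[of g] K_funcset[of "{1..n}" g] finprod_closed by simp
  qed
next
  fix x y assume "x \<in> carrier PG" "y \<in> carrier PG"
  then obtain g h where gh: "x = encode g" "y = encode h"
    "\<And>i. i \<in> {1..n} \<Longrightarrow> g i \<in> K i" "\<And>i. i \<in> {1..n} \<Longrightarrow> h i \<in> K i"
    unfolding carrier_PG by auto
  have "f (x \<otimes>\<^bsub>PG\<^esub> y) = f (encode (\<lambda>i. g i \<otimes> h i))"
    unfolding gh(1,2) using mult_PG[of g h] gh(3,4) by simp
  also have "\<dots> = finprod G (\<lambda>i. g i \<otimes> h i) {1..n}"
    by (rule f_encode) (intro subgroup.m_closed[OF K_subgroup] gh(3,4))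
  \<comment> \<open>Factors of different subgroups are interchanged here: the product map is a
    homomorphism because \<open>G\<close> is abelian.\<close>
  also have "\<dots> = finprod G g {1..n} \<otimes> finprod G h {1..n}"
    using gh(3,4) by (intro finprod_multf K_funcset)
  also have "\<dots> = f x \<otimes> f y"
    unfolding gh using f_encode[of g] f_encode[of h] gh(3,4) by simp
  finally show "f (x \<otimes>\<^bsub>PG\<^esub> y) = f x \<otimes> f y" .
qed

sublocale f: group_hom PG G f
  using group_PG f_hom by (simp add: group_hom_def group_hom_axioms_def)

lemma f_surj: "f ` carrier PG = carrier G"
proof
  show "f ` carrier PG \<subseteq> carrier G"
    by auto
  have sub: "subgroup (f ` carrier PG) G"
    by (rule f.img_is_subgroup)
  have "E i \<subseteq> f ` carrier PG" if i: "i \<in> {1..n}" for i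
  proof
    fix g assume g: "g \<in> E i"
    \<comment> \<open>The generator is placed at position \<open>i\<close> and padded with
      \<open>\<one>\<close>.\<close>
    let ?g = "\<lambda>j. if j = i then g else \<one>"
    have K: "?g j \<in> K j" for j
      using g E_subset_K[of i] subgroup.one_closed[OF K_subgroup] by auto
    then have "f (encode ?g) = finprod G ?g {1..n}"
      by (intro f_encode) auto
    also have "\<dots> = g"
      using finprod_singleton_swap[OF i, of "\<lambda>_. g"] g by (auto simp: E_def)
    finally have "g = f (encode ?g)" ..
    then show "g \<in> f ` carrier PG"
      by (rule image_eqI) (use K in \<open>auto simp: carrier_PG\<close>)
  qed
  then have "gen_by B \<subseteq> f ` carrier PG"
    unfolding gen_by_def E_def[symmetric] using sub by (intro generate_subgroup_incl UN_least)
  then show "carrier G \<subseteq> f ` carrier PG"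
    using carrier_gen by simp
qed

lemma fam_K: "g \<in> fam n \<mu> \<Longrightarrow> i \<in> {1..n} \<Longrightarrow> g i \<in> K i"
  using famD level_subset_K by blast

lemma f_fam: "g \<in> fam n \<mu> \<Longrightarrow> f (encode g) = finprod G g {1..n}"
  by (rule f_encode) (rule fam_K)

lemma arity_ld_product: "arity (ld_product n S) = join n du_arity"
  unfolding ld_product_def by (simp add: S_def du_arity_def[abs_def])

lemma pieces_ld_product: "pieces (ld_product n S) = range (\<lambda>\<mu>. encode ` fam n \<mu>)"
proof -
  have *: "join n ` (\<Pi>\<^sub>E i\<in>{1..n}. P i) = encode ` fam n \<mu>"
    if P: "\<And>i. i \<in> {1..n} \<Longrightarrow> P i = enc i ` level i (\<mu> i)" for P \<mu>
  proof (intro Set.equalityI subsetI)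
    fix z assume "z \<in> join n ` (\<Pi>\<^sub>E i\<in>{1..n}. P i)"
    then obtain x where x: "z = join n x" "x \<in> (\<Pi>\<^sub>E i\<in>{1..n}. P i)"
      by blast
    have "\<exists>h. h \<in> level i (\<mu> i) \<and> x i = enc i h" if "i \<in> {1..n}" for i
      using PiE_mem[OF x(2) that] unfolding P[OF that] by blast
    then obtain g where g: "\<And>i. i \<in> {1..n} \<Longrightarrow> g i \<in> level i (\<mu> i) \<and> x i = enc i (g i)"
      by metis
    then have "z = encode g"
      unfolding encode_def x(1) by (intro join_cong) auto
    with g show "z \<in> encode ` fam n \<mu>"
      by (auto simp: fam_def)
  next
    fix z assume "z \<in> encode ` fam n \<mu>"
    then obtain g where g: "z = encode g" "g \<in> fam n \<mu>" by blast
    have "(\<lambda>i\<in>{1..n}. enc i (g i)) \<in> (\<Pi>\<^sub>E i\<in>{1..n}. P i)"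
      using P famD[OF g(2)] by auto
    then show "z \<in> join n ` (\<Pi>\<^sub>E i\<in>{1..n}. P i)"
      unfolding g(1) encode_restrict by blast
  qed
  show ?thesis
  proof (intro Set.equalityI subsetI)
    fix z assume "z \<in> pieces (ld_product n S)"
    then obtain P where P: "z = join n ` (\<Pi>\<^sub>E i\<in>{1..n}. P i)" "\<forall>i\<in>{1..n}. P i \<in> pieces (S i)"
      unfolding ld_product_def by auto
    have "\<exists>m. P i = enc i ` level i m" if "i \<in> {1..n}" for i
      using bspec[OF P(2) that] by (auto simp: S_def)
    then obtain \<mu> where "\<And>i. i \<in> {1..n} \<Longrightarrow> P i = enc i ` level i (\<mu> i)"
      by metis
    then show "z \<in> range (\<lambda>\<mu>. encode ` fam n \<mu>)"
      unfolding P(1) using * by blast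
  next
    fix z assume "z \<in> range (\<lambda>\<mu>. encode ` fam n \<mu>)"
    then obtain \<mu> where "z = join n ` (\<Pi>\<^sub>E i\<in>{1..n}. enc i ` level i (\<mu> i))"
      using *[of "\<lambda>i. enc i ` level i (_ i)"] by auto
    then show "z \<in> pieces (ld_product n S)"
      by (auto simp: ld_product_def S_def)
  qed
qed

lemma set_join_du_arity: "set (join n du_arity) \<subseteq> {1..n}"
  unfolding join_def by (auto simp: du_arity_def)

lemma encode_tuples: "g \<in> fam n \<mu> \<Longrightarrow> encode g \<in> tuples DU (join n du_arity)"
  unfolding encode_def by (intro join_enc_tuples) auto

lemma finprod_closed_fam: "g \<in> fam n \<mu> \<Longrightarrow> finprod G g {1..n} \<in> carrier G"
  by (intro finprod_closed fam_carrier)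

lemma definable_f_graph:
  "definable DU (join n du_arity @ w) {x @ f x | x. x \<in> encode ` fam n \<mu>}"
proof -
  have "definable DU (join n du_arity @ w) {encode g @ finprod G g {1..n} | g. g \<in> fam n \<mu>}"
    using definable_finprod_graph[OF order_refl, of \<mu>] unfolding encode_def[symmetric]
    by (rule DU.definable_swap_indexed)
       (intro conjI encode_tuples carrier_tuples finprod_closed_fam; assumption)
  also have "{encode g @ finprod G g {1..n} | g. g \<in> fam n \<mu>} = {x @ f x | x. x \<in> encode ` fam n \<mu>}"
    using f_fam by fastforce
  finally show ?thesis .
qed

text \<open>The graph of the product map on a piece is already known to be definable; projecting the
  product away leaves the piece.\<close>

lemma definable_ld_product_piece: "definable DU (join n du_arity) (encode ` fam n \<mu>)"
proof -
  have "{y. \<exists>x\<in>tuples DU w. x @ y \<in> {finprod G g {1..n} @ encode g | g. g \<in> fam n \<mu>}} =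
      encode ` fam n \<mu>" (is "?L = ?R")
  proof (intro Set.equalityI subsetI)
    fix y assume "y \<in> ?L"
    then obtain x g where *: "x \<in> tuples DU w" "x @ y = finprod G g {1..n} @ encode g" "g \<in> fam n \<mu>"
      by blast
    then show "y \<in> ?R"
      using tuples_append_eqD(2)[OF *(2,1) carrier_tuples[OF finprod_closed_fam[OF *(3)]]] by blast
  next
    fix y assume "y \<in> ?R"
    then show "y \<in> ?L"
      using carrier_tuples[OF finprod_closed_fam] by blast
  qed
  moreover have "definable DU (w @ join n du_arity) {finprod G g {1..n} @ encode g | g. g \<in> fam n \<mu>}"
    using definable_finprod_graph[of n \<mu>] by (simp add: encode_def)
  ultimately show ?thesis
    using DU.definable_proj by fastforce
qed

lemma f_ld_hom: "ld_hom DU (ld_product n S) PG (single w (carrier G)) G f"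
proof -
  have "ld_function DU (ld_product n S) (single w (carrier G)) f"
  proof (rule DU.ld_functionI)
    fix P assume "P \<in> pieces (ld_product n S)"
    then obtain \<mu> where P: "P = encode ` fam n \<mu>"
      unfolding pieces_ld_product by blast
    show "definable DU (arity (ld_product n S)) P"
      unfolding P arity_ld_product by (rule definable_ld_product_piece)
    show "definable DU (arity (ld_product n S) @ arity (single w (carrier G))) {x @ f x | x. x \<in> P}"
      unfolding P arity_ld_product single_def using definable_f_graph by simp
    have "f ` P \<subseteq> carrier G"
      unfolding P using f_fam finprod_closed_fam by auto
    then show "\<exists>Q\<in>pieces (single w (carrier G)). f ` P \<subseteq> Q"
      by (simp add: single_def)
  qed (use definable_carrier set_join_du_arity set_w in \<open>auto simp: single_def arity_ld_product\<close>)
  with f_hom show ?thesis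
    by (simp add: ld_hom_def)
qed

section \<open>Discreteness of the kernel\<close>

text \<open>
  Orthogonality: for \<open>j \<noteq> i\<close> the elements of a piece of \<open>K j\<close> have finitely many entries of sort
  \<open>i\<close>. So if a product of such elements is \<open>\<one>\<close>, then its \<open>i\<close>-th factor, the inverse of the product
  of the other ones, takes finitely many values.
\<close>

lemma finite_u_finprod:
  assumes i: "i \<in> {1..n}" and J: "finite J" "J \<subseteq> {1..n} - {i}"
  shows "finite (u i ` (\<lambda>g. finprod G g J) ` fam n \<mu>)"
  using J
proof (induction J rule: finite_induct)
  case empty
  then show ?case
    by (auto intro: finite_subset[of _ "{u i \<one>}"])
next
  case (insert j J)
  obtain L where "rect_group G (u i) (v i) L"
    using rect[OF i] by blast
  then interpret r: rect_group G "u i" "v i" L .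
  have j: "j \<in> {1..n}" "j \<noteq> i"
    using insert.prems by auto
  have g: "g \<in> J \<rightarrow> carrier G" "g j \<in> level j (\<mu> j)" "g j \<in> carrier G" if "g \<in> fam n \<mu>" for g
    using fam_carrier[OF that] famD[OF that j(1)] insert.prems j by auto
  let ?T = "(\<lambda>g. finprod G g J) ` fam n \<mu>"
  \<comment> \<open>As \<open>i\<close> differs from \<open>j\<close>, the entries of sort
    \<open>i\<close> are among those recorded by \<open>v j\<close>, which takes finitely many
    values on a level of \<open>j\<close>.\<close>
  have "sel (\<lambda>s. s = i) (filter (\<lambda>s. \<not> s = j) w) (v j x) = u i x" if "x \<in> level j (\<mu> j)" for x
    using j(2) length_tuples[OF level_tuples[OF that]] by (intro sel_sel) auto
  then have "u i ` level j (\<mu> j) = sel (\<lambda>s. s = i) (filter (\<lambda>s. \<not> s = j) w) ` v j ` level j (\<mu> j)"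
    by (simp add: image_image cong: image_cong)
  then have "finite (u i ` level j (\<mu> j))"
    using finite_v_level[OF j(1)] by simp
  moreover have "finite (u i ` ?T)"
    using insert by simp
  moreover have "?T \<subseteq> carrier G"
    using g by (auto intro: finprod_closed)
  ultimately have "finite (u i ` (level j (\<mu> j) <#> ?T))"
    by (intro r.finite_u_mult level_carrier)
  moreover have "finprod G g (insert j J) \<in> level j (\<mu> j) <#> ?T" if "g \<in> fam n \<mu>" for g
    using that g[OF that] insert.hyps by (auto simp: set_mult_eq)
  ultimately show ?case
    by (elim finite_subset[rotated]) auto
qed

lemma finite_kernel_piece: "finite (kernel PG G f \<inter> encode ` fam n \<mu>)"
proof -
  let ?N = "{g \<in> fam n \<mu>. finprod G g {1..n} = \<one>}"
  have fin: "finite ((\<lambda>g. g i) ` ?N)" if i: "i \<in> {1..n}" for i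
  proof -
    obtain L where "rect_group G (u i) (v i) L"
      using rect[OF i] by blast
    then interpret r: rect_group G "u i" "v i" L .
    let ?J = "{1..n} - {i}"
    let ?T = "(\<lambda>g. finprod G g ?J) ` fam n \<mu>"
    have c: "g \<in> ?J \<rightarrow> carrier G" "g i \<in> carrier G" if "g \<in> fam n \<mu>" for g
      using fam_carrier[OF that] i by auto
    then have T: "?T \<subseteq> carrier G"
      by (auto intro: finprod_closed)
    have "g i \<in> m_inv G ` ?T" if "g \<in> ?N" for g
    proof -
      have "insert i ?J = {1..n}"
        using i by auto
      then have "finprod G g {1..n} = g i \<otimes> finprod G g ?J"
        using finprod_insert[of ?J i g] c that by simp
      then have "g i = inv (finprod G g ?J)"
        using that c T by (intro inv_equality[symmetric]) (auto intro: finprod_closed)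
      then show ?thesis
        using that by auto
    qed
    then have "u i ` (\<lambda>g. g i) ` ?N \<subseteq> u i ` m_inv G ` ?T"
      by auto
    then have "finite (u i ` (\<lambda>g. g i) ` ?N)"
      by (rule finite_subset) (use finite_u_finprod[OF i] T in \<open>auto intro!: r.finite_u_inv\<close>)
    moreover have "finite (v i ` (\<lambda>g. g i) ` ?N)"
      by (rule finite_subset[OF _ finite_v_level[OF i, of "\<mu> i"]]) (use famD i in auto)
    ultimately have "finite (u i ` (\<lambda>g. g i) ` ?N \<times> v i ` (\<lambda>g. g i) ` ?N)"
      by simp
    then show ?thesis
    proof (rule inj_on_finite[rotated 2])
      show "inj_on (\<lambda>x. (u i x, v i x)) ((\<lambda>g. g i) ` ?N)"
        using r.uv_inject c by (auto intro!: inj_onI)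
    qed auto
  qed
  have "kernel PG G f \<inter> encode ` fam n \<mu> \<subseteq> encode ` (\<Pi>\<^sub>E i\<in>{1..n}. (\<lambda>g. g i) ` ?N)"
  proof
    fix z assume z: "z \<in> kernel PG G f \<inter> encode ` fam n \<mu>"
    then obtain g where g: "z = encode g" "g \<in> fam n \<mu>" by blast
    then have "g \<in> ?N"
      using z f_fam[OF g(2)] by (auto simp: kernel_def)
    then have "restrict g {1..n} \<in> (\<Pi>\<^sub>E i\<in>{1..n}. (\<lambda>g. g i) ` ?N)"
      by auto
    \<comment> \<open>Families in \<open>fam\<close> are unconstrained outside
      \<open>{1..n}\<close>; only after restriction do they range over a finite set, and the code
      does not change.\<close>
    moreover have "z = encode (restrict g {1..n})"
      unfolding g(1) encode_def by (rule join_cong) simp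
    ultimately show "z \<in> encode ` (\<Pi>\<^sub>E i\<in>{1..n}. (\<lambda>g. g i) ` ?N)"
      by blast
  qed
  then show ?thesis
    by (rule finite_subset) (intro finite_imageI finite_PiE fin; simp)
qed

lemma kernel_tuples: "kernel PG G f \<subseteq> tuples DU (join n du_arity)"
proof
  fix z assume "z \<in> kernel PG G f"
  then obtain g where g: "z = encode g" "\<And>i. i \<in> {1..n} \<Longrightarrow> g i \<in> K i"
    by (auto simp: kernel_def carrier_PG)
  show "z \<in> tuples DU (join n du_arity)"
    unfolding g(1) encode_def using g(2) carrier_H_tuples
    by (intro join_in_tuples) (auto simp: carrier_H)
qed

text \<open>Levels increase, so the largest of finitely many bounds serves for all factors. Constant
  bounds index countably many pieces, whereas the functions \<open>\<mu>\<close> are uncountable in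
  number.\<close>

lemma kernel_const_piece:
  assumes "z \<in> kernel PG G f"
  shows "\<exists>m. z \<in> encode ` fam n (\<lambda>_. m)"
proof -
  obtain g where g: "z = encode g" "\<And>i. i \<in> {1..n} \<Longrightarrow> \<exists>m. g i \<in> level i m"
    using assms by (auto simp: kernel_def carrier_PG K_eq)
  then obtain \<mu> where \<mu>: "\<And>i. i \<in> {1..n} \<Longrightarrow> g i \<in> level i (\<mu> i)"
    by metis
  have "g i \<in> level i (Max (\<mu> ` {1..n}))" if "i \<in> {1..n}" for i
    using \<mu>[OF that] level_mono[of "\<mu> i" "Max (\<mu> ` {1..n})" i] that by auto
  then have "g \<in> fam n (\<lambda>_. Max (\<mu> ` {1..n}))"
    unfolding fam_def by blast
  then show ?thesis
    using g(1) by blast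
qed

lemma finite_kernel_Int:
  assumes "definable_subset DU (ld_product n S) D"
  shows "finite (kernel PG G f \<inter> D)"
proof -
  obtain F where F: "finite F" "F \<subseteq> pieces (ld_product n S)" "D \<subseteq> \<Union>F"
    using assms unfolding definable_subset_def by blast
  have "finite (\<Union>P\<in>F. kernel PG G f \<inter> P)"
  proof (rule finite_UN_I[OF F(1)])
    fix P assume "P \<in> F"
    then obtain \<mu> where "P = encode ` fam n \<mu>"
      using F(2) unfolding pieces_ld_product by blast
    then show "finite (kernel PG G f \<inter> P)"
      using finite_kernel_piece by simp
  qed
  then show ?thesis
    by (rule finite_subset[rotated]) (use F(3) in blast)
qed

text \<open>Finite sets are definable with parameters, so compatibility follows from the finiteness
  of the intersections.\<close>

lemma definable_subset_kernel:
  assumes "definable_subset DU (ld_product n S) D"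
  shows "definable_subset DU (ld_product n S) (kernel PG G f \<inter> D)"
  using finite_kernel_Int[OF assms] assms kernel_tuples set_join_du_arity
  unfolding definable_subset_def arity_ld_product
  by (auto intro!: DU.definable_finite)

lemma definable_subset_piece: "definable_subset DU (ld_product n S) (encode ` fam n \<mu>)"
  unfolding definable_subset_def arity_ld_product pieces_ld_product
  by (intro conjI definable_ld_product_piece exI[of _ "{encode ` fam n \<mu>}"]) auto

lemma kernel_ld_subset: "ld_subset DU (ld_product n S) (kernel PG G f)"
  unfolding ld_subset_def
proof (intro exI[of _ "range (\<lambda>m. kernel PG G f \<inter> encode ` fam n (\<lambda>_. m))"] conjI ballI)
  fix Q assume "Q \<in> range (\<lambda>m. kernel PG G f \<inter> encode ` fam n (\<lambda>_. m))"
  then show "definable_subset DU (ld_product n S) Q"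
    using definable_subset_kernel[OF definable_subset_piece] by auto
next
  show "kernel PG G f = \<Union> (range (\<lambda>m. kernel PG G f \<inter> encode ` fam n (\<lambda>_. m)))"
    using kernel_const_piece by blast
qed auto

lemma kernel_compatible: "compatible_subset DU (ld_product n S) (kernel PG G f)"
proof -
  have "kernel PG G f \<subseteq> points (ld_product n S)"
    unfolding points_def pieces_ld_product using kernel_const_piece by blast
  then show ?thesis
    unfolding compatible_subset_def using definable_subset_kernel by blast
qed

lemma kernel_discrete: "discrete_subset DU (ld_product n S) (kernel PG G f)"
  unfolding discrete_subset_def using kernel_compatible finite_kernel_Int by blast

end

theorem theorem9p2:
  fixes n :: nat
    and M :: "nat \<Rightarrow> (unit, 'a) fo_structure"
    and w :: "nat list"
    and G :: "'a list monoid"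
  assumes "\<And>i. i \<in> {1..n} \<Longrightarrow> o_minimal (M i)"
    and "definable_group (disjoint_union n M) w G"
    and "comm_group G"
  shows "\<exists>S H \<Gamma> f.
      (\<forall>i\<in>{1..n}. ld_group (M i) (S i) (H i) \<and> definably_generated (M i) (S i) (H i)) \<and>
      subgroup \<Gamma> (product_ld_group n H) \<and>
      ld_subset (disjoint_union n M) (ld_product n S) \<Gamma> \<and>
      compatible_subset (disjoint_union n M) (ld_product n S) \<Gamma> \<and>
      discrete_subset (disjoint_union n M) (ld_product n S) \<Gamma> \<and>
      ld_hom (disjoint_union n M) (ld_product n S) (product_ld_group n H)
        (single w (carrier G)) G f \<and>
      f ` carrier (product_ld_group n H) = carrier G \<and>
      kernel (product_ld_group n H) G f = \<Gamma>"
proof -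
  have "n \<noteq> 0"
  proof
    assume "n = 0"
    \<comment> \<open>Without sorts there are no well-formed formulas, so that not even \<open>{[]}\<close> is definable.\<close>
    then have no_fm: "\<not> wf_fm (disjoint_union n M) [] \<phi>" for \<phi>
      by (induction \<phi>) (auto simp: disjoint_union_def elim: wf_tm.elims)
    have "definable (disjoint_union n M) w (carrier G)"
      using assms(2) by (simp add: definable_group_def)
    with \<open>n = 0\<close> no_fm show False
      by (auto simp: definable_def disjoint_union_def)
  qed
  interpret comm_group G by (rule assms(3))
  interpret du_group n M G w
    using assms \<open>n \<noteq> 0\<close> by unfold_locales auto
  obtain B where "\<forall>i\<in>{1..n}. finite (B i)" "carrier G = gen_by B"
    using carrier_generated by blast
  then interpret du_group_gen n M G w B
    by unfold_locales auto
  show ?thesis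
    using ld_group_H definably_generated_H f.subgroup_kernel kernel_ld_subset kernel_compatible
      kernel_discrete f_ld_hom f_surj
    by (intro exI[of _ S] exI[of _ H] exI[of _ "kernel PG G f"] exI[of _ f]) auto
qed

end
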